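(* Let $V$ be the ground model, let $\mathbb{P}\in V$ be a notion of forcing adding a Cohen real over $V$, and let $\mathcal{A}\in V$ be an infinite Boolean algebra. Then for every $\mathbb{P}$-generic filter $G$ over $V$, the Stone space $St(\mathcal{A})$ as computed in $V[G]$ contains a non-trivial convergent sequence.
   Context: A real $x\in 2^\omega\cap V[G]$ is Cohen over $V$ if for every dense subset $D\in V$ of the poset $Fn(\omega,2)$ of finite partial functions $\omega\to2$ ordered by reverse inclusion, there is $p\in D$ with $p\subseteq x$. $St(\mathcal{A})$ is the space of ultrafilters on $\mathcal{A}$ with the Stone topology. A sequence $(x_n)$ in a space is non-trivial if its terms are pairwise distinct and, if it converges, no term equals its limit. *)

theory Defs
  imports Main
begin

section \<open>The ambient universe of sets\<close>

text \<open>
  The sets of the background set theory in which transitive models and their generic extensions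
  live. \<open>elts x\<close> is the collection of members of \<open>x\<close>. Replacement is second order and
  contains separation. Neither power sets nor an infinite set are required, so that, for instance,
  the hereditarily countable sets qualify.
\<close>

class set_universe =
  fixes elts :: "'a \<Rightarrow> 'a set"
  assumes elts_ext: "elts x = elts y \<Longrightarrow> x = y"
    and wf_elts: "wf {(x, y). x \<in> elts y}"
    and pairing: "\<exists>z. elts z = {x, y}"
    and union: "\<exists>z. elts z = (\<Union>y \<in> elts x. elts y)"
    and replacement: "\<exists>z. elts z = f ` (elts x \<inter> X)"

text \<open>Meaningful only when \<open>X\<close> is the collection of members of some set.\<close>

definition set_of :: "'a::set_universe set \<Rightarrow> 'a" where
  "set_of X = (THE x. elts x = X)"

lemma elts_set_of: "elts x = X \<Longrightarrow> elts (set_of X) = X"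
  unfolding set_of_def by (rule theI2[where a = x]) (auto intro: elts_ext)

definition opair :: "'a::set_universe \<Rightarrow> 'a \<Rightarrow> 'a" where
  "opair x y = set_of {set_of {x, x}, set_of {x, y}}"

lemma elts_set_of_pair: "elts (set_of {x, y}) = {x, y}"
  using pairing[of x y] elts_set_of by blast

lemma opair_eq_iff: "opair x y = opair u v \<longleftrightarrow> x = u \<and> y = v"
proof
  assume "opair x y = opair u v"
  then have "{set_of {x, x}, set_of {x, y}} = {set_of {u, u}, set_of {u, v}}"
    unfolding opair_def by (metis elts_set_of_pair)
  then have "elts ` {set_of {x, x}, set_of {x, y}} = elts ` {set_of {u, u}, set_of {u, v}}"
    by (rule arg_cong)
  then have "{{x, x}, {x, y}} = {{u, u}, {u, v}}"
    by (simp only: image_insert image_empty elts_set_of_pair)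
  then show "x = u \<and> y = v"
    by (auto simp: doubleton_eq_iff)
qed simp

lemma opair_fst_below:
  assumes "opair x y \<in> elts t"
  shows "(x, t) \<in> {(x, y). x \<in> elts y}\<^sup>+"
proof -
  have "x \<in> elts (set_of {x, x})" "set_of {x, x} \<in> elts (opair x y)"
    by (simp_all add: opair_def elts_set_of_pair del: insert_absorb2)
  then have "(x, set_of {x, x}) \<in> {(x, y). x \<in> elts y}"
      "(set_of {x, x}, opair x y) \<in> {(x, y). x \<in> elts y}"
      "(opair x y, t) \<in> {(x, y). x \<in> elts y}"
    using assms by simp_all
  then show ?thesis
    by (rule trancl_into_trancl[OF trancl_into_trancl[OF r_into_trancl]])
qed

text \<open>The von Neumann numerals.\<close>

primrec num :: "nat \<Rightarrow> 'a::set_universe" where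
  "num 0 = set_of {}"
| "num (Suc n) = set_of (insert (num n) (elts (num n)))"

lemma elts_num: "elts (num n) = num ` {..<n}"
proof (induction n)
  case 0
  have "\<exists>z. elts z = (id :: 'a \<Rightarrow> 'a) ` (elts undefined \<inter> {})"
    by (rule replacement)
  then obtain z :: 'a where "elts z = {}"
    by auto
  then show ?case
    using elts_set_of[of z "{}"] by simp
next
  case (Suc n)
  obtain s :: 'a where s: "elts s = {num n, num n}"
    using pairing by blast
  obtain p where p: "elts p = {s, num n}"
    using pairing by blast
  have "\<exists>z. elts z = (\<Union>y \<in> elts p. elts y)"
    by (rule union)
  then obtain z :: 'a where "elts z = insert (num n) (elts (num n))"
    using s p by auto
  then have "elts (num (Suc n) :: 'a) = insert (num n) (elts (num n))"
    unfolding num.simps by (rule elts_set_of)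
  then show ?case
    by (simp add: Suc lessThan_Suc)
qed

definition is_fun :: "'a::set_universe \<Rightarrow> 'a set \<Rightarrow> 'a set \<Rightarrow> bool" where
  "is_fun f X Y \<longleftrightarrow>
     (\<forall>z \<in> elts f. \<exists>x \<in> X. \<exists>y \<in> Y. z = opair x y) \<and> (\<forall>x \<in> X. \<exists>!y. opair x y \<in> elts f)"

definition app :: "'a::set_universe \<Rightarrow> 'a \<Rightarrow> 'a" where
  "app f x = (THE y. opair x y \<in> elts f)"


section \<open>Transitive models of ZFC\<close>

text \<open>First-order formulas of the language of set theory, with de Bruijn indices.\<close>

datatype fm = Mem nat nat | Eq nat nat | Neg fm | Conj fm fm | All fm

primrec sat :: "'a::set_universe set \<Rightarrow> (nat \<Rightarrow> 'a) \<Rightarrow> fm \<Rightarrow> bool" where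
  "sat M e (Mem i j) \<longleftrightarrow> e i \<in> elts (e j)"
| "sat M e (Eq i j) \<longleftrightarrow> e i = e j"
| "sat M e (Neg \<phi>) \<longleftrightarrow> \<not> sat M e \<phi>"
| "sat M e (Conj \<phi> \<psi>) \<longleftrightarrow> sat M e \<phi> \<and> sat M e \<psi>"
| "sat M e (All \<phi>) \<longleftrightarrow> (\<forall>x \<in> M. sat M (case_nat x e) \<phi>)"

text \<open>
  The finitely many single axioms are written out as their relativizations to \<open>M\<close>; the schemes
  range over all formulas, with parameters from \<open>M\<close>.
\<close>

definition models_ZFC :: "'a::set_universe set \<Rightarrow> bool" where
  "models_ZFC M \<longleftrightarrow>
     \<comment> \<open>extensionality\<close>
     (\<forall>x \<in> M. \<forall>y \<in> M. (\<forall>z \<in> M. z \<in> elts x \<longleftrightarrow> z \<in> elts y) \<longrightarrow> x = y) \<and>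
     \<comment> \<open>foundation\<close>
     (\<forall>x \<in> M. (\<exists>y \<in> M. y \<in> elts x) \<longrightarrow>
        (\<exists>y \<in> M. y \<in> elts x \<and> \<not> (\<exists>z \<in> M. z \<in> elts x \<and> z \<in> elts y))) \<and>
     \<comment> \<open>pairing\<close>
     (\<forall>x \<in> M. \<forall>y \<in> M. \<exists>z \<in> M. \<forall>w \<in> M. w \<in> elts z \<longleftrightarrow> w = x \<or> w = y) \<and>
     \<comment> \<open>union\<close>
     (\<forall>x \<in> M. \<exists>z \<in> M. \<forall>w \<in> M. w \<in> elts z \<longleftrightarrow> (\<exists>y \<in> M. y \<in> elts x \<and> w \<in> elts y)) \<and>
     \<comment> \<open>power set\<close>
     (\<forall>x \<in> M. \<exists>z \<in> M. \<forall>w \<in> M. w \<in> elts z \<longleftrightarrow> (\<forall>v \<in> M. v \<in> elts w \<longrightarrow> v \<in> elts x)) \<and>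
     \<comment> \<open>infinity\<close>
     (\<exists>x \<in> M. (\<exists>z \<in> M. z \<in> elts x \<and> (\<forall>w \<in> M. w \<notin> elts z)) \<and>
        (\<forall>y \<in> M. y \<in> elts x \<longrightarrow>
           (\<exists>z \<in> M. z \<in> elts x \<and> (\<forall>w \<in> M. w \<in> elts z \<longleftrightarrow> w \<in> elts y \<or> w = y)))) \<and>
     \<comment> \<open>choice\<close>
     (\<forall>x \<in> M.
        (\<forall>y \<in> M. y \<in> elts x \<longrightarrow> (\<exists>w \<in> M. w \<in> elts y)) \<and>
        (\<forall>y \<in> M. \<forall>z \<in> M. y \<in> elts x \<and> z \<in> elts x \<and> y \<noteq> z \<longrightarrow>
           \<not> (\<exists>w \<in> M. w \<in> elts y \<and> w \<in> elts z)) \<longrightarrow>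
        (\<exists>c \<in> M. \<forall>y \<in> M. y \<in> elts x \<longrightarrow> (\<exists>!w. w \<in> M \<and> w \<in> elts y \<and> w \<in> elts c))) \<and>
     \<comment> \<open>separation\<close>
     (\<forall>\<phi> e. range e \<subseteq> M \<longrightarrow>
        (\<forall>x \<in> M. \<exists>z \<in> M. \<forall>w \<in> M. w \<in> elts z \<longleftrightarrow> w \<in> elts x \<and> sat M (case_nat w e) \<phi>)) \<and>
     \<comment> \<open>replacement\<close>
     (\<forall>\<phi> e. range e \<subseteq> M \<longrightarrow>
        (\<forall>x \<in> M.
           (\<forall>u \<in> M. u \<in> elts x \<longrightarrow> (\<exists>!v. v \<in> M \<and> sat M (case_nat u (case_nat v e)) \<phi>)) \<longrightarrow>
           (\<exists>z \<in> M. \<forall>v \<in> M. v \<in> elts z \<longleftrightarrow>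
              (\<exists>u \<in> M. u \<in> elts x \<and> sat M (case_nat u (case_nat v e)) \<phi>))))"

definition transitive_model_ZFC :: "'a::set_universe set \<Rightarrow> bool" where
  "transitive_model_ZFC M \<longleftrightarrow> (\<forall>x \<in> M. elts x \<subseteq> M) \<and> models_ZFC M"


section \<open>Forcing and generic extensions\<close>

text \<open>
  A notion of forcing is a nonempty preorder; \<open>P\<close> is its set of conditions and \<open>R\<close> the set of
  pairs \<open>opair q p\<close> with \<open>q\<close> stronger than \<open>p\<close>.
\<close>

definition forcing_le :: "'a::set_universe \<Rightarrow> 'a \<Rightarrow> 'a \<Rightarrow> bool" where
  "forcing_le R q p \<longleftrightarrow> opair q p \<in> elts R"

definition forcing_notion :: "'a::set_universe \<Rightarrow> 'a \<Rightarrow> bool" where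
  "forcing_notion P R \<longleftrightarrow>
     elts P \<noteq> {} \<and>
     (\<forall>z \<in> elts R. \<exists>p \<in> elts P. \<exists>q \<in> elts P. z = opair p q) \<and>
     (\<forall>p \<in> elts P. forcing_le R p p) \<and>
     (\<forall>p \<in> elts P. \<forall>q \<in> elts P. \<forall>r \<in> elts P.
        forcing_le R p q \<longrightarrow> forcing_le R q r \<longrightarrow> forcing_le R p r)"

definition forcing_dense :: "'a::set_universe \<Rightarrow> 'a \<Rightarrow> 'a set \<Rightarrow> bool" where
  "forcing_dense P R D \<longleftrightarrow>
     D \<subseteq> elts P \<and> (\<forall>p \<in> elts P. \<exists>q \<in> D. forcing_le R q p)"

definition forcing_filter :: "'a::set_universe \<Rightarrow> 'a \<Rightarrow> 'a set \<Rightarrow> bool" where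
  "forcing_filter P R G \<longleftrightarrow>
     G \<subseteq> elts P \<and> G \<noteq> {} \<and>
     (\<forall>p \<in> G. \<forall>q \<in> elts P. forcing_le R p q \<longrightarrow> q \<in> G) \<and>
     (\<forall>p \<in> G. \<forall>q \<in> G. \<exists>r \<in> G. forcing_le R r p \<and> forcing_le R r q)"

definition generic_filter :: "'a::set_universe set \<Rightarrow> 'a \<Rightarrow> 'a \<Rightarrow> 'a set \<Rightarrow> bool" where
  "generic_filter V P R G \<longleftrightarrow>
     forcing_filter P R G \<and> (\<forall>D \<in> V. forcing_dense P R (elts D) \<longrightarrow> G \<inter> elts D \<noteq> {})"

inductive forcing_name :: "'a::set_universe \<Rightarrow> 'a \<Rightarrow> bool" for P where
  "(\<And>z. z \<in> elts t \<Longrightarrow> \<exists>s p. z = opair s p \<and> p \<in> elts P \<and> forcing_name P s)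
   \<Longrightarrow> forcing_name P t"

function name_val :: "'a::set_universe set \<Rightarrow> 'a \<Rightarrow> 'a" where
  "name_val G t = set_of (name_val G ` {s. \<exists>p \<in> G. opair s p \<in> elts t})"
  by auto
termination
proof (relation "inv_image ({(x, y). x \<in> elts y}\<^sup>+) snd")
  show "wf (inv_image ({(x, y). x \<in> elts (y::'a)}\<^sup>+) snd)"
    by (intro wf_inv_image wf_trancl wf_elts)
qed (auto dest: opair_fst_below)

declare name_val.simps [simp del]

lemma elts_name_val: "elts (name_val G t) = {name_val G s | s p. p \<in> G \<and> opair s p \<in> elts t}"
proof -
  define first where "first = (\<lambda>z::'a. THE s. \<exists>p. z = opair s p)"
  have first: "first (opair s p) = s" for s p
    unfolding first_def by (auto simp: opair_eq_iff)
  have "\<exists>z. elts z = (name_val G \<circ> first) ` (elts t \<inter> {opair s p | s p. p \<in> G})"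
    by (rule replacement)
  also have "(name_val G \<circ> first) ` (elts t \<inter> {opair s p | s p. p \<in> G})
      = name_val G ` {s. \<exists>p \<in> G. opair s p \<in> elts t}"
    by (force simp: first image_iff)
  finally obtain z where "elts z = name_val G ` {s. \<exists>p \<in> G. opair s p \<in> elts t}"
    by blast
  then have "elts (name_val G t) = name_val G ` {s. \<exists>p \<in> G. opair s p \<in> elts t}"
    unfolding name_val.simps[of G t] by (rule elts_set_of)
  then show ?thesis
    by auto
qed

definition generic_extension :: "'a::set_universe set \<Rightarrow> 'a \<Rightarrow> 'a set \<Rightarrow> 'a set" where
  "generic_extension V P G = {name_val G t | t. t \<in> V \<and> forcing_name P t}"


section \<open>Cohen reals\<close>

definition Fn_omega_2 :: "'a::set_universe set" where
  "Fn_omega_2 = {p. finite (elts p) \<and> (\<exists>X \<subseteq> range num. is_fun p X {num 0, num 1})}"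

definition Cohen_real :: "'a::set_universe set \<Rightarrow> 'a \<Rightarrow> bool" where
  "Cohen_real V x \<longleftrightarrow>
     is_fun x (range num) {num 0, num 1} \<and>
     (\<forall>D \<in> V. elts D \<subseteq> Fn_omega_2 \<and> (\<forall>p \<in> Fn_omega_2. \<exists>q \<in> elts D. elts p \<subseteq> elts q) \<longrightarrow>
        (\<exists>p \<in> elts D. elts p \<subseteq> elts x))"

definition adds_Cohen_real :: "'a::set_universe set \<Rightarrow> 'a \<Rightarrow> 'a \<Rightarrow> bool" where
  "adds_Cohen_real V P R \<longleftrightarrow>
     (\<forall>G. generic_filter V P R G \<longrightarrow> (\<exists>x \<in> generic_extension V P G. Cohen_real V x))"


section \<open>Boolean algebras and their Stone spaces\<close>

text \<open>
  The components of a Boolean algebra as a structure inside the universe of sets: the operations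
  are sets of ordered pairs.
\<close>

record 'a ba =
  carr :: 'a
  meet_fun :: 'a
  join_fun :: 'a
  compl_fun :: 'a
  bot_elt :: 'a
  top_elt :: 'a

definition ba_meet :: "'a::set_universe ba \<Rightarrow> 'a \<Rightarrow> 'a \<Rightarrow> 'a" where
  "ba_meet A a b = app (meet_fun A) (opair a b)"

definition ba_join :: "'a::set_universe ba \<Rightarrow> 'a \<Rightarrow> 'a \<Rightarrow> 'a" where
  "ba_join A a b = app (join_fun A) (opair a b)"

definition ba_compl :: "'a::set_universe ba \<Rightarrow> 'a \<Rightarrow> 'a" where
  "ba_compl A a = app (compl_fun A) a"

definition is_boolean_algebra :: "'a::set_universe ba \<Rightarrow> bool" where
  "is_boolean_algebra A \<longleftrightarrow>
     (let B = elts (carr A); BB = {opair a b | a b. a \<in> B \<and> b \<in> B} in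
        is_fun (meet_fun A) BB B \<and> is_fun (join_fun A) BB B \<and> is_fun (compl_fun A) B B \<and>
        bot_elt A \<in> B \<and> top_elt A \<in> B \<and>
        (\<forall>a \<in> B. \<forall>b \<in> B. ba_meet A a b = ba_meet A b a) \<and>
        (\<forall>a \<in> B. \<forall>b \<in> B. ba_join A a b = ba_join A b a) \<and>
        (\<forall>a \<in> B. \<forall>b \<in> B. \<forall>c \<in> B. ba_meet A (ba_meet A a b) c = ba_meet A a (ba_meet A b c)) \<and>
        (\<forall>a \<in> B. \<forall>b \<in> B. \<forall>c \<in> B. ba_join A (ba_join A a b) c = ba_join A a (ba_join A b c)) \<and>
        (\<forall>a \<in> B. \<forall>b \<in> B. \<forall>c \<in> B.
           ba_meet A a (ba_join A b c) = ba_join A (ba_meet A a b) (ba_meet A a c)) \<and>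
        (\<forall>a \<in> B. \<forall>b \<in> B. \<forall>c \<in> B.
           ba_join A a (ba_meet A b c) = ba_meet A (ba_join A a b) (ba_join A a c)) \<and>
        (\<forall>a \<in> B. ba_meet A a (top_elt A) = a) \<and>
        (\<forall>a \<in> B. ba_join A a (bot_elt A) = a) \<and>
        (\<forall>a \<in> B. ba_meet A a (ba_compl A a) = bot_elt A) \<and>
        (\<forall>a \<in> B. ba_join A a (ba_compl A a) = top_elt A))"

definition ba_in :: "'a::set_universe ba \<Rightarrow> 'a set \<Rightarrow> bool" where
  "ba_in A M \<longleftrightarrow>
     {carr A, meet_fun A, join_fun A, compl_fun A, bot_elt A, top_elt A} \<subseteq> M"

definition ba_ultrafilter :: "'a::set_universe ba \<Rightarrow> 'a \<Rightarrow> bool" where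
  "ba_ultrafilter A U \<longleftrightarrow>
     elts U \<subseteq> elts (carr A) \<and> top_elt A \<in> elts U \<and> bot_elt A \<notin> elts U \<and>
     (\<forall>a \<in> elts U. \<forall>b \<in> elts U. ba_meet A a b \<in> elts U) \<and>
     (\<forall>a \<in> elts U. \<forall>b \<in> elts (carr A). ba_meet A a b = a \<longrightarrow> b \<in> elts U) \<and>
     (\<forall>a \<in> elts (carr A). a \<in> elts U \<or> ba_compl A a \<in> elts U)"

text \<open>
  The Stone space as computed in a transitive model \<open>M\<close>: its points are the ultrafilters lying in
  \<open>M\<close>, its open sets are the elements of \<open>M\<close> that are unions of basic sets \<open>{U. a \<in> U}\<close>, and
  its sequences are those whose graph is an element of \<open>M\<close>.
\<close>

definition stone_points :: "'a::set_universe set \<Rightarrow> 'a ba \<Rightarrow> 'a set" where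
  "stone_points M A = {U \<in> M. ba_ultrafilter A U}"

definition stone_basic :: "'a::set_universe set \<Rightarrow> 'a ba \<Rightarrow> 'a \<Rightarrow> 'a set" where
  "stone_basic M A a = {U \<in> stone_points M A. a \<in> elts U}"

definition stone_open :: "'a::set_universe set \<Rightarrow> 'a ba \<Rightarrow> 'a \<Rightarrow> bool" where
  "stone_open M A S \<longleftrightarrow>
     S \<in> M \<and> elts S \<subseteq> stone_points M A \<and>
     (\<forall>U \<in> elts S. \<exists>a \<in> elts (carr A). U \<in> stone_basic M A a \<and> stone_basic M A a \<subseteq> elts S)"

definition stone_sequence :: "'a::set_universe set \<Rightarrow> 'a ba \<Rightarrow> (nat \<Rightarrow> 'a) \<Rightarrow> bool" where
  "stone_sequence M A s \<longleftrightarrow>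
     range s \<subseteq> stone_points M A \<and> (\<exists>f \<in> M. elts f = {opair (num n) (s n) | n. True})"

definition stone_tendsto :: "'a::set_universe set \<Rightarrow> 'a ba \<Rightarrow> (nat \<Rightarrow> 'a) \<Rightarrow> 'a \<Rightarrow> bool" where
  "stone_tendsto M A s u \<longleftrightarrow>
     u \<in> stone_points M A \<and>
     (\<forall>S. stone_open M A S \<and> u \<in> elts S \<longrightarrow> (\<exists>N. \<forall>n \<ge> N. s n \<in> elts S))"

definition stone_nontrivial :: "'a::set_universe set \<Rightarrow> 'a ba \<Rightarrow> (nat \<Rightarrow> 'a) \<Rightarrow> bool" where
  "stone_nontrivial M A s \<longleftrightarrow> inj s \<and> (\<forall>u. stone_tendsto M A s u \<longrightarrow> (\<forall>n. s n \<noteq> u))"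

end

theory Submission
  imports Defs
begin

text \<open>
  Call an element of the algebra infinite if there are infinitely many elements below it. If some
  infinite \<open>a\<close> is not the join of two disjoint infinite elements, then any sequence of distinct
  atoms below \<open>a\<close> converges to the ultrafilter of those \<open>b\<close> for which \<open>a - b\<close> is finite.

  Otherwise every infinite element splits into two infinite ones, and repeated splitting yields in
  \<open>V\<close> a binary tree of nonzero elements. Let \<open>I \<in> V\<close> be an ideal that is maximal among those
  containing no node. Modulo \<open>I\<close> the nodes are dense, so each element of the algebra is decided by
  densely many nodes, and the nodes along a Cohen real generate modulo \<open>I\<close> an ultrafilter.
  Flipping the \<open>n\<close>-th bit of the Cohen real gives another ultrafilter. It shares the first \<open>n\<close>
  nodes with the original one, which makes these ultrafilters converge, and it is different from
  it because the next nodes are disjoint.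

  That limits are unique requires the basic clopen sets to be elements of \<open>V[G]\<close>, hence power sets
  and separation in \<open>V[G]\<close>, which come from the forcing theorem.
\<close>

section \<open>Definability over a class of sets\<close>

primrec rename_fm :: "(nat \<Rightarrow> nat) \<Rightarrow> fm \<Rightarrow> fm" where
  "rename_fm f (Mem i j) = Mem (f i) (f j)"
| "rename_fm f (Eq i j) = Eq (f i) (f j)"
| "rename_fm f (Neg \<phi>) = Neg (rename_fm f \<phi>)"
| "rename_fm f (Conj \<phi> \<psi>) = Conj (rename_fm f \<phi>) (rename_fm f \<psi>)"
| "rename_fm f (All \<phi>) = All (rename_fm (case_nat 0 (\<lambda>n. Suc (f n))) \<phi>)"

lemma sat_rename_fm: "sat M e (rename_fm f \<phi>) \<longleftrightarrow> sat M (\<lambda>n. e (f n)) \<phi>"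
proof (induction \<phi> arbitrary: e f)
  case (All \<phi>)
  have "(\<lambda>n. case_nat x e (case_nat 0 (\<lambda>n. Suc (f n)) n)) = case_nat x (\<lambda>n. e (f n))" for x
    by (auto split: nat.split)
  then show ?case
    by (simp add: All)
qed simp_all

lemma range_case_nat: "range e \<subseteq> X \<Longrightarrow> x \<in> X \<Longrightarrow> range (case_nat x e) \<subseteq> X"
  by (fastforce split: nat.split)

text \<open>
  An instantiation \<open>k\<close> tells for each free variable of a formula whether it stands for a parameter
  or for an entry of the environment.
\<close>

definition instantiate :: "(nat \<Rightarrow> 'a + nat) \<Rightarrow> (nat \<Rightarrow> 'a) \<Rightarrow> nat \<Rightarrow> 'a" where
  "instantiate k e n = case_sum id e (k n)"

definition definable :: "'a::set_universe set \<Rightarrow> ((nat \<Rightarrow> 'a) \<Rightarrow> bool) \<Rightarrow> bool" where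
  "definable M Q \<longleftrightarrow> (\<exists>\<phi> k. range k \<subseteq> M <+> UNIV \<and>
     (\<forall>e. range e \<subseteq> M \<longrightarrow> sat M (instantiate k e) \<phi> = Q e))"

definition definable_term :: "'a::set_universe set \<Rightarrow> ((nat \<Rightarrow> 'a) \<Rightarrow> 'a) \<Rightarrow> bool" where
  "definable_term M t \<longleftrightarrow>
     (\<forall>e. range e \<subseteq> M \<longrightarrow> t e \<in> M) \<and> definable M (\<lambda>e. e 0 = t (\<lambda>n. e (Suc n)))"

named_theorems definable_intros

lemma instantiate_Inr [simp]: "instantiate (\<lambda>n. Inr (f n)) e = (\<lambda>n. e (f n))"
  by (simp add: instantiate_def fun_eq_iff)

lemma instantiate_case_nat:
  "instantiate (case_nat (Inr i) k) e = case_nat (e i) (instantiate k e)"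
  by (auto simp: instantiate_def split: nat.split)

lemma instantiate_Inl [simp]: "instantiate (\<lambda>n. Inl (e n)) e' = e"
  by (simp add: instantiate_def fun_eq_iff)

lemma range_instantiate:
  assumes "range k \<subseteq> M <+> UNIV" "range e \<subseteq> M"
  shows "range (instantiate k e) \<subseteq> M"
proof
  fix x assume "x \<in> range (instantiate k e)"
  then obtain n where x_eq: "x = case_sum id e (k n)"
    by (auto simp: instantiate_def)
  have "k n \<in> M <+> UNIV"
    using assms(1) by blast
  then show "x \<in> M"
    unfolding x_eq by (rule PlusE) (use assms(2) in auto)
qed

lemma definableE:
  assumes "definable M Q"
  obtains \<phi> k where "range k \<subseteq> M <+> UNIV"
    "\<And>e. range e \<subseteq> M \<Longrightarrow> sat M (instantiate k e) \<phi> = Q e"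
  using assms unfolding definable_def by blast

lemma definableI:
  assumes "range k \<subseteq> M <+> UNIV" "\<And>e. range e \<subseteq> M \<Longrightarrow> sat M (instantiate k e) \<phi> = Q e"
  shows "definable M Q"
  using assms unfolding definable_def by blast

lemma definable_cong:
  assumes "definable M Q" "\<And>e. range e \<subseteq> M \<Longrightarrow> Q' e = Q e"
  shows "definable M Q'"
  using assms unfolding definable_def by metis

lemma definable_instantiate:
  assumes "definable M Q" and range_g: "range g \<subseteq> M <+> UNIV"
  shows "definable M (\<lambda>e. Q (instantiate g e))"
proof -
  obtain \<phi> k where range_k: "range k \<subseteq> M <+> UNIV"
    and sat_iff: "\<And>e. range e \<subseteq> M \<Longrightarrow> sat M (instantiate k e) \<phi> = Q e"
    using assms(1) by (rule definableE) blast
  define kg where "kg n = case_sum Inl g (k n)" for n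
  show ?thesis
  proof (rule definableI)
    have "case_sum Inl g z \<in> M <+> UNIV" if "z \<in> M <+> UNIV" for z
      using that range_g by (auto simp: image_subset_iff)
    then show "range kg \<subseteq> M <+> UNIV"
      using range_k unfolding kg_def by blast
    show "sat M (instantiate kg e) \<phi> = Q (instantiate g e)" if "range e \<subseteq> M" for e
    proof -
      have "instantiate kg e = instantiate k (instantiate g e)"
        by (rule ext) (simp add: instantiate_def kg_def split: sum.split)
      then show ?thesis
        using sat_iff range_instantiate[OF range_g that] by simp
    qed
  qed
qed

lemma definable_rename:
  assumes "definable M Q"
  shows "definable M (\<lambda>e. Q (\<lambda>n. e (f n)))"
  using definable_instantiate[OF assms, of "\<lambda>n. Inr (f n)"] by (simp add: image_subset_iff InrI)

lemma definable_swap: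
  assumes "definable M (\<lambda>e. Q (e 0) (e (Suc 0)))"
  shows "definable M (\<lambda>e. Q (e (Suc 0)) (e 0))"
  using definable_rename[OF assms, of "\<lambda>n. if n = 0 then Suc 0 else 0"] by simp

lemma definable_fix_tail:
  assumes "definable M (\<lambda>e. Q (e 0) (\<lambda>n. e (Suc n)))" "range e \<subseteq> M"
  shows "definable M (\<lambda>e'. Q (e' i) e)"
proof -
  have "range (case_nat (Inr i) (\<lambda>n. Inl (e n))) \<subseteq> M <+> UNIV"
    using assms(2) by (intro range_case_nat) (auto simp: image_subset_iff)
  from definable_instantiate[OF assms(1) this] show ?thesis
    by (simp add: instantiate_case_nat)
qed

lemma definable_var_mem: "definable M (\<lambda>e. e i \<in> elts (e j))"
  by (rule definableI[where k = Inr and \<phi> = "Mem i j"]) (auto simp: instantiate_def)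

lemma definable_var_eq: "definable M (\<lambda>e. e i = e j)"
  by (rule definableI[where k = Inr and \<phi> = "Eq i j"]) (auto simp: instantiate_def)

lemma definable_not [definable_intros]:
  assumes "definable M Q"
  shows "definable M (\<lambda>e. \<not> Q e)"
proof -
  obtain \<phi> k where "range k \<subseteq> M <+> UNIV"
    "\<And>e. range e \<subseteq> M \<Longrightarrow> sat M (instantiate k e) \<phi> = Q e"
    using assms by (rule definableE) blast
  then show ?thesis
    by (intro definableI[where k = k and \<phi> = "Neg \<phi>"]) simp_all
qed

lemma definable_conj [definable_intros]:
  assumes "definable M Q" "definable M Q'"
  shows "definable M (\<lambda>e. Q e \<and> Q' e)"
proof -
  obtain \<phi> k where range_k: "range k \<subseteq> M <+> UNIV"
    and sat_left: "\<And>e. range e \<subseteq> M \<Longrightarrow> sat M (instantiate k e) \<phi> = Q e"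
    using assms(1) by (rule definableE) blast
  obtain \<psi> l where range_l: "range l \<subseteq> M <+> UNIV"
    and sat_right: "\<And>e. range e \<subseteq> M \<Longrightarrow> sat M (instantiate l e) \<psi> = Q' e"
    using assms(2) by (rule definableE) blast
  define kl where "kl n = (if even n then k (n div 2) else l (n div 2))" for n
  have "(\<lambda>n. instantiate kl e (2 * n)) = instantiate k e"
    "(\<lambda>n. instantiate kl e (2 * n + 1)) = instantiate l e" for e
    by (simp_all add: instantiate_def kl_def fun_eq_iff)
  then show ?thesis
    by (intro definableI[where k = kl
          and \<phi> = "Conj (rename_fm (\<lambda>n. 2 * n) \<phi>) (rename_fm (\<lambda>n. 2 * n + 1) \<psi>)"])
      (use range_k range_l in \<open>auto simp: sat_rename_fm sat_left sat_right kl_def image_subset_iff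
        simp del: add_Suc_right\<close>)
qed

text \<open>
  A bound variable is entered at position \<open>0\<close> of the environment; stating this with a schematic
  \<open>Q\<close> lets higher-order unification do the shift of the indices.
\<close>

lemma definable_pushE:
  assumes "definable M (\<lambda>e. Q (e 0) (\<lambda>n. e (Suc n)))" "c \<in> M"
  obtains \<phi> k where "range k \<subseteq> M <+> UNIV"
    "\<And>e x. range e \<subseteq> M \<Longrightarrow> x \<in> M \<Longrightarrow> sat M (case_nat x (instantiate k e)) \<phi> = Q x e"
proof -
  obtain \<phi> k where range_k: "range k \<subseteq> M <+> UNIV"
    and sat_iff: "\<And>e. range e \<subseteq> M \<Longrightarrow> sat M (instantiate k e) \<phi> = Q (e 0) (\<lambda>n. e (Suc n))"
    using assms(1) by (rule definableE) blast
  define k' where "k' n = case_sum Inl (case_nat (Inl c) Inr) (k n)" for n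
  define f where "f n = (if k n = Inr 0 then 0 else Suc n)" for n
  have "sat M (case_nat x (instantiate k' e)) (rename_fm f \<phi>) = Q x e"
    if range_e: "range e \<subseteq> M" and x_in: "x \<in> M" for e x
  proof -
    have "(\<lambda>n. case_nat x (instantiate k' e) (f n)) = instantiate k (case_nat x e)"
      unfolding instantiate_def k'_def f_def by (rule ext) (auto split: sum.split nat.split)
    then show ?thesis
      using sat_iff[OF range_case_nat[OF range_e x_in]] by (simp add: sat_rename_fm)
  qed
  moreover have "case_sum Inl (case_nat (Inl c) Inr) z \<in> M <+> UNIV" if "z \<in> M <+> UNIV" for z
    using that assms(2) by (auto split: nat.split)
  then have "range k' \<subseteq> M <+> UNIV"
    using range_k unfolding k'_def by blast
  ultimately show thesis
    by (rule that[rotated])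
qed

lemma definable_ball_model [definable_intros]:
  assumes "definable M (\<lambda>e. Q (e 0) (\<lambda>n. e (Suc n)))"
  shows "definable M (\<lambda>e. \<forall>x\<in>M. Q x e)"
proof (cases "M = {}")
  case True
  then show ?thesis
    by (intro definableI[where k = Inr and \<phi> = "Eq 0 0"]) auto
next
  case False
  then obtain c where "c \<in> M"
    by blast
  obtain \<phi> k where "range k \<subseteq> M <+> UNIV"
    "\<And>e x. range e \<subseteq> M \<Longrightarrow> x \<in> M \<Longrightarrow> sat M (case_nat x (instantiate k e)) \<phi> = Q x e"
    using definable_pushE[where Q = Q, OF assms \<open>c \<in> M\<close>] by metis
  then show ?thesis
    by (intro definableI[where k = k and \<phi> = "All \<phi>"]) auto
qed

lemma definable_disj [definable_intros]:
  assumes "definable M Q" "definable M Q'"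
  shows "definable M (\<lambda>e. Q e \<or> Q' e)"
proof -
  have "definable M (\<lambda>e. \<not> (\<not> Q e \<and> \<not> Q' e))"
    by (intro definable_not definable_conj assms)
  then show ?thesis
    by simp
qed

lemma definable_imp [definable_intros]:
  "definable M Q \<Longrightarrow> definable M Q' \<Longrightarrow> definable M (\<lambda>e. Q e \<longrightarrow> Q' e)"
  unfolding imp_conv_disj by (intro definable_not definable_disj)

lemma definable_iff [definable_intros]:
  "definable M Q \<Longrightarrow> definable M Q' \<Longrightarrow> definable M (\<lambda>e. Q e \<longleftrightarrow> Q' e)"
  unfolding iff_conv_conj_imp by (intro definable_conj definable_imp)

lemma definable_bex_model [definable_intros]:
  assumes "definable M (\<lambda>e. Q (e 0) (\<lambda>n. e (Suc n)))"
  shows "definable M (\<lambda>e. \<exists>x\<in>M. Q x e)"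
proof -
  have "definable M (\<lambda>e. \<not> (\<forall>x\<in>M. \<not> Q x e))"
    by (intro definable_not definable_ball_model assms)
  then show ?thesis
    by simp
qed

lemma definable_const [definable_intros]: "definable M (\<lambda>e. b)"
  using definable_not[OF definable_var_eq[of M 0 0]] definable_var_eq[of M 0 0]
  by (cases b) simp_all

lemma definable_term_in: "definable_term M t \<Longrightarrow> range e \<subseteq> M \<Longrightarrow> t e \<in> M"
  unfolding definable_term_def by blast

lemma definable_term_rename:
  assumes "definable_term M t"
  shows "definable_term M (\<lambda>e. t (\<lambda>n. e (f n)))"
  unfolding definable_term_def
proof (intro conjI allI impI)
  fix e :: "nat \<Rightarrow> 'a" assume "range e \<subseteq> M"
  then show "t (\<lambda>n. e (f n)) \<in> M"
    by (intro definable_term_in[OF assms]) auto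
next
  show "definable M (\<lambda>e. e 0 = t (\<lambda>n. e (Suc (f n))))"
    using definable_rename[of M _ "case_nat 0 (\<lambda>n. Suc (f n))"] assms
    unfolding definable_term_def by fastforce
qed

lemma definable_term_var [definable_intros]: "definable_term M (\<lambda>e. e i)"
  unfolding definable_term_def by (auto intro: definable_var_eq)

lemma definable_term_const [definable_intros]:
  assumes "c \<in> M"
  shows "definable_term M (\<lambda>e. c)"
  unfolding definable_term_def
proof (intro conjI allI impI)
  show "definable M (\<lambda>e. e 0 = c)"
    by (rule definable_fix_tail[where Q = "\<lambda>x e. x = e 0" and e = "\<lambda>_. c"])
      (use assms in \<open>auto intro: definable_var_eq\<close>)
qed (use assms in auto)

lemma definable_plug:
  assumes "definable_term M t" "definable M (\<lambda>e. Q (e 0) (\<lambda>n. e (Suc n)))"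
  shows "definable M (\<lambda>e. Q (t e) e)"
proof (rule definable_cong)
  show "definable M (\<lambda>e. \<exists>x\<in>M. x = t e \<and> Q x e)"
    using assms unfolding definable_term_def by (intro definable_intros) auto
qed (use assms(1) in \<open>auto dest: definable_term_in\<close>)

lemma definable_mem [definable_intros]:
  assumes "definable_term M s" "definable_term M t"
  shows "definable M (\<lambda>e. s e \<in> elts (t e))"
  using definable_term_rename[OF assms(1)] definable_var_mem
  by (intro definable_plug[OF assms(2), where Q = "\<lambda>y e. s e \<in> elts y"]
      definable_plug[where Q = "\<lambda>x e. x \<in> elts (e 0)"]) auto

lemma definable_eq [definable_intros]:
  assumes "definable_term M s" "definable_term M t"
  shows "definable M (\<lambda>e. s e = t e)"
  using definable_term_rename[OF assms(1)] definable_var_eq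
  by (intro definable_plug[OF assms(2), where Q = "\<lambda>y e. s e = y"]
      definable_plug[where Q = "\<lambda>x e. x = e 0"]) auto

section \<open>Set operations\<close>

definition sep :: "'a::set_universe \<Rightarrow> ('a \<Rightarrow> bool) \<Rightarrow> 'a" where
  "sep X Q = set_of {x \<in> elts X. Q x}"

lemma elts_sep [simp]: "elts (sep X Q) = {x \<in> elts X. Q x}"
proof -
  obtain z where "elts z = id ` (elts X \<inter> Collect Q)"
    using replacement by blast
  then show ?thesis
    unfolding sep_def by (intro elts_set_of[of z]) auto
qed

definition upair :: "'a::set_universe \<Rightarrow> 'a \<Rightarrow> 'a" where
  "upair x y = set_of {x, y}"

lemma elts_upair [simp]: "elts (upair x y) = {x, y}"
  unfolding upair_def by (rule elts_set_of_pair)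

lemma opair_upair: "opair x y = upair (upair x x) (upair x y)"
  unfolding opair_def upair_def ..

definition Unions :: "'a::set_universe \<Rightarrow> 'a" where
  "Unions x = set_of (\<Union>y \<in> elts x. elts y)"

lemma elts_Unions [simp]: "elts (Unions x) = (\<Union>y \<in> elts x. elts y)"
  unfolding Unions_def using union[of x] elts_set_of by blast

definition union2 :: "'a::set_universe \<Rightarrow> 'a \<Rightarrow> 'a" where
  "union2 x y = Unions (upair x y)"

lemma elts_union2 [simp]: "elts (union2 x y) = elts x \<union> elts y"
  unfolding union2_def by simp

definition cons :: "'a::set_universe \<Rightarrow> 'a \<Rightarrow> 'a" where
  "cons x y = union2 (upair x x) y"

lemma elts_cons [simp]: "elts (cons x y) = insert x (elts y)"
  unfolding cons_def by simp

declare num.simps [simp del]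

lemma elts_num_0 [simp]: "elts (num 0) = {}"
  by (simp add: elts_num)

lemma num_Suc: "num (Suc n) = cons (num n) (num n)"
  by (rule elts_ext) (simp add: elts_num lessThan_Suc)

lemma not_mem_self: "x \<notin> elts (x::'a::set_universe)"
  using wf_elts wf_not_refl by fastforce

lemma wf_trancl_elts: "wf ({(x, y). x \<in> elts (y::'a::set_universe)}\<^sup>+)"
  by (rule wf_trancl[OF wf_elts])

lemma num_eq_iff [simp]: "num m = (num n :: 'a::set_universe) \<longleftrightarrow> m = n"
proof -
  have "num m \<noteq> (num n :: 'a)" if "m < n" for m n
  proof -
    have "num m \<in> elts (num n :: 'a)"
      using that by (simp add: elts_num)
    then show ?thesis
      using not_mem_self by metis
  qed
  then show ?thesis
    by (metis nat_neq_iff)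
qed

lemma num_mem_iff [simp]: "num m \<in> elts (num n :: 'a::set_universe) \<longleftrightarrow> m < n"
  by (auto simp: elts_num)

definition omega :: "'a::set_universe" where
  "omega = set_of (range num)"

definition transitive_set :: "'a::set_universe \<Rightarrow> bool" where
  "transitive_set T \<longleftrightarrow> (\<forall>y\<in>elts T. elts y \<subseteq> elts T)"

lemma transitive_setD: "transitive_set T \<Longrightarrow> y \<in> elts T \<Longrightarrow> x \<in> elts y \<Longrightarrow> x \<in> elts T"
  unfolding transitive_set_def by blast

lemma transitive_set_opair:
  assumes "transitive_set T" "opair x y \<in> elts T"
  shows "x \<in> elts T" "y \<in> elts T"
proof -
  have "upair x y \<in> elts T"
    using transitive_setD[OF assms] by (simp add: opair_upair)
  then show "x \<in> elts T" "y \<in> elts T"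
    using transitive_setD[OF assms(1)] by simp_all
qed

text \<open>Unlike \<open>app\<close>, this evaluation has a definite value also outside the domain of \<open>f\<close>.\<close>

definition total_app :: "'a::set_universe \<Rightarrow> 'a \<Rightarrow> 'a" where
  "total_app f x = Unions (sep (Unions (Unions f)) (\<lambda>y. opair x y \<in> elts f))"

lemma opair_in_Unions:
  assumes "opair x y \<in> elts f"
  shows "x \<in> elts (Unions (Unions f))" "y \<in> elts (Unions (Unions f))"
proof -
  have "upair x y \<in> elts (Unions f)"
    using assms by (auto simp: opair_upair intro: bexI[rotated])
  then show "x \<in> elts (Unions (Unions f))" "y \<in> elts (Unions (Unions f))"
    using elts_Unions[of "Unions f"] elts_upair by blast+
qed

lemma total_app_eqI:
  assumes "opair x y \<in> elts f" "\<And>z. opair x z \<in> elts f \<Longrightarrow> z = y"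
  shows "total_app f x = y"
proof (rule elts_ext)
  have "{z \<in> elts (Unions (Unions f)). opair x z \<in> elts f} = {y}"
    using assms opair_in_Unions(2)[OF assms(1)] by blast
  then show "elts (total_app f x) = elts y"
    unfolding total_app_def by (simp del: elts_Unions add: elts_Unions[of "sep _ _"])
qed

lemma is_fun_opair_iff:
  assumes "is_fun f X Y" "x \<in> X"
  shows "opair x y \<in> elts f \<longleftrightarrow> y = total_app f x"
proof -
  have "\<exists>!y. opair x y \<in> elts f"
    using assms unfolding is_fun_def by blast
  then show ?thesis
    using total_app_eqI by metis
qed

lemma is_fun_total_app_in:
  assumes "is_fun f X Y" "x \<in> X"
  shows "total_app f x \<in> Y"
proof -
  have "opair x (total_app f x) \<in> elts f"
    using is_fun_opair_iff[OF assms] by blast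
  then show ?thesis
    using assms(1) unfolding is_fun_def by (metis opair_eq_iff)
qed

lemma app_eq_total_app: "is_fun f X Y \<Longrightarrow> x \<in> X \<Longrightarrow> app f x = total_app f x"
  unfolding app_def using is_fun_opair_iff by (metis (mono_tags) the_equality)

definition num_rec :: "'a::set_universe \<Rightarrow> ('a \<Rightarrow> 'a \<Rightarrow> 'a) \<Rightarrow> 'a \<Rightarrow> 'a" where
  "num_rec a s m = (if m \<in> range num then rec_nat a (\<lambda>k. s (num k)) (inv num m) else num 0)"

lemma num_rec_num: "num_rec a s (num n) = rec_nat a (\<lambda>k. s (num k)) n"
  unfolding num_rec_def by (simp add: inv_f_f inj_def)

lemma num_rec_0 [simp]: "num_rec a s (num 0) = a"
  unfolding num_rec_num by simp

lemma num_rec_Suc [simp]: "num_rec a s (num (Suc n)) = s (num n) (num_rec a s (num n))"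
  unfolding num_rec_num by simp

section \<open>Transitive classes closed under definable operations\<close>

locale transitive_separation =
  fixes M :: "'a::set_universe set"
  assumes transitive: "x \<in> M \<Longrightarrow> y \<in> elts x \<Longrightarrow> y \<in> M"
    and sat_sep_in: "range e \<subseteq> M \<Longrightarrow> x \<in> M \<Longrightarrow> sep x (\<lambda>w. sat M (case_nat w e) \<phi>) \<in> M"
    and nonempty: "M \<noteq> {}"
begin

lemma sep_in:
  assumes "x \<in> M" "definable M (\<lambda>e. Q (e 0))"
  shows "sep x Q \<in> M"
proof -
  obtain \<phi> and k :: "nat \<Rightarrow> 'a + nat" where range_k: "range k \<subseteq> M <+> UNIV"
    and sat_iff: "\<And>e w. range e \<subseteq> M \<Longrightarrow> w \<in> M \<Longrightarrow> sat M (case_nat w (instantiate k e)) \<phi> = Q w"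
    using definable_pushE[where Q = "\<lambda>w e. Q w", OF assms(2,1)] by metis
  define e where "e = instantiate k (\<lambda>_. x)"
  have "range e \<subseteq> M"
    unfolding e_def using assms(1) by (intro range_instantiate range_k) auto
  then have "sep x (\<lambda>w. sat M (case_nat w e) \<phi>) \<in> M"
    using assms(1) by (rule sat_sep_in)
  also have "sep x (\<lambda>w. sat M (case_nat w e) \<phi>) = sep x Q"
    by (rule elts_ext) (use sat_iff[of "\<lambda>_. x"] assms(1) transitive in \<open>auto simp: e_def\<close>)
  finally show ?thesis .
qed

lemma definable_ball_elts [definable_intros]:
  assumes "definable_term M t" "definable M (\<lambda>e. Q (e 0) (\<lambda>n. e (Suc n)))"
  shows "definable M (\<lambda>e. \<forall>x\<in>elts (t e). Q x e)"
proof (rule definable_cong)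
  show "definable M (\<lambda>e. \<forall>x\<in>M. x \<in> elts (t e) \<longrightarrow> Q x e)"
    by (intro definable_intros assms assms(1)[THEN definable_term_rename])
qed (use definable_term_in[OF assms(1)] transitive in blast)

lemma definable_bex_elts [definable_intros]:
  assumes "definable_term M t" "definable M (\<lambda>e. Q (e 0) (\<lambda>n. e (Suc n)))"
  shows "definable M (\<lambda>e. \<exists>x\<in>elts (t e). Q x e)"
proof -
  have "definable M (\<lambda>e. \<not> (\<forall>x\<in>elts (t e). \<not> Q x e))"
    by (intro definable_not definable_ball_elts assms)
  then show ?thesis
    by simp
qed

lemma definable_subset [definable_intros]:
  assumes "definable_term M s" "definable_term M t"
  shows "definable M (\<lambda>e. elts (s e) \<subseteq> elts (t e))"
  unfolding subset_eq by (intro definable_intros assms assms[THEN definable_term_rename])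

lemma definable_term_setI:
  assumes in_M: "\<And>e. range e \<subseteq> M \<Longrightarrow> t e \<in> M"
    and members: "definable M (\<lambda>e. e 0 \<in> elts (t (\<lambda>n. e (Suc n))))"
  shows "definable_term M t"
  unfolding definable_term_def
proof (intro conjI allI impI in_M)
  have "definable M (\<lambda>e. \<forall>z\<in>M. z \<in> elts (e 0) \<longleftrightarrow> z \<in> elts (t (\<lambda>n. e (Suc n))))"
    using definable_rename[OF members, of "case_nat 0 (\<lambda>n. Suc (Suc n))"]
    by (intro definable_ball_model definable_iff definable_var_mem) simp
  then show "definable M (\<lambda>e. e 0 = t (\<lambda>n. e (Suc n)))"
  proof (rule definable_cong)
    fix e :: "nat \<Rightarrow> 'a" assume range_e: "range e \<subseteq> M"
    have "e 0 \<in> M" "t (\<lambda>n. e (Suc n)) \<in> M"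
      using range_e by (auto intro!: in_M)
    then show "(e 0 = t (\<lambda>n. e (Suc n))) = (\<forall>z\<in>M. z \<in> elts (e 0) \<longleftrightarrow> z \<in> elts (t (\<lambda>n. e (Suc n))))"
      using transitive by (metis elts_ext set_eqI)
  qed
qed

lemma definable_term_compose:
  assumes "definable_term M t" "definable_term M (\<lambda>e. f (e 0))"
  shows "definable_term M (\<lambda>e. f (t e))"
  unfolding definable_term_def
proof (intro conjI allI impI)
  show "f (t e) \<in> M" if "range e \<subseteq> M" for e
    using definable_term_in[OF assms(2), of "\<lambda>_. t e"] definable_term_in[OF assms(1) that] by auto
  have "definable M (\<lambda>e. e (Suc 0) = f (e 0))"
    using assms(2) definable_swap[where Q = "\<lambda>x y. x = f y"] unfolding definable_term_def by blast
  then show "definable M (\<lambda>e. e 0 = f (t (\<lambda>n. e (Suc n))))"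
    by (intro definable_plug[where Q = "\<lambda>x e. e 0 = f x"] assms(1)[THEN definable_term_rename])
qed

lemma definable_term_sep [definable_intros]:
  assumes term_t: "definable_term M t" and definable_Q: "definable M (\<lambda>e. Q (e 0) (\<lambda>n. e (Suc n)))"
  shows "definable_term M (\<lambda>e. sep (t e) (\<lambda>x. Q x e))"
proof (rule definable_term_setI)
  show "sep (t e) (\<lambda>x. Q x e) \<in> M" if "range e \<subseteq> M" for e
    by (rule sep_in[OF definable_term_in[OF term_t that] definable_fix_tail[OF definable_Q that]])
  show "definable M (\<lambda>e. e 0 \<in> elts (sep (t (\<lambda>n. e (Suc n))) (\<lambda>x. Q x (\<lambda>n. e (Suc n)))))"
    unfolding elts_sep mem_Collect_eq
    by (intro definable_intros assms term_t[THEN definable_term_rename])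
qed

lemma empty_in: "num 0 \<in> M"
proof -
  obtain x where "x \<in> M"
    using nonempty by blast
  then have "sep x (\<lambda>_. False) \<in> M"
    by (intro sep_in definable_intros)
  moreover have "sep x (\<lambda>_. False) = num 0"
    by (rule elts_ext) simp
  ultimately show ?thesis
    by simp
qed

text \<open>
  Recursive notions enter through a coinductive characterization: by well-foundedness a
  recursion has only one solution, and the largest one is defined by a first-order formula
  without constructing functions on transitive closures.
\<close>

definition largest_solution :: "(('a \<Rightarrow> bool) \<Rightarrow> 'a \<Rightarrow> bool) \<Rightarrow> 'a \<Rightarrow> bool" where
  "largest_solution \<Phi> x \<longleftrightarrow> (\<exists>W\<in>M. x \<in> elts W \<and> (\<forall>z\<in>elts W. \<Phi> (\<lambda>y. y \<in> elts W) z))"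

lemma definable_largest_solution:
  assumes "definable M (\<lambda>e. \<Phi> (\<lambda>y. y \<in> elts (e 0)) (e (Suc 0)))" "definable_term M t"
  shows "definable M (\<lambda>e. largest_solution \<Phi> (t e))"
proof (rule definable_plug[OF assms(2)])
  have "definable M (\<lambda>e. \<Phi> (\<lambda>y. y \<in> elts (e (Suc 0))) (e 0))"
    using assms(1) by (rule definable_swap)
  then show "definable M (\<lambda>e. largest_solution \<Phi> (e 0))"
    unfolding largest_solution_def by (intro definable_intros)
qed

lemma largest_solution_unfold:
  assumes clause_mono: "\<And>X Y z. \<Phi> X z \<Longrightarrow> (\<And>y. X y \<Longrightarrow> Y y) \<Longrightarrow> \<Phi> Y z"
    and \<Phi>: "definable M (\<lambda>e. \<Phi> (\<lambda>y. y \<in> elts (e 0)) (e (Suc 0)))"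
    and T_solution: "T \<in> M" "x \<in> elts T"
    and closed: "\<And>X z. z \<in> elts T \<Longrightarrow> \<Phi> X z \<Longrightarrow> \<Phi> (\<lambda>y. X y \<and> y \<in> elts T) z"
  shows "largest_solution \<Phi> x \<longleftrightarrow> \<Phi> (largest_solution \<Phi>) x"
proof
  have unfold: "\<Phi> (largest_solution \<Phi>) z" if z_solved: "largest_solution \<Phi> z" for z
  proof -
    obtain W where W_solution: "W \<in> M" "\<forall>z\<in>elts W. \<Phi> (\<lambda>y. y \<in> elts W) z" "z \<in> elts W"
      using z_solved unfolding largest_solution_def by blast
    show ?thesis
      by (rule clause_mono[OF bspec[OF W_solution(2,3)]])
        (use W_solution in \<open>auto simp: largest_solution_def\<close>)
  qed
  then show "\<Phi> (largest_solution \<Phi>) x" if "largest_solution \<Phi> x"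
    using that .
  assume clause_x: "\<Phi> (largest_solution \<Phi>) x"
  define W where "W = sep T (\<lambda>z. z = x \<or> largest_solution \<Phi> z)"
  have "\<Phi> (\<lambda>y. y \<in> elts W) z" if "z \<in> elts W" for z
  proof -
    have "z \<in> elts T" "\<Phi> (largest_solution \<Phi>) z"
      using that clause_x unfold unfolding W_def by auto
    then have "\<Phi> (\<lambda>y. largest_solution \<Phi> y \<and> y \<in> elts T) z"
      by (intro closed)
    then show ?thesis
      by (rule clause_mono) (simp add: W_def)
  qed
  moreover have "W \<in> M"
    unfolding W_def
    by (intro sep_in definable_intros definable_largest_solution \<Phi> T_solution
      transitive[OF T_solution])
  moreover have "x \<in> elts W"
    unfolding W_def using T_solution(2) by simp
  ultimately show "largest_solution \<Phi> x"
    unfolding largest_solution_def by blast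
qed

end

locale transitive_zermelo = transitive_separation +
  assumes upair_in [intro]: "x \<in> M \<Longrightarrow> y \<in> M \<Longrightarrow> upair x y \<in> M"
    and Unions_in [intro]: "x \<in> M \<Longrightarrow> Unions x \<in> M"
    and power_exists: "x \<in> M \<Longrightarrow> \<exists>z\<in>M. elts z = {y \<in> M. elts y \<subseteq> elts x}"
begin

lemma definable_term_upair [definable_intros]:
  assumes "definable_term M s" "definable_term M t"
  shows "definable_term M (\<lambda>e. upair (s e) (t e))"
proof (rule definable_term_setI)
  show "definable M (\<lambda>e. e 0 \<in> elts (upair (s (\<lambda>n. e (Suc n))) (t (\<lambda>n. e (Suc n)))))"
    unfolding elts_upair insert_iff empty_iff
    by (intro definable_intros assms assms[THEN definable_term_rename])
qed (use assms definable_term_in in blast)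

lemma definable_term_Unions [definable_intros]:
  assumes "definable_term M t"
  shows "definable_term M (\<lambda>e. Unions (t e))"
proof (rule definable_term_setI)
  show "definable M (\<lambda>e. e 0 \<in> elts (Unions (t (\<lambda>n. e (Suc n)))))"
    unfolding elts_Unions UN_iff by (intro definable_intros assms assms[THEN definable_term_rename])
qed (use assms definable_term_in in blast)

lemma definable_term_union2 [definable_intros]:
  "definable_term M s \<Longrightarrow> definable_term M t \<Longrightarrow> definable_term M (\<lambda>e. union2 (s e) (t e))"
  unfolding union2_def by (intro definable_intros)

lemma definable_term_cons [definable_intros]:
  "definable_term M s \<Longrightarrow> definable_term M t \<Longrightarrow> definable_term M (\<lambda>e. cons (s e) (t e))"
  unfolding cons_def by (intro definable_intros)

lemma definable_term_opair [definable_intros]: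
  "definable_term M s \<Longrightarrow> definable_term M t \<Longrightarrow> definable_term M (\<lambda>e. opair (s e) (t e))"
  unfolding opair_upair by (intro definable_intros)

lemma definable_term_total_app [definable_intros]:
  assumes "definable_term M s" "definable_term M t"
  shows "definable_term M (\<lambda>e. total_app (s e) (t e))"
  unfolding total_app_def by (intro definable_intros assms assms[THEN definable_term_rename])

lemma definable_term_if [definable_intros]:
  assumes "definable M Q" "definable_term M s" "definable_term M t"
  shows "definable_term M (\<lambda>e. if Q e then s e else t e)"
  unfolding definable_term_def
proof (intro conjI allI impI)
  have "definable M (\<lambda>e. (Q (\<lambda>n. e (Suc n)) \<longrightarrow> e 0 = s (\<lambda>n. e (Suc n))) \<and>
      (\<not> Q (\<lambda>n. e (Suc n)) \<longrightarrow> e 0 = t (\<lambda>n. e (Suc n))))"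
    by (intro definable_intros assms assms(1)[THEN definable_rename]
        assms(2,3)[THEN definable_term_rename])
  then show
    "definable M (\<lambda>e. e 0 = (if Q (\<lambda>n. e (Suc n)) then s (\<lambda>n. e (Suc n)) else t (\<lambda>n. e (Suc n))))"
    by (rule definable_cong) simp
qed (use assms definable_term_in in auto)

lemma union2_in [intro]: "x \<in> M \<Longrightarrow> y \<in> M \<Longrightarrow> union2 x y \<in> M"
  unfolding union2_def by blast

lemma cons_in [intro]: "x \<in> M \<Longrightarrow> y \<in> M \<Longrightarrow> cons x y \<in> M"
  unfolding cons_def by blast

lemma opair_in [intro]: "x \<in> M \<Longrightarrow> y \<in> M \<Longrightarrow> opair x y \<in> M"
  unfolding opair_upair by blast

lemma opair_inD:
  assumes "opair x y \<in> M"
  shows "x \<in> M" "y \<in> M"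
proof -
  have "upair x y \<in> M"
    using transitive[OF assms, of "upair x y"] by (simp add: opair_upair)
  then show "x \<in> M" "y \<in> M"
    using transitive by fastforce+
qed

definition power :: "'a \<Rightarrow> 'a" where
  "power x = set_of {y \<in> M. elts y \<subseteq> elts x}"

lemma elts_power: "x \<in> M \<Longrightarrow> elts (power x) = {y \<in> M. elts y \<subseteq> elts x}"
  unfolding power_def by (drule power_exists, elim bexE, rule elts_set_of)

lemma power_in [intro]: "x \<in> M \<Longrightarrow> power x \<in> M"
  using power_exists[of x] elts_power[of x] by (metis elts_ext)

lemma definable_term_power [definable_intros]:
  assumes "definable_term M t"
  shows "definable_term M (\<lambda>e. power (t e))"
proof (rule definable_term_setI)
  have "definable M (\<lambda>e. elts (e 0) \<subseteq> elts (t (\<lambda>n. e (Suc n))))"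
    by (intro definable_intros assms assms[THEN definable_term_rename])
  then show "definable M (\<lambda>e. e 0 \<in> elts (power (t (\<lambda>n. e (Suc n)))))"
  proof (rule definable_cong)
    fix e :: "nat \<Rightarrow> 'a" assume range_e: "range e \<subseteq> M"
    then have "t (\<lambda>n. e (Suc n)) \<in> M" "e 0 \<in> M"
      by (auto intro!: definable_term_in[OF assms])
    then show "(e 0 \<in> elts (power (t (\<lambda>n. e (Suc n))))) = (elts (e 0) \<subseteq> elts (t (\<lambda>n. e (Suc n))))"
      by (simp add: elts_power)
  qed
qed (use assms definable_term_in in blast)

definition times :: "'a \<Rightarrow> 'a \<Rightarrow> 'a" where
  "times x y = sep (power (power (union2 x y))) (\<lambda>z. \<exists>a\<in>elts x. \<exists>b\<in>elts y. z = opair a b)"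

lemma elts_times:
  assumes "x \<in> M" "y \<in> M"
  shows "elts (times x y) = {opair a b | a b. a \<in> elts x \<and> b \<in> elts y}"
proof -
  have "opair a b \<in> elts (power (power (union2 x y)))" if "a \<in> elts x" "b \<in> elts y" for a b
  proof -
    have a_b_in: "a \<in> M" "b \<in> M"
      using that assms transitive by auto
    then have "upair a a \<in> elts (power (union2 x y))" "upair a b \<in> elts (power (union2 x y))"
      using that assms by (auto simp: elts_power union2_in)
    then show ?thesis
      using a_b_in assms by (auto simp: elts_power union2_in power_in opair_upair)
  qed
  then show ?thesis
    unfolding times_def by auto
qed

lemma times_in [intro]: "x \<in> M \<Longrightarrow> y \<in> M \<Longrightarrow> times x y \<in> M"
  unfolding times_def by (intro sep_in power_in union2_in definable_intros)

lemma opair_in_times [simp]: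
  assumes "x \<in> M" "y \<in> M"
  shows "opair a b \<in> elts (times x y) \<longleftrightarrow> a \<in> elts x \<and> b \<in> elts y"
  using assms by (auto simp: elts_times opair_eq_iff)

lemma definable_term_times [definable_intros]:
  assumes "definable_term M s" "definable_term M t"
  shows "definable_term M (\<lambda>e. times (s e) (t e))"
  unfolding times_def by (intro definable_intros assms assms[THEN definable_term_rename])

lemma num_in [intro]: "num n \<in> M"
  by (induction n) (auto simp: empty_in num_Suc)

lemma finite_subset_in:
  assumes "finite X" "X \<subseteq> M"
  shows "\<exists>z\<in>M. elts z = X"
  using assms
proof (induction rule: finite_induct)
  case empty
  then show ?case
    using empty_in elts_num_0 by blast
next
  case (insert x X)
  then obtain z where "z \<in> M" "elts z = X"
    by auto
  then show ?case
    using insert by (intro bexI[of _ "cons x z"]) auto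
qed

lemma finite_graph_in:
  assumes "\<And>i. i < n \<Longrightarrow> h i \<in> M"
  obtains f where "f \<in> M" "elts f = {opair (num i) (h i) | i. i < n}"
proof -
  have "finite {opair (num i) (h i) | i. i < n}" "{opair (num i) (h i) | i. i < n} \<subseteq> M"
    using assms by auto
  then show thesis
    using finite_subset_in that by blast
qed

end

locale transitive_zermelo_omega = transitive_zermelo +
  assumes omega_exists: "\<exists>z\<in>M. elts z = range num"
begin

lemma elts_omega [simp]: "elts (omega :: 'a) = range num"
  using omega_exists unfolding omega_def by (elim bexE) (rule elts_set_of, assumption)

lemma omega_in [intro]: "omega \<in> M"
proof -
  obtain z where "z \<in> M" "elts z = range num"
    using omega_exists by blast
  then show ?thesis
    using elts_ext[of z omega] by simp
qed

lemma num_neq_omega [simp]: "num n \<noteq> (omega :: 'a)"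
  using not_mem_self[of omega] by (metis elts_omega rangeI)

definition recursion_attempt :: "'a \<Rightarrow> ('a \<Rightarrow> 'a \<Rightarrow> 'a) \<Rightarrow> 'a \<Rightarrow> bool" where
  "recursion_attempt a s h \<longleftrightarrow> (\<forall>z\<in>elts h. z = opair (num 0) a \<or>
     (\<exists>k\<in>elts omega. \<exists>y\<in>M. opair k y \<in> elts h \<and> z = opair (cons k k) (s k y)))"

lemma recursion_attempt_eq_num_rec:
  assumes "recursion_attempt a s h" "opair (num n) y \<in> elts h"
  shows "y = num_rec a s (num n)"
  using assms(2)
proof (induction n arbitrary: y)
  case 0
  have "num 0 \<noteq> cons k k" for k :: 'a
    by (metis elts_cons elts_num_0 insert_not_empty)
  then show ?case
    using 0 assms(1) unfolding recursion_attempt_def by (fastforce simp: opair_eq_iff)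
next
  case (Suc n)
  have "opair (num (Suc n)) y = opair (num 0) a \<or> (\<exists>k\<in>elts omega. \<exists>y'\<in>M.
      opair k y' \<in> elts h \<and> opair (num (Suc n)) y = opair (cons k k) (s k y'))"
    using assms(1) Suc.prems unfolding recursion_attempt_def by blast
  then obtain k y' where "opair (num k) y' \<in> elts h" "num (Suc n) = (num (Suc k) :: 'a)"
    "y = s (num k) y'"
    by (auto simp: opair_eq_iff num_Suc[of k for k, symmetric])
  then show ?case
    using Suc.IH by simp
qed

lemma recursion_attempt_exists:
  assumes num_rec_in: "\<And>i. num_rec a s (num i) \<in> M"
  shows "\<exists>h\<in>M. recursion_attempt a s h \<and> opair (num n) (num_rec a s (num n)) \<in> elts h"
proof -
  let ?rec = "\<lambda>i. num_rec a s (num i)"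
  obtain h where h_graph: "h \<in> M" "elts h = {opair (num i) (?rec i) | i. i < Suc n}"
    using finite_graph_in[of "Suc n" ?rec] num_rec_in by blast
  have "recursion_attempt a s h"
    unfolding recursion_attempt_def
  proof
    fix z assume "z \<in> elts h"
    then obtain i where z_entry: "i < Suc n" "z = opair (num i) (?rec i)"
      using h_graph(2) by blast
    show "z = opair (num 0) a \<or>
      (\<exists>k\<in>elts omega. \<exists>y\<in>M. opair k y \<in> elts h \<and> z = opair (cons k k) (s k y))"
    proof (cases i)
      case (Suc j)
      then have "opair (num j) (?rec j) \<in> elts h"
        using h_graph(2) z_entry(1) by auto
      then show ?thesis
        using z_entry(2) Suc num_rec_in by (auto simp: num_Suc[symmetric])
    qed (use z_entry in simp)
  qed
  then show ?thesis
    using h_graph by auto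
qed

lemma num_rec_eq_iff:
  assumes "\<And>i. num_rec a s (num i) \<in> M"
  shows "y = num_rec a s z \<longleftrightarrow>
    z \<in> elts omega \<and> (\<exists>h\<in>M. recursion_attempt a s h \<and> opair z y \<in> elts h) \<or>
    z \<notin> elts omega \<and> y = num 0"
proof (cases "z \<in> range num")
  case True
  then obtain n where "z = num n"
    by blast
  then show ?thesis
    using recursion_attempt_exists[OF assms] recursion_attempt_eq_num_rec
    unfolding elts_omega by blast
qed (simp add: num_rec_def)

lemma definable_term_num_rec [definable_intros]:
  assumes term_a: "definable_term M a" and term_m: "definable_term M m"
    and term_s: "definable_term M (\<lambda>e. s (e 0) (e (Suc 0)) (\<lambda>n. e (Suc (Suc n))))"
  shows "definable_term M (\<lambda>e. num_rec (a e) (\<lambda>k y. s k y e) (m e))"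
proof -
  let ?rec = "\<lambda>e. num_rec (a e) (\<lambda>k y. s k y e)"
  let ?attempt = "\<lambda>e h. recursion_attempt (a e) (\<lambda>k y. s k y e) h"
  let ?tail = "\<lambda>e n. e (Suc n)"
  have s_in: "s k y e \<in> M" if "range e \<subseteq> M" "k \<in> M" "y \<in> M" for k y e
    using definable_term_in[OF term_s range_case_nat[OF range_case_nat[OF that(1,3)] that(2)]]
    by simp
  have rec_num_in: "?rec e (num n) \<in> M" if "range e \<subseteq> M" for e n
    by (induction n) (use that definable_term_in[OF term_a] s_in[OF that num_in] in simp_all)
  show ?thesis
    unfolding definable_term_def
  proof (intro conjI allI impI)
    show "?rec e (m e) \<in> M" if "range e \<subseteq> M" for e
      using rec_num_in[OF that] empty_in by (cases "m e \<in> range num") (auto simp: num_rec_def)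
    have "definable M (\<lambda>e. \<exists>h\<in>M. ?attempt (?tail e) h \<and> opair (m (?tail e)) (e 0) \<in> elts h)"
      unfolding recursion_attempt_def
      using definable_term_rename[OF term_s, of "case_nat (Suc 0) (case_nat 0 (\<lambda>n. n + 5))"]
      by (intro definable_intros term_a[THEN definable_term_rename]
        term_m[THEN definable_term_rename] empty_in omega_in)
        (simp_all add: numeral_eq_Suc)
    then have "definable M (\<lambda>e. m (?tail e) \<in> elts omega \<and>
        (\<exists>h\<in>M. ?attempt (?tail e) h \<and> opair (m (?tail e)) (e 0) \<in> elts h) \<or>
        m (?tail e) \<notin> elts omega \<and> e 0 = num 0)"
      by (intro definable_disj definable_conj definable_not definable_mem definable_eq
          term_m[THEN definable_term_rename] definable_term_const definable_term_var
          empty_in omega_in)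
    then show "definable M (\<lambda>e. e 0 = ?rec (?tail e) (m (?tail e)))"
      by (rule definable_cong) (intro num_rec_eq_iff rec_num_in, auto)
  qed
qed

lemma finite_iff_enumerated_in:
  assumes "x \<in> M"
  shows "finite (elts x) \<longleftrightarrow>
    (\<exists>n\<in>elts omega. \<exists>f\<in>M. \<forall>y\<in>elts x. \<exists>i\<in>elts n. total_app f i = y)"
proof
  assume "finite (elts x)"
  then obtain n :: nat and h where h_enumerates: "elts x = h ` {i. i < n}"
    using finite_imp_nat_seg_image_inj_on by blast
  then have "h i \<in> M" if "i < n" for i
    using that transitive[OF assms] by blast
  then obtain f where f_graph: "f \<in> M" "elts f = {opair (num i) (h i) | i. i < n}"
    by (rule finite_graph_in)
  have "\<forall>y\<in>elts x. \<exists>i\<in>elts (num n). total_app f i = y"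
  proof
    fix y assume "y \<in> elts x"
    then obtain i where y_eq: "i < n" "y = h i"
      using h_enumerates by blast
    then have "total_app f (num i) = y"
      using f_graph(2) by (intro total_app_eqI) (auto simp: opair_eq_iff)
    then show "\<exists>i\<in>elts (num n). total_app f i = y"
      using y_eq(1) by (intro bexI[of _ "num i"]) simp_all
  qed
  then show "\<exists>n\<in>elts omega. \<exists>f\<in>M. \<forall>y\<in>elts x. \<exists>i\<in>elts n. total_app f i = y"
    using f_graph(1) by auto
next
  assume "\<exists>n\<in>elts omega. \<exists>f\<in>M. \<forall>y\<in>elts x. \<exists>i\<in>elts n. total_app f i = y"
  then obtain n f where "\<And>y. y \<in> elts x \<Longrightarrow> \<exists>i\<in>elts (num n). total_app f i = y"
    by auto
  then have "elts x \<subseteq> total_app f ` elts (num n)"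
    by (metis imageI subsetI)
  then show "finite (elts x)"
    by (rule finite_subset) (simp add: elts_num)
qed

lemma definable_finite [definable_intros]:
  assumes "definable_term M t"
  shows "definable M (\<lambda>e. finite (elts (t e)))"
proof (rule definable_cong)
  show "definable M (\<lambda>e. \<exists>n\<in>elts omega. \<exists>f\<in>M. \<forall>y\<in>elts (t e). \<exists>i\<in>elts n. total_app f i = y)"
    by (intro definable_intros assms[THEN definable_term_rename] omega_in)
qed (intro finite_iff_enumerated_in definable_term_in[OF assms])

end

section \<open>Transitive models of ZFC\<close>

locale transitive_zfc = transitive_zermelo_omega +
  assumes sat_replacement: "range e \<subseteq> M \<Longrightarrow> x \<in> M \<Longrightarrow>
      (\<And>u. u \<in> elts x \<Longrightarrow> \<exists>!v. v \<in> M \<and> sat M (case_nat u (case_nat v e)) \<phi>) \<Longrightarrow>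
      \<exists>z\<in>M. elts z = {v \<in> M. \<exists>u\<in>elts x. sat M (case_nat u (case_nat v e)) \<phi>}"
    and choice_set: "x \<in> M \<Longrightarrow> (\<And>y. y \<in> elts x \<Longrightarrow> elts y \<noteq> {}) \<Longrightarrow>
      (\<And>y z. y \<in> elts x \<Longrightarrow> z \<in> elts x \<Longrightarrow> y \<noteq> z \<Longrightarrow> elts y \<inter> elts z = {}) \<Longrightarrow>
      \<exists>c\<in>M. \<forall>y\<in>elts x. \<exists>!w. w \<in> elts y \<and> w \<in> elts c"
begin

lemma replacement_in:
  assumes x_in: "x \<in> M" and definable_Q: "definable M (\<lambda>e. Q (e 0) (e (Suc 0)))"
    and functional: "\<And>u. u \<in> elts x \<Longrightarrow> \<exists>!v. v \<in> M \<and> Q u v"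
  shows "\<exists>z\<in>M. elts z = {v \<in> M. \<exists>u\<in>elts x. Q u v}"
proof -
  obtain \<phi> k where range_k: "range k \<subseteq> M <+> UNIV"
    and sat_k: "\<And>e. range e \<subseteq> M \<Longrightarrow> sat M (instantiate k e) \<phi> = Q (e 0) (e (Suc 0))"
    using definable_Q by (rule definableE) blast
  define e where "e = instantiate k (\<lambda>_. x)"
  define f where
    "f n = (if k n = Inr 0 then 0 else if k n = Inr (Suc 0) then Suc 0 else Suc (Suc n))" for n
  have range_e: "range e \<subseteq> M"
    unfolding e_def using x_in by (intro range_instantiate range_k) auto
  have sat_iff: "sat M (case_nat u (case_nat v e)) (rename_fm f \<phi>) = Q u v"
    if "u \<in> M" "v \<in> M" for u v
  proof -
    have "(\<lambda>n. case_nat u (case_nat v e) (f n)) = instantiate k (case_nat u (case_nat v (\<lambda>_. x)))"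
      unfolding f_def e_def instantiate_def by (rule ext) (auto split: nat.split sum.split)
    moreover have "range (case_nat u (case_nat v (\<lambda>_::nat. x))) \<subseteq> M"
      using that x_in by (intro range_case_nat) auto
    ultimately show ?thesis
      using sat_k by (simp add: sat_rename_fm)
  qed
  have "\<exists>!v. v \<in> M \<and> sat M (case_nat u (case_nat v e)) (rename_fm f \<phi>)" if "u \<in> elts x" for u
    using functional[OF that] sat_iff[OF transitive[OF x_in that]] by metis
  from sat_replacement[OF range_e x_in this] obtain z where "z \<in> M"
    "elts z = {v \<in> M. \<exists>u\<in>elts x. sat M (case_nat u (case_nat v e)) (rename_fm f \<phi>)}"
    by blast
  then show ?thesis
    using sat_iff transitive[OF x_in] by (intro bexI[of _ z]) auto
qed

lemma image_in:
  assumes x_in: "x \<in> M" and term_f: "definable_term M (\<lambda>e. f (e 0))"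
  obtains z where "z \<in> M" "elts z = f ` elts x"
proof -
  have f_in: "f u \<in> M" if "u \<in> elts x" for u
    using definable_term_in[OF term_f, of "\<lambda>_. u"] transitive[OF x_in that] by auto
  have "definable M (\<lambda>e. e (Suc 0) = f (e 0))"
    by (intro definable_intros term_f)
  then have "\<exists>z\<in>M. elts z = {v \<in> M. \<exists>u\<in>elts x. v = f u}"
    using x_in f_in by (intro replacement_in) auto
  then obtain z where "z \<in> M" "elts z = {v \<in> M. \<exists>u\<in>elts x. v = f u}"
    by blast
  moreover have "{v \<in> M. \<exists>u\<in>elts x. v = f u} = f ` elts x"
    using f_in by auto
  ultimately show thesis
    using that by simp
qed

lemma transitive_set_exists:
  assumes "x \<in> M"
  obtains T where "T \<in> M" "x \<in> elts T" "transitive_set T"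
proof -
  define level where "level n = num_rec (upair x x) (\<lambda>_. Unions) n" for n
  have "definable_term M (\<lambda>e. level (e 0))"
    unfolding level_def by (intro definable_intros assms)
  then obtain z where levels_z: "z \<in> M" "elts z = level ` elts omega"
    by (rule image_in[OF omega_in])
  have members: "w \<in> elts (Unions z) \<longleftrightarrow> (\<exists>n. w \<in> elts (level (num n)))" for w
    unfolding elts_Unions levels_z(2) by simp
  have "x \<in> elts (level (num 0))"
    unfolding level_def by simp
  then have "x \<in> elts (Unions z)"
    unfolding members by blast
  moreover have "transitive_set (Unions z)"
    unfolding transitive_set_def
  proof (intro ballI subsetI)
    fix y w assume y_level: "y \<in> elts (Unions z)" and w_in: "w \<in> elts y"
    obtain n where "y \<in> elts (level (num n))"
      using y_level members by blast
    then have "w \<in> elts (level (num (Suc n)))"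
      using w_in unfolding level_def by auto
    then show "w \<in> elts (Unions z)"
      using members by blast
  qed
  ultimately show thesis
    using that levels_z(1) by blast
qed

lemma choice_on_family:
  assumes F_in: "F \<in> M" and nonempty: "\<And>S. S \<in> elts F \<Longrightarrow> elts S \<noteq> {}"
  obtains ch where "ch \<in> M" "\<And>S. S \<in> elts F \<Longrightarrow> total_app ch S \<in> elts S"
proof -
  define tagged where "tagged S = times (upair S S) S" for S
  have elts_tagged: "elts (tagged S) = opair S ` elts S" if "S \<in> elts F" for S
    using transitive[OF F_in that] unfolding tagged_def by (auto simp: elts_times upair_in)
  have "definable_term M (\<lambda>e. tagged (e 0))"
    unfolding tagged_def by (intro definable_intros)
  then obtain F' where F'_tagged: "F' \<in> M" "elts F' = tagged ` elts F"
    by (rule image_in[OF F_in])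
  have "\<exists>c\<in>M. \<forall>y\<in>elts F'. \<exists>!w. w \<in> elts y \<and> w \<in> elts c"
    using nonempty elts_tagged
    by (intro choice_set[OF F'_tagged(1)]) (auto simp: F'_tagged(2) opair_eq_iff)
  then obtain c where c_in: "c \<in> M" and selects: "\<forall>S\<in>elts F. \<exists>!w. w \<in> elts (tagged S) \<and> w \<in> elts c"
    unfolding F'_tagged(2) ball_simps by (rule bexE)
  define ch where "ch = sep (Unions F') (\<lambda>z. z \<in> elts c)"
  have "ch \<in> M"
    unfolding ch_def by (intro sep_in Unions_in definable_intros F'_tagged(1) c_in)
  moreover have "total_app ch S \<in> elts S" if S_in: "S \<in> elts F" for S
  proof -
    have ch_iff: "opair S y \<in> elts ch \<longleftrightarrow> y \<in> elts S \<and> opair S y \<in> elts c" for y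
      using S_in elts_tagged unfolding ch_def by (auto simp: F'_tagged(2) opair_eq_iff)
    obtain y where y_chosen: "y \<in> elts S" "opair S y \<in> elts c"
      using ex1_implies_ex[OF bspec[OF selects S_in]] unfolding elts_tagged[OF S_in] by blast
    have "y' = y" if "y' \<in> elts S" "opair S y' \<in> elts c" for y'
    proof -
      have "opair S y' = opair S y"
        using bspec[OF selects S_in] elts_tagged[OF S_in] y_chosen that by blast
      then show ?thesis
        by (simp add: opair_eq_iff)
    qed
    then have "total_app ch S = y"
      using y_chosen ch_iff by (intro total_app_eqI) blast+
    then show ?thesis
      using y_chosen(1) by simp
  qed
  ultimately show thesis
    using that by blast
qed

lemma choice_function:
  assumes "X \<in> M"
  obtains ch where "ch \<in> M"
    "\<And>S. S \<in> M \<Longrightarrow> elts S \<subseteq> elts X \<Longrightarrow> elts S \<noteq> {} \<Longrightarrow> total_app ch S \<in> elts S"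
proof -
  have "sep (power X) (\<lambda>S. \<exists>y\<in>elts S. True) \<in> M"
    by (intro sep_in definable_intros power_in assms)
  then obtain ch where "ch \<in> M"
    "\<And>S. S \<in> elts (sep (power X) (\<lambda>S. \<exists>y\<in>elts S. True)) \<Longrightarrow> total_app ch S \<in> elts S"
    by (rule choice_on_family) auto
  then show thesis
    by (intro that[of ch]) (auto simp: elts_power assms)
qed

end

section \<open>Zorn's lemma inside a model\<close>

definition inclusion_chain :: "'a::set_universe \<Rightarrow> bool" where
  "inclusion_chain C \<longleftrightarrow> (\<forall>x\<in>elts C. \<forall>y\<in>elts C. elts x \<subseteq> elts y \<or> elts y \<subseteq> elts x)"

lemma (in transitive_separation) definable_inclusion_chain [definable_intros]:
  assumes "definable_term M t"
  shows "definable M (\<lambda>e. inclusion_chain (t e))"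
  unfolding inclusion_chain_def
  by (intro definable_intros assms assms[THEN definable_term_rename])

text \<open>
  The proof of the Bourbaki--Witt theorem goes through inside \<open>M\<close>: all properties to which the
  induction over the tower is applied are definable.
\<close>

locale inflationary_map = transitive_zermelo +
  fixes F start :: 'a and f :: "'a \<Rightarrow> 'a"
  assumes F_in: "F \<in> M" and start_mem: "start \<in> elts F"
    and definable_f: "definable_term M (\<lambda>e. f (e 0))"
    and f_mem: "x \<in> elts F \<Longrightarrow> f x \<in> elts F"
    and f_inflationary: "x \<in> elts F \<Longrightarrow> elts x \<subseteq> elts (f x)"
    and chain_Unions_mem: "C \<in> M \<Longrightarrow> elts C \<subseteq> elts F \<Longrightarrow> elts C \<noteq> {} \<Longrightarrow> inclusion_chain C \<Longrightarrow>
      Unions C \<in> elts F"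
begin

definition tower_closed :: "'a \<Rightarrow> bool" where
  "tower_closed T \<longleftrightarrow> start \<in> elts T \<and> (\<forall>x\<in>elts T. f x \<in> elts T) \<and>
     (\<forall>C\<in>M. elts C \<subseteq> elts T \<and> (\<exists>y\<in>elts C. True) \<and> inclusion_chain C \<longrightarrow> Unions C \<in> elts T)"

definition tower :: 'a where
  "tower = sep F (\<lambda>x. \<forall>T\<in>M. elts T \<subseteq> elts F \<and> tower_closed T \<longrightarrow> x \<in> elts T)"

lemma F_elem_in: "x \<in> elts F \<Longrightarrow> x \<in> M"
  using transitive[OF F_in] .

lemma definable_term_f [definable_intros]: "definable_term M t \<Longrightarrow> definable_term M (\<lambda>e. f (t e))"
  using definable_term_compose definable_f by blast

lemma tower_in: "tower \<in> M"
  unfolding tower_def tower_closed_def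
  by (intro sep_in definable_intros F_in F_elem_in[OF start_mem])

lemma tower_sub: "x \<in> elts tower \<Longrightarrow> x \<in> elts F"
  unfolding tower_def by simp

lemma tower_least: "T \<in> M \<Longrightarrow> elts T \<subseteq> elts F \<Longrightarrow> tower_closed T \<Longrightarrow> elts tower \<subseteq> elts T"
  unfolding tower_def by auto

lemma start_in_tower: "start \<in> elts tower"
  unfolding tower_def tower_closed_def using start_mem by auto

lemma f_in_tower: "x \<in> elts tower \<Longrightarrow> f x \<in> elts tower"
  unfolding tower_def tower_closed_def using f_mem by auto

lemma Unions_in_tower:
  assumes "C \<in> M" "elts C \<subseteq> elts tower" "elts C \<noteq> {}" "inclusion_chain C"
  shows "Unions C \<in> elts tower"
proof -
  have "Unions C \<in> elts F"
    using assms tower_sub by (intro chain_Unions_mem) auto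
  moreover have "Unions C \<in> elts T" if T_tower: "T \<in> M" "elts T \<subseteq> elts F" "tower_closed T" for T
  proof -
    have "elts C \<subseteq> elts T"
      using assms(2) tower_least[OF T_tower] by blast
    then show ?thesis
      using T_tower(3) assms unfolding tower_closed_def by blast
  qed
  ultimately show ?thesis
    unfolding tower_def by simp
qed

lemma tower_induct [consumes 2, case_names start step limit]:
  assumes definable_Q: "definable M (\<lambda>e. Q (e 0))" and x_in: "x \<in> elts tower"
    and start: "Q start"
    and step: "\<And>x. x \<in> elts tower \<Longrightarrow> Q x \<Longrightarrow> Q (f x)"
    and limit: "\<And>C. elts C \<subseteq> elts tower \<Longrightarrow> elts C \<noteq> {} \<Longrightarrow> (\<And>x. x \<in> elts C \<Longrightarrow> Q x) \<Longrightarrow> Q (Unions C)"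
  shows "Q x"
proof -
  have "elts tower \<subseteq> elts (sep tower Q)"
  proof (rule tower_least)
    show "sep tower Q \<in> M"
      by (rule sep_in[OF tower_in definable_Q])
    show "elts (sep tower Q) \<subseteq> elts F"
      using tower_sub by auto
    show "tower_closed (sep tower Q)"
      unfolding tower_closed_def
    proof (intro conjI ballI impI)
      fix C assume C_chain: "C \<in> M"
        "elts C \<subseteq> elts (sep tower Q) \<and> (\<exists>y\<in>elts C. True) \<and> inclusion_chain C"
      then have "elts C \<subseteq> elts tower" "elts C \<noteq> {}" "inclusion_chain C" "\<And>x. x \<in> elts C \<Longrightarrow> Q x"
        by auto
      then show "Unions C \<in> elts (sep tower Q)"
        using Unions_in_tower[OF C_chain(1)] limit[of C] by simp
    qed (use start_in_tower start f_in_tower step in auto)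
  qed
  then show ?thesis
    using x_in by auto
qed

lemma start_least:
  assumes "x \<in> elts tower"
  shows "elts start \<subseteq> elts x"
proof -
  have "definable M (\<lambda>e. elts start \<subseteq> elts (e 0))"
    by (intro definable_intros F_elem_in start_mem)
  then show ?thesis
    using assms
  proof (induction rule: tower_induct)
    case (step x)
    then show ?case
      using f_inflationary tower_sub by blast
  next
    case (limit C)
    then show ?case
      unfolding elts_Unions by blast
  qed simp
qed

definition extreme :: "'a \<Rightarrow> bool" where
  "extreme c \<longleftrightarrow> (\<forall>x\<in>elts tower. elts x \<subseteq> elts c \<and> x \<noteq> c \<longrightarrow> elts (f x) \<subseteq> elts c)"

lemma below_extreme_or_above_step:
  assumes x_in: "x \<in> elts tower" and c_extreme: "c \<in> elts tower" "extreme c"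
  shows "elts x \<subseteq> elts c \<or> elts (f c) \<subseteq> elts x"
proof -
  have "definable M (\<lambda>e. elts (e 0) \<subseteq> elts c \<or> elts (f c) \<subseteq> elts (e 0))"
    by (intro definable_intros F_elem_in tower_sub c_extreme)
  then show ?thesis
    using x_in
  proof (induction rule: tower_induct)
    case start
    then show ?case
      using start_least[OF c_extreme(1)] by blast
  next
    case (step x)
    show ?case
    proof (cases "x = c")
      case False
      then show ?thesis
        using step c_extreme(2) f_inflationary[OF tower_sub[OF step(1)]] unfolding extreme_def
        by blast
    qed simp
  next
    case (limit C)
    then show ?case
      unfolding elts_Unions by blast
  qed
qed

lemma extreme_step:
  assumes c_extreme: "c \<in> elts tower" "extreme c"
  shows "extreme (f c)"
  unfolding extreme_def
proof (intro ballI impI)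
  fix x assume x_below: "x \<in> elts tower" "elts x \<subseteq> elts (f c) \<and> x \<noteq> f c"
  then have "\<not> elts (f c) \<subseteq> elts x"
    using elts_ext[of x "f c"] by blast
  then have "elts x \<subseteq> elts c"
    using below_extreme_or_above_step[OF x_below(1) c_extreme] by blast
  show "elts (f x) \<subseteq> elts (f c)"
  proof (cases "x = c")
    case False
    then have "elts (f x) \<subseteq> elts c"
      using c_extreme(2) x_below(1) \<open>elts x \<subseteq> elts c\<close> unfolding extreme_def by blast
    then show ?thesis
      using f_inflationary[OF tower_sub[OF c_extreme(1)]] by blast
  qed simp
qed

lemma extreme_Unions:
  assumes C_extreme: "elts C \<subseteq> elts tower" "\<And>c. c \<in> elts C \<Longrightarrow> extreme c"
  shows "extreme (Unions C)"
  unfolding extreme_def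
proof (intro ballI impI)
  fix x assume x_below: "x \<in> elts tower" "elts x \<subseteq> elts (Unions C) \<and> x \<noteq> Unions C"
  then have "\<not> elts (Unions C) \<subseteq> elts x"
    using elts_ext[of x "Unions C"] by blast
  then obtain c where c_not_below: "c \<in> elts C" "\<not> elts c \<subseteq> elts x"
    unfolding elts_Unions by blast
  then have "c \<in> elts tower" "extreme c"
    using C_extreme by auto
  then have "elts x \<subseteq> elts c"
    using below_extreme_or_above_step[OF x_below(1)] c_not_below(2) f_inflationary[OF tower_sub]
    by blast
  then have "elts (f x) \<subseteq> elts c"
    using \<open>extreme c\<close> x_below(1) c_not_below(2) unfolding extreme_def by blast
  then show "elts (f x) \<subseteq> elts (Unions C)"
    using c_not_below(1) unfolding elts_Unions by blast
qed

lemma tower_extreme: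
  assumes "c \<in> elts tower"
  shows "extreme c"
proof -
  have "definable M (\<lambda>e. extreme (e 0))"
    unfolding extreme_def by (intro definable_intros tower_in)
  then show ?thesis
    using assms
  proof (induction rule: tower_induct)
    case start
    show ?case
      unfolding extreme_def using start_least elts_ext by blast
  qed (simp_all add: extreme_step extreme_Unions)
qed

lemma tower_chain: "inclusion_chain tower"
  unfolding inclusion_chain_def
proof (intro ballI)
  fix x y assume "x \<in> elts tower" "y \<in> elts tower"
  then show "elts x \<subseteq> elts y \<or> elts y \<subseteq> elts x"
    using below_extreme_or_above_step tower_extreme f_inflationary[OF tower_sub] by blast
qed

theorem fixed_point: "\<exists>x\<in>elts F. f x = x"
proof -
  have Unions_tower_in: "Unions tower \<in> elts tower"
    using Unions_in_tower[OF tower_in _ _ tower_chain] start_in_tower by blast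
  have "elts (f (Unions tower)) \<subseteq> elts (Unions tower)"
    unfolding elts_Unions[of tower] using f_in_tower[OF Unions_tower_in] by (rule UN_upper)
  then have "f (Unions tower) = Unions tower"
    using f_inflationary[OF tower_sub[OF Unions_tower_in]] by (intro elts_ext equalityI)
  then show ?thesis
    using tower_sub[OF Unions_tower_in] by blast
qed

end

lemma (in transitive_zfc) zorn_in:
  assumes start_in_F: "F \<in> M" "start \<in> elts F"
    and chain_Unions: "\<And>C. C \<in> M \<Longrightarrow> elts C \<subseteq> elts F \<Longrightarrow> elts C \<noteq> {} \<Longrightarrow> inclusion_chain C \<Longrightarrow>
      Unions C \<in> elts F"
  obtains x where "x \<in> elts F" "\<And>y. y \<in> elts F \<Longrightarrow> elts x \<subseteq> elts y \<Longrightarrow> y = x"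
proof -
  obtain ch where ch_chooses: "ch \<in> M"
    "\<And>S. S \<in> M \<Longrightarrow> elts S \<subseteq> elts F \<Longrightarrow> elts S \<noteq> {} \<Longrightarrow> total_app ch S \<in> elts S"
    using choice_function[OF start_in_F(1)] by metis
  define above where "above x = sep F (\<lambda>y. elts x \<subseteq> elts y \<and> y \<noteq> x)" for x
  define f where "f x = (if \<exists>y\<in>elts (above x). True then total_app ch (above x) else x)" for x
  have f_cases: "f x \<in> elts (above x) \<or> f x = x \<and> elts (above x) = {}" if "x \<in> elts F" for x
  proof (cases "elts (above x) = {}")
    case False
    have "above x \<in> M"
      unfolding above_def
      by (intro sep_in definable_intros start_in_F transitive[OF start_in_F(1) that])
    moreover have "elts (above x) \<subseteq> elts F"
      unfolding above_def by auto
    ultimately show ?thesis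
      using ch_chooses(2) False unfolding f_def by auto
  qed (simp add: f_def)
  interpret inflationary_map M F start f
  proof
    show "definable_term M (\<lambda>e. f (e 0))"
      unfolding f_def above_def by (intro definable_intros ch_chooses(1) start_in_F(1))
    show "f x \<in> elts F" "elts x \<subseteq> elts (f x)" if "x \<in> elts F" for x
      using f_cases[OF that] that unfolding above_def by auto
  qed (fact start_in_F chain_Unions)+
  obtain x where x_fixed: "x \<in> elts F" "f x = x"
    using fixed_point by blast
  then have "elts (above x) = {}"
    using f_cases[OF x_fixed(1)] unfolding above_def by auto
  then show thesis
    using that[OF x_fixed(1)] unfolding above_def by auto
qed

section \<open>The axioms of ZFC in a transitive model\<close>

definition successor_closed :: "'a::set_universe \<Rightarrow> bool" where
  "successor_closed Z \<longleftrightarrow> num 0 \<in> elts Z \<and> (\<forall>y\<in>elts Z. cons y y \<in> elts Z)"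

lemma num_mem_successor_closed: "successor_closed Z \<Longrightarrow> num n \<in> elts Z"
  by (induction n) (auto simp: successor_closed_def num_Suc)

lemma successor_closed_remove:
  assumes "successor_closed Z" and m_not_num: "m \<notin> range num"
    and below: "\<And>y. y \<in> elts m \<Longrightarrow> y \<in> elts Z \<Longrightarrow> y \<in> range num"
  shows "successor_closed (sep Z (\<lambda>y. y \<noteq> m))"
proof -
  have "cons y y \<noteq> m" if "y \<in> elts Z" for y
  proof
    assume "cons y y = m"
    then have "y \<in> range num"
      using below[of y] that by auto
    then show False
      using m_not_num \<open>cons y y = m\<close> num_Suc by (metis rangeE rangeI)
  qed
  then show ?thesis
    using assms(1) m_not_num unfolding successor_closed_def by auto
qed

lemma (in transitive_zermelo) omega_existsI:
  assumes X_closed: "X \<in> M" "successor_closed X"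
  shows "\<exists>z\<in>M. elts z = range num"
proof -
  define L where "L = sep X (\<lambda>n. \<forall>Z\<in>M. elts Z \<subseteq> elts X \<and> successor_closed Z \<longrightarrow> n \<in> elts Z)"
  have "L \<in> M"
    unfolding L_def successor_closed_def by (intro sep_in definable_intros X_closed empty_in)
  have least: "elts L \<subseteq> elts Z" if "Z \<in> M" "elts Z \<subseteq> elts X" "successor_closed Z" for Z
    unfolding L_def using that by auto
  have L_closed: "successor_closed L"
    using X_closed(2) unfolding L_def successor_closed_def by auto
  have "m \<in> range num" if "m \<in> elts L" for m
    using wf_elts that
  proof (induction m rule: wf_induct_rule)
    case (less m)
    let ?Z = "sep L (\<lambda>y. y \<noteq> m)"
    show ?case
    proof (rule ccontr)
      assume "m \<notin> range num"
      then have "successor_closed ?Z"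
        using L_closed less.IH by (intro successor_closed_remove) auto
      moreover have "?Z \<in> M"
        by (intro sep_in definable_intros \<open>L \<in> M\<close> transitive[OF \<open>L \<in> M\<close> less.prems])
      moreover have "elts ?Z \<subseteq> elts X"
        unfolding L_def by auto
      ultimately have "m \<in> elts ?Z"
        using least less.prems by blast
      then show False
        by simp
    qed
  qed
  then have "elts L = range num"
    using num_mem_successor_closed[OF L_closed] by blast
  then show ?thesis
    using \<open>L \<in> M\<close> by blast
qed

context
  fixes V :: "'a::set_universe set"
  assumes V: "transitive_model_ZFC V"
begin

lemma transitive_model_mem: "x \<in> V \<Longrightarrow> y \<in> elts x \<Longrightarrow> y \<in> V"
  using V unfolding transitive_model_ZFC_def by blast

lemma transitive_model_eqI:
  assumes "z \<in> V" "elts w \<subseteq> V" "\<And>y. y \<in> V \<Longrightarrow> y \<in> elts z \<longleftrightarrow> y \<in> elts w"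
  shows "z = w"
  using assms transitive_model_mem by (intro elts_ext) blast

lemma transitive_model_upair:
  assumes "x \<in> V" "y \<in> V"
  shows "upair x y \<in> V"
proof -
  have "\<forall>x\<in>V. \<forall>y\<in>V. \<exists>z\<in>V. \<forall>w\<in>V. w \<in> elts z \<longleftrightarrow> w = x \<or> w = y"
    using V unfolding transitive_model_ZFC_def models_ZFC_def by (elim conjE)
  then obtain z where "z \<in> V" "\<forall>w\<in>V. w \<in> elts z \<longleftrightarrow> w = x \<or> w = y"
    using assms by blast
  then show ?thesis
    using transitive_model_eqI[of z "upair x y"] assms by auto
qed

lemma transitive_model_Unions:
  assumes x_in: "x \<in> V"
  shows "Unions x \<in> V"
proof -
  have "\<forall>x\<in>V. \<exists>z\<in>V. \<forall>w\<in>V. w \<in> elts z \<longleftrightarrow> (\<exists>y\<in>V. y \<in> elts x \<and> w \<in> elts y)"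
    using V unfolding transitive_model_ZFC_def models_ZFC_def by (elim conjE)
  then obtain z where z_union: "z \<in> V" "\<forall>w\<in>V. w \<in> elts z \<longleftrightarrow> (\<exists>y\<in>V. y \<in> elts x \<and> w \<in> elts y)"
    using x_in by blast
  have "z = Unions x"
  proof (rule transitive_model_eqI[OF z_union(1)])
    show "elts (Unions x) \<subseteq> V"
      using transitive_model_mem[OF transitive_model_mem[OF x_in]] by auto
    show "w \<in> elts z \<longleftrightarrow> w \<in> elts (Unions x)" if "w \<in> V" for w
      using z_union(2) that transitive_model_mem[OF x_in] by auto
  qed
  then show ?thesis
    using z_union(1) by simp
qed

lemma transitive_model_power:
  assumes "x \<in> V"
  shows "\<exists>z\<in>V. elts z = {y \<in> V. elts y \<subseteq> elts x}"
proof -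
  have "\<forall>x\<in>V. \<exists>z\<in>V. \<forall>w\<in>V. w \<in> elts z \<longleftrightarrow> (\<forall>v\<in>V. v \<in> elts w \<longrightarrow> v \<in> elts x)"
    using V unfolding transitive_model_ZFC_def models_ZFC_def by (elim conjE)
  then obtain z where z_power: "z \<in> V" "\<forall>w\<in>V. w \<in> elts z \<longleftrightarrow> (\<forall>v\<in>V. v \<in> elts w \<longrightarrow> v \<in> elts x)"
    using assms by blast
  then have "elts z = {y \<in> V. elts y \<subseteq> elts x}"
    using transitive_model_mem by blast
  then show ?thesis
    using z_power(1) by blast
qed

lemma transitive_model_separation:
  assumes range_e: "range e \<subseteq> V" and x_in: "x \<in> V"
  shows "sep x (\<lambda>w. sat V (case_nat w e) \<phi>) \<in> V"
proof -
  have "\<forall>\<phi> e. range e \<subseteq> V \<longrightarrow>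
      (\<forall>x\<in>V. \<exists>z\<in>V. \<forall>w\<in>V. w \<in> elts z \<longleftrightarrow> w \<in> elts x \<and> sat V (case_nat w e) \<phi>)"
    using V unfolding transitive_model_ZFC_def models_ZFC_def by (elim conjE)
  then obtain z where z_separated: "z \<in> V" "\<forall>w\<in>V. w \<in> elts z \<longleftrightarrow> w \<in> elts x \<and> sat V (case_nat w e) \<phi>"
    using range_e x_in by blast
  then have "z = sep x (\<lambda>w. sat V (case_nat w e) \<phi>)"
    using transitive_model_mem[OF x_in] by (intro transitive_model_eqI) auto
  then show ?thesis
    using z_separated(1) by simp
qed

lemma transitive_zermelo_model: "transitive_zermelo V"
proof
  show "V \<noteq> {}"
    using V unfolding transitive_model_ZFC_def models_ZFC_def by blast
qed (fact transitive_model_mem transitive_model_separation transitive_model_upair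
    transitive_model_Unions transitive_model_power)+

lemma transitive_model_omega: "\<exists>z\<in>V. elts z = range num"
proof -
  interpret transitive_zermelo V
    by (rule transitive_zermelo_model)
  have "\<exists>x\<in>V. (\<exists>z\<in>V. z \<in> elts x \<and> (\<forall>w\<in>V. w \<notin> elts z)) \<and>
      (\<forall>y\<in>V. y \<in> elts x \<longrightarrow> (\<exists>z\<in>V. z \<in> elts x \<and> (\<forall>w\<in>V. w \<in> elts z \<longleftrightarrow> w \<in> elts y \<or> w = y)))"
    using V unfolding transitive_model_ZFC_def models_ZFC_def by (elim conjE)
  then obtain x z where x_in: "x \<in> V" and z_new: "z \<in> V" "z \<in> elts x" "\<forall>w\<in>V. w \<notin> elts z"
    and step: "\<forall>y\<in>V. y \<in> elts x \<longrightarrow>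
      (\<exists>z\<in>V. z \<in> elts x \<and> (\<forall>w\<in>V. w \<in> elts z \<longleftrightarrow> w \<in> elts y \<or> w = y))"
    by blast
  show ?thesis
  proof (rule omega_existsI[OF x_in])
    have "z = num 0"
      using z_new(1,3) by (intro transitive_model_eqI) auto
    moreover have "cons y y \<in> elts x" if y_in: "y \<in> elts x" for y
    proof -
      obtain z where z_new: "z \<in> V" "z \<in> elts x" "\<forall>w\<in>V. w \<in> elts z \<longleftrightarrow> w \<in> elts y \<or> w = y"
        using step y_in transitive[OF x_in] by blast
      then have "z = cons y y"
        using transitive[OF x_in y_in] transitive[OF transitive[OF x_in y_in]]
        by (intro transitive_model_eqI) auto
      then show ?thesis
        using z_new(2) by simp
    qed
    ultimately show "successor_closed x"
      using z_new(2) unfolding successor_closed_def by simp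
  qed
qed

lemma transitive_model_replacement:
  assumes range_e: "range e \<subseteq> V" and x_in: "x \<in> V"
    and functional: "\<And>u. u \<in> elts x \<Longrightarrow> \<exists>!v. v \<in> V \<and> sat V (case_nat u (case_nat v e)) \<phi>"
  shows "\<exists>z\<in>V. elts z = {v \<in> V. \<exists>u\<in>elts x. sat V (case_nat u (case_nat v e)) \<phi>}"
proof -
  have "\<forall>\<phi> e. range e \<subseteq> V \<longrightarrow> (\<forall>x\<in>V.
      (\<forall>u\<in>V. u \<in> elts x \<longrightarrow> (\<exists>!v. v \<in> V \<and> sat V (case_nat u (case_nat v e)) \<phi>)) \<longrightarrow>
      (\<exists>z\<in>V. \<forall>v\<in>V. v \<in> elts z \<longleftrightarrow>
        (\<exists>u\<in>V. u \<in> elts x \<and> sat V (case_nat u (case_nat v e)) \<phi>)))"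
    using V unfolding transitive_model_ZFC_def models_ZFC_def by (elim conjE)
  from this[rule_format, OF range_e x_in functional] obtain z where z_image: "z \<in> V"
    "\<forall>v\<in>V. v \<in> elts z \<longleftrightarrow> (\<exists>u\<in>V. u \<in> elts x \<and> sat V (case_nat u (case_nat v e)) \<phi>)"
    by blast
  then have "elts z = {v \<in> V. \<exists>u\<in>elts x. sat V (case_nat u (case_nat v e)) \<phi>}"
    using transitive_model_mem[OF z_image(1)] transitive_model_mem[OF x_in] by blast
  then show ?thesis
    using z_image(1) by blast
qed

lemma transitive_model_choice:
  assumes x_in: "x \<in> V" and nonempty: "\<And>y. y \<in> elts x \<Longrightarrow> elts y \<noteq> {}"
    and disjoint: "\<And>y z. y \<in> elts x \<Longrightarrow> z \<in> elts x \<Longrightarrow> y \<noteq> z \<Longrightarrow> elts y \<inter> elts z = {}"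
  shows "\<exists>c\<in>V. \<forall>y\<in>elts x. \<exists>!w. w \<in> elts y \<and> w \<in> elts c"
proof -
  have choice: "\<forall>x\<in>V.
      (\<forall>y\<in>V. y \<in> elts x \<longrightarrow> (\<exists>w\<in>V. w \<in> elts y)) \<and>
      (\<forall>y\<in>V. \<forall>z\<in>V. y \<in> elts x \<and> z \<in> elts x \<and> y \<noteq> z \<longrightarrow>
         \<not> (\<exists>w\<in>V. w \<in> elts y \<and> w \<in> elts z)) \<longrightarrow>
      (\<exists>c\<in>V. \<forall>y\<in>V. y \<in> elts x \<longrightarrow> (\<exists>!w. w \<in> V \<and> w \<in> elts y \<and> w \<in> elts c))"
    using V unfolding transitive_model_ZFC_def models_ZFC_def by (elim conjE)
  have "\<exists>c\<in>V. \<forall>y\<in>V. y \<in> elts x \<longrightarrow> (\<exists>!w. w \<in> V \<and> w \<in> elts y \<and> w \<in> elts c)"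
  proof (rule bspec[OF choice x_in, THEN mp], intro conjI ballI impI)
    show "\<exists>w\<in>V. w \<in> elts y" if "y \<in> V" "y \<in> elts x" for y
      using nonempty[OF that(2)] transitive_model_mem[OF that(1)] by blast
    show "\<not> (\<exists>w\<in>V. w \<in> elts y \<and> w \<in> elts z)" if "y \<in> elts x \<and> z \<in> elts x \<and> y \<noteq> z" for y z
      using disjoint[of y z] that by blast
  qed
  then obtain c where "c \<in> V"
    and c_meets: "\<forall>y\<in>V. y \<in> elts x \<longrightarrow> (\<exists>!w. w \<in> V \<and> w \<in> elts y \<and> w \<in> elts c)"
    by (rule bexE)
  have "\<exists>!w. w \<in> elts y \<and> w \<in> elts c" if y_in: "y \<in> elts x" for y
  proof -
    have "y \<in> V"
      using transitive_model_mem[OF x_in y_in] .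
    then have "w \<in> V \<and> w \<in> elts y \<and> w \<in> elts c \<longleftrightarrow> w \<in> elts y \<and> w \<in> elts c" for w
      using transitive_model_mem by blast
    moreover have "\<exists>!w. w \<in> V \<and> w \<in> elts y \<and> w \<in> elts c"
      using c_meets y_in \<open>y \<in> V\<close> by blast
    ultimately show ?thesis
      by simp
  qed
  then show ?thesis
    using \<open>c \<in> V\<close> by blast
qed

lemma transitive_zfc_model: "transitive_zfc V"
proof -
  interpret transitive_zermelo V
    by (rule transitive_zermelo_model)
  show ?thesis
    by unfold_locales
      (fact transitive_model_omega transitive_model_replacement transitive_model_choice)+
qed

end

section \<open>Generic filters\<close>

locale generic_forcing = transitive_zfc V for V :: "'a::set_universe set" +
  fixes P R :: 'a and G :: "'a set"
  assumes P_in [intro]: "P \<in> V" and R_in [intro]: "R \<in> V"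
    and notion: "forcing_notion P R" and generic: "generic_filter V P R G"
begin

abbreviation stronger :: "'a \<Rightarrow> 'a \<Rightarrow> bool"  (infix "\<preceq>" 50) where
  "q \<preceq> p \<equiv> forcing_le R q p"

abbreviation val :: "'a \<Rightarrow> 'a" where
  "val \<equiv> name_val G"

lemma stronger_in_P:
  assumes "q \<preceq> p"
  shows "q \<in> elts P" "p \<in> elts P"
  using assms notion unfolding forcing_notion_def forcing_le_def by (metis opair_eq_iff)+

lemma stronger_refl: "p \<in> elts P \<Longrightarrow> p \<preceq> p"
  using notion unfolding forcing_notion_def by blast

lemma stronger_trans: "p \<preceq> q \<Longrightarrow> q \<preceq> r \<Longrightarrow> p \<preceq> r"
  using notion stronger_in_P unfolding forcing_notion_def by metis

lemma definable_stronger [definable_intros]: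
  "definable_term V s \<Longrightarrow> definable_term V t \<Longrightarrow> definable V (\<lambda>e. s e \<preceq> t e)"
  unfolding forcing_le_def by (intro definable_intros R_in)

lemma P_elem_in: "p \<in> elts P \<Longrightarrow> p \<in> V"
  using transitive P_in by blast

lemma forcing_filter_G: "forcing_filter P R G"
  using generic unfolding generic_filter_def by blast

lemma G_sub: "p \<in> G \<Longrightarrow> p \<in> elts P"
  using forcing_filter_G unfolding forcing_filter_def by blast

lemma G_upward: "p \<in> G \<Longrightarrow> p \<preceq> q \<Longrightarrow> q \<in> G"
  using forcing_filter_G stronger_in_P unfolding forcing_filter_def by metis

lemma G_directed:
  assumes "p \<in> G" "q \<in> G"
  obtains r where "r \<in> G" "r \<preceq> p" "r \<preceq> q"
  using forcing_filter_G assms unfolding forcing_filter_def by metis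

lemma G_nonempty: obtains p where "p \<in> G"
  using forcing_filter_G unfolding forcing_filter_def by blast

lemma generic_meets:
  assumes definable_Q: "definable V (\<lambda>e. Q (e 0))" and r_in_G: "r \<in> G"
    and dense: "\<And>p. p \<preceq> r \<Longrightarrow> \<exists>q. q \<preceq> p \<and> Q q"
  obtains q where "q \<in> G" "Q q"
proof -
  define D where "D = sep P (\<lambda>q. Q q \<or> (\<forall>s\<in>elts P. \<not> (s \<preceq> q \<and> s \<preceq> r)))"
  have "D \<in> V"
    unfolding D_def by (intro sep_in definable_intros P_in definable_Q P_elem_in G_sub r_in_G)
  moreover have "forcing_dense P R (elts D)"
    unfolding forcing_dense_def
  proof (intro conjI ballI)
    fix p assume p_in_P: "p \<in> elts P"
    show "\<exists>q\<in>elts D. q \<preceq> p"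
    proof (cases "\<exists>s. s \<preceq> p \<and> s \<preceq> r")
      case True
      then obtain s q where "s \<preceq> p" "q \<preceq> s" "Q q"
        using dense by blast
      then show ?thesis
        unfolding D_def by (intro bexI[of _ q]) (auto intro: stronger_trans stronger_in_P)
    next
      case False
      then show ?thesis
        unfolding D_def using p_in_P by (intro bexI[of _ p]) (auto intro: stronger_refl)
    qed
  qed (auto simp: D_def)
  ultimately obtain q where q_generic: "q \<in> G" "q \<in> elts D"
    using generic unfolding generic_filter_def by blast
  obtain s where "s \<in> G" "s \<preceq> q" "s \<preceq> r"
    using G_directed[OF q_generic(1) r_in_G] .
  then have "Q q"
    using q_generic(2) stronger_in_P unfolding D_def by auto
  then show thesis
    using that q_generic(1) by blast
qed

text \<open>
  The truth lemma reduces to the following equivalences, which let \<open>\<exists>p\<in>G\<close> commute with the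
  logical connectives. Their restriction to persistent and stable sets of conditions makes these
  sets correspond to the elements of the Boolean completion.
\<close>

definition persistent :: "('a \<Rightarrow> bool) \<Rightarrow> bool" where
  "persistent H \<longleftrightarrow> (\<forall>p q. H p \<longrightarrow> q \<preceq> p \<longrightarrow> H q)"

definition dense_below :: "('a \<Rightarrow> bool) \<Rightarrow> 'a \<Rightarrow> bool" where
  "dense_below H p \<longleftrightarrow> (\<forall>r\<in>elts P. r \<preceq> p \<longrightarrow> (\<exists>s\<in>elts P. s \<preceq> r \<and> H s))"

definition stable :: "('a \<Rightarrow> bool) \<Rightarrow> bool" where
  "stable H \<longleftrightarrow> (\<forall>p\<in>elts P. dense_below H p \<longrightarrow> H p)"

lemma persistentD: "persistent H \<Longrightarrow> H p \<Longrightarrow> q \<preceq> p \<Longrightarrow> H q"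
  unfolding persistent_def by blast

lemma stableD: "stable H \<Longrightarrow> p \<in> elts P \<Longrightarrow> dense_below H p \<Longrightarrow> H p"
  unfolding stable_def by blast

lemma dense_below_iff: "dense_below H p \<longleftrightarrow> (\<forall>r. r \<preceq> p \<longrightarrow> (\<exists>s. s \<preceq> r \<and> H s))"
  unfolding dense_below_def using stronger_in_P by blast

lemma dense_below_mono:
  assumes "dense_below H p" "\<And>s. s \<in> elts P \<Longrightarrow> H s \<Longrightarrow> H' s"
  shows "dense_below H' p"
  using assms unfolding dense_below_def by blast

lemma persistent_dense_below: "persistent (dense_below H)"
  unfolding persistent_def dense_below_iff using stronger_trans by blast

lemma stable_dense_below: "stable (dense_below H)"
  unfolding stable_def
proof (intro ballI impI)
  fix p assume dense: "dense_below (dense_below H) p"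
  show "dense_below H p"
    unfolding dense_below_iff[of H p]
  proof (intro allI impI)
    fix r assume "r \<preceq> p"
    then obtain s where s_dense: "s \<preceq> r" "dense_below H s"
      using dense unfolding dense_below_iff[of "dense_below H"] by blast
    then obtain s' where "s' \<preceq> s" "H s'"
      using stronger_refl[OF stronger_in_P(1)[OF s_dense(1)]] unfolding dense_below_iff by blast
    then show "\<exists>s. s \<preceq> r \<and> H s"
      using stronger_trans s_dense(1) by blast
  qed
qed

lemma dense_below_of_persistent:
  assumes "persistent H" "H p"
  shows "dense_below H p"
  using persistentD[OF assms] stronger_refl stronger_in_P(1) unfolding dense_below_iff by blast

lemma persistent_conj: "persistent H \<Longrightarrow> persistent H' \<Longrightarrow> persistent (\<lambda>p. H p \<and> H' p)"
  unfolding persistent_def by blast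

lemma stable_conj:
  assumes "stable H" "stable H'"
  shows "stable (\<lambda>p. H p \<and> H' p)"
  unfolding stable_def
proof (intro ballI impI)
  fix p assume p_in: "p \<in> elts P" and "dense_below (\<lambda>p. H p \<and> H' p) p"
  then have "dense_below H p" "dense_below H' p"
    by (auto elim!: dense_below_mono)
  then show "H p \<and> H' p"
    using stableD[OF assms(1) p_in] stableD[OF assms(2) p_in] by blast
qed

lemma persistent_all:
  "(\<And>x. x \<in> V \<Longrightarrow> N x \<Longrightarrow> persistent (H x)) \<Longrightarrow> persistent (\<lambda>p. \<forall>x\<in>V. N x \<longrightarrow> H x p)"
  unfolding persistent_def by blast

lemma stable_all:
  assumes "\<And>x. x \<in> V \<Longrightarrow> N x \<Longrightarrow> stable (H x)"
  shows "stable (\<lambda>p. \<forall>x\<in>V. N x \<longrightarrow> H x p)"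
  unfolding stable_def
proof (intro ballI impI)
  fix p x assume p_in: "p \<in> elts P" and x_in: "x \<in> V" "N x"
    and "dense_below (\<lambda>p. \<forall>x\<in>V. N x \<longrightarrow> H x p) p"
  then have "dense_below (H x) p"
    by (elim dense_below_mono) blast
  then show "H x p"
    by (rule stableD[OF assms[OF x_in] p_in])
qed

definition refutes :: "('a \<Rightarrow> bool) \<Rightarrow> 'a \<Rightarrow> bool" where
  "refutes H p \<longleftrightarrow> (\<forall>q\<in>elts P. q \<preceq> p \<longrightarrow> \<not> H q)"

lemma refutesD: "refutes H p \<Longrightarrow> q \<preceq> p \<Longrightarrow> \<not> H q"
  unfolding refutes_def using stronger_in_P by blast

lemma persistent_refutes: "persistent (refutes H)"
  unfolding persistent_def refutes_def using stronger_trans by blast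

lemma stable_refutes:
  assumes "persistent H"
  shows "stable (refutes H)"
  unfolding stable_def
proof (intro ballI impI)
  fix p assume dense: "dense_below (refutes H) p"
  show "refutes H p"
    unfolding refutes_def
  proof (intro ballI impI notI)
    fix q assume q_forces: "q \<preceq> p" "H q"
    then obtain s where s_refutes: "s \<preceq> q" "refutes H s"
      using dense unfolding dense_below_iff by blast
    then show False
      using persistentD[OF assms q_forces(2)] refutesD stronger_refl stronger_in_P(1) by blast
  qed
qed

lemma definable_refutes [definable_intros]:
  assumes "definable V (\<lambda>e. H (e 0) (\<lambda>n. e (Suc n)))" "definable_term V p"
  shows "definable V (\<lambda>e. refutes (\<lambda>s. H s e) (p e))"
  unfolding refutes_def
  by (intro definable_intros P_in assms assms(2)[THEN definable_term_rename])

lemma generic_dense_below_iff: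
  assumes "definable V (\<lambda>e. H (e 0))" "persistent H"
  shows "(\<exists>p\<in>G. dense_below H p) \<longleftrightarrow> (\<exists>p\<in>G. H p)"
proof
  assume "\<exists>p\<in>G. dense_below H p"
  then obtain p where "p \<in> G" "dense_below H p"
    by blast
  then show "\<exists>p\<in>G. H p"
    using generic_meets[OF assms(1)] unfolding dense_below_iff by metis
qed (use assms(2) dense_below_of_persistent in blast)

lemma generic_conj_iff:
  assumes "persistent H" "persistent H'"
  shows "(\<exists>p\<in>G. H p \<and> H' p) \<longleftrightarrow> (\<exists>p\<in>G. H p) \<and> (\<exists>p\<in>G. H' p)"
proof
  assume "(\<exists>p\<in>G. H p) \<and> (\<exists>p\<in>G. H' p)"
  then obtain p q where p_q_forces: "p \<in> G" "q \<in> G" "H p" "H' q"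
    by blast
  obtain r where "r \<in> G" "r \<preceq> p" "r \<preceq> q"
    using G_directed[OF p_q_forces(1,2)] .
  then show "\<exists>p\<in>G. H p \<and> H' p"
    using persistentD[OF assms(1) p_q_forces(3)] persistentD[OF assms(2) p_q_forces(4)] by blast
qed blast

lemma generic_not_iff:
  assumes persistent_H: "definable V (\<lambda>e. H (e 0))" "persistent H"
  shows "(\<exists>p\<in>G. refutes H p) \<longleftrightarrow> \<not> (\<exists>p\<in>G. H p)"
proof
  assume "\<exists>p\<in>G. refutes H p"
  then show "\<not> (\<exists>p\<in>G. H p)"
    using G_directed refutesD persistentD[OF persistent_H(2)] by metis
next
  assume never: "\<not> (\<exists>p\<in>G. H p)"
  obtain r where r_in_G: "r \<in> G"
    using G_nonempty .
  obtain p where "p \<in> G" "H p \<or> refutes H p"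
  proof (rule generic_meets[OF _ r_in_G])
    show "definable V (\<lambda>e. H (e 0) \<or> refutes H (e 0))"
      by (intro definable_intros persistent_H(1))
    show "\<exists>q. q \<preceq> p \<and> (H q \<or> refutes H q)" if "p \<preceq> r" for p
      using stronger_refl[OF stronger_in_P(1)[OF that]] unfolding refutes_def by blast
  qed blast
  then show "\<exists>p\<in>G. refutes H p"
    using never by blast
qed

lemma generic_imp_iff:
  assumes persistent_H: "definable V (\<lambda>e. H (e 0))" "persistent H" and q_in: "q \<in> elts P"
  shows "(\<exists>p\<in>G. \<forall>r\<in>elts P. r \<preceq> p \<and> r \<preceq> q \<longrightarrow> dense_below H r) \<longleftrightarrow> (q \<in> G \<longrightarrow> (\<exists>p\<in>G. H p))"
proof
  assume "\<exists>p\<in>G. \<forall>r\<in>elts P. r \<preceq> p \<and> r \<preceq> q \<longrightarrow> dense_below H r"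
  then have "\<exists>p\<in>G. dense_below H p" if "q \<in> G"
    using G_directed[OF _ that] G_sub by metis
  then show "q \<in> G \<longrightarrow> (\<exists>p\<in>G. H p)"
    using generic_dense_below_iff[OF persistent_H] by blast
next
  assume generic_imp: "q \<in> G \<longrightarrow> (\<exists>p\<in>G. H p)"
  show "\<exists>p\<in>G. \<forall>r\<in>elts P. r \<preceq> p \<and> r \<preceq> q \<longrightarrow> dense_below H r"
  proof (cases "q \<in> G")
    case True
    then obtain p where "p \<in> G" "H p"
      using generic_imp by blast
    then show ?thesis
      using dense_below_of_persistent[OF persistent_H(2)] persistentD[OF persistent_H(2)] by blast
  next
    case False
    have "definable V (\<lambda>e. e 0 \<preceq> q)"
      by (intro definable_intros P_elem_in q_in)
    moreover have "persistent (\<lambda>p. p \<preceq> q)"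
      unfolding persistent_def using stronger_trans by blast
    moreover have "\<not> (\<exists>p\<in>G. p \<preceq> q)"
      using False G_upward by blast
    ultimately have "\<exists>p\<in>G. refutes (\<lambda>p. p \<preceq> q) p"
      using generic_not_iff[where H = "\<lambda>p. p \<preceq> q"] by blast
    then show ?thesis
      unfolding refutes_def by blast
  qed
qed

lemma generic_all_iff:
  assumes definable_N: "definable V (\<lambda>e. N (e 0))"
    and definable_H: "definable V (\<lambda>e. H (e 0) (e (Suc 0)))"
    and persistent: "\<And>x. x \<in> V \<Longrightarrow> persistent (H x)" and stable: "\<And>x. x \<in> V \<Longrightarrow> stable (H x)"
  shows "(\<exists>p\<in>G. \<forall>x\<in>V. N x \<longrightarrow> H x p) \<longleftrightarrow> (\<forall>x\<in>V. N x \<longrightarrow> (\<exists>p\<in>G. H x p))"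
proof
  assume each: "\<forall>x\<in>V. N x \<longrightarrow> (\<exists>p\<in>G. H x p)"
  obtain r where r_in_G: "r \<in> G"
    using G_nonempty .
  obtain p where p: "p \<in> G" "(\<forall>x\<in>V. N x \<longrightarrow> H x p) \<or> (\<exists>x\<in>V. N x \<and> refutes (H x) p)"
  proof (rule generic_meets[OF _ r_in_G])
    have "definable V (\<lambda>e. H (e (Suc 0)) (e 0))"
      using definable_H by (rule definable_swap)
    then show "definable V (\<lambda>e. (\<forall>x\<in>V. N x \<longrightarrow> H x (e 0)) \<or> (\<exists>x\<in>V. N x \<and> refutes (H x) (e 0)))"
      unfolding refutes_def by (intro definable_intros definable_N definable_H P_in)
    fix p assume "p \<preceq> r"
    then have p: "p \<in> elts P"
      using stronger_in_P by blast
    show "\<exists>q. q \<preceq> p \<and> ((\<forall>x\<in>V. N x \<longrightarrow> H x q) \<or> (\<exists>x\<in>V. N x \<and> refutes (H x) q))"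
    proof (cases "\<forall>x\<in>V. N x \<longrightarrow> H x p")
      case False
      then obtain x where "x \<in> V" "N x" "\<not> dense_below (H x) p"
        using stableD[OF stable p] by blast
      then show ?thesis
        unfolding dense_below_def refutes_def by blast
    qed (use stronger_refl p in blast)
  qed blast
  have "\<not> refutes (H x) p" if "x \<in> V" "N x" for x
    using each that G_directed[OF p(1)] refutesD persistentD[OF persistent[OF that(1)]] by metis
  then show "\<exists>p\<in>G. \<forall>x\<in>V. N x \<longrightarrow> H x p"
    using p by blast
qed blast

section \<open>Names\<close>

lemma forcing_name_iff:
  "forcing_name P t \<longleftrightarrow> (\<forall>z\<in>elts t. \<exists>s. \<exists>p\<in>elts P. z = opair s p \<and> forcing_name P s)"
  by (subst forcing_name.simps) blast

lemma forcing_nameD: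
  assumes "forcing_name P t" "opair s p \<in> elts t"
  shows "forcing_name P s" "p \<in> elts P"
  using assms forcing_name_iff[of t] by (auto simp: opair_eq_iff)

lemma opair_fst_in: "t \<in> V \<Longrightarrow> opair s p \<in> elts t \<Longrightarrow> s \<in> V"
  using opair_inD(1) transitive by blast

definition name_clause :: "('a \<Rightarrow> bool) \<Rightarrow> 'a \<Rightarrow> bool" where
  "name_clause X t \<longleftrightarrow> (\<forall>z\<in>elts t. \<exists>s\<in>V. \<exists>p\<in>elts P. z = opair s p \<and> X s)"

lemma definable_name_clause: "definable V (\<lambda>e. name_clause (\<lambda>y. y \<in> elts (e 0)) (e (Suc 0)))"
  unfolding name_clause_def by (intro definable_intros P_in)

lemma forcing_name_iff_largest_solution:
  assumes "t \<in> V"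
  shows "forcing_name P t \<longleftrightarrow> largest_solution name_clause t"
  using wf_trancl_elts assms
proof (induction t rule: wf_induct_rule)
  case (less t)
  obtain T where T_closure: "T \<in> V" "t \<in> elts T" "transitive_set T"
    using transitive_set_exists[OF less.prems] .
  have "largest_solution name_clause t \<longleftrightarrow> name_clause (largest_solution name_clause) t"
  proof (rule largest_solution_unfold[OF _ definable_name_clause T_closure(1,2)])
    show "name_clause Y z" if "name_clause X z" "\<And>y. X y \<Longrightarrow> Y y" for X Y z
      using that unfolding name_clause_def by blast
    show "name_clause (\<lambda>y. X y \<and> y \<in> elts T) z" if z_clause: "z \<in> elts T" "name_clause X z" for X z
      unfolding name_clause_def
    proof
      fix w assume w_in: "w \<in> elts z"
      then obtain s p where w_eq: "s \<in> V" "p \<in> elts P" "w = opair s p" "X s"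
        using z_clause(2) unfolding name_clause_def by blast
      moreover have "s \<in> elts T"
        using transitive_set_opair(1)[OF T_closure(3)]
          transitive_setD[OF T_closure(3) z_clause(1) w_in] w_eq(3) by blast
      ultimately show "\<exists>s\<in>V. \<exists>p\<in>elts P. w = opair s p \<and> X s \<and> s \<in> elts T"
        by blast
    qed
  qed
  also have "\<dots> \<longleftrightarrow> name_clause (forcing_name P) t"
  proof -
    have "forcing_name P s \<longleftrightarrow> largest_solution name_clause s"
      if "s \<in> V" "opair s p \<in> elts t" for s p
      using less.IH[OF opair_fst_below[OF that(2)] that(1)] .
    then show ?thesis
      unfolding name_clause_def[of _ t] by (metis (no_types, lifting))
  qed
  also have "\<dots> \<longleftrightarrow> forcing_name P t"
    using forcing_name_iff[of t] opair_fst_in[OF less.prems] unfolding name_clause_def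
    by (metis (no_types, lifting))
  finally show ?case ..
qed

lemma definable_forcing_name [definable_intros]:
  assumes "definable_term V t"
  shows "definable V (\<lambda>e. forcing_name P (t e))"
  using definable_largest_solution[OF definable_name_clause assms]
  by (rule definable_cong) (intro forcing_name_iff_largest_solution definable_term_in[OF assms])

lemma in_valE:
  assumes "x \<in> elts (val t)"
  obtains s p where "x = val s" "p \<in> G" "opair s p \<in> elts t"
  using assms unfolding elts_name_val by blast

lemma in_valI: "p \<in> G \<Longrightarrow> opair s p \<in> elts t \<Longrightarrow> val s \<in> elts (val t)"
  unfolding elts_name_val by blast

section \<open>Forcing of equality and membership\<close>

definition forces_member_at :: "('a \<Rightarrow> 'a \<Rightarrow> 'a \<Rightarrow> bool) \<Rightarrow> 'a \<Rightarrow> 'a \<Rightarrow> 'a \<Rightarrow> bool" where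
  "forces_member_at E \<rho> \<tau> s \<longleftrightarrow> (\<exists>\<pi>\<in>V. \<exists>q\<in>elts P. opair \<pi> q \<in> elts \<tau> \<and> s \<preceq> q \<and> E \<rho> \<pi> s)"

definition forces_entry :: "('a \<Rightarrow> 'a \<Rightarrow> 'a \<Rightarrow> bool) \<Rightarrow> 'a \<Rightarrow> 'a \<Rightarrow> 'a \<Rightarrow> bool" where
  "forces_entry E \<tau> z p \<longleftrightarrow> (\<forall>\<rho>\<in>V. \<forall>q\<in>elts P. z = opair \<rho> q \<longrightarrow>
     (\<forall>r\<in>elts P. r \<preceq> p \<and> r \<preceq> q \<longrightarrow> dense_below (forces_member_at E \<rho> \<tau>) r))"

definition forces_subset :: "('a \<Rightarrow> 'a \<Rightarrow> 'a \<Rightarrow> bool) \<Rightarrow> 'a \<Rightarrow> 'a \<Rightarrow> 'a \<Rightarrow> bool" where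
  "forces_subset E \<sigma> \<tau> p \<longleftrightarrow> (\<forall>z\<in>V. z \<in> elts \<sigma> \<longrightarrow> forces_entry E \<tau> z p)"

lemma forces_entry_opair:
  "\<rho> \<in> V \<Longrightarrow> q \<in> elts P \<Longrightarrow> forces_entry E \<tau> (opair \<rho> q) p \<longleftrightarrow>
    (\<forall>r\<in>elts P. r \<preceq> p \<and> r \<preceq> q \<longrightarrow> dense_below (forces_member_at E \<rho> \<tau>) r)"
  unfolding forces_entry_def by (auto simp: opair_eq_iff)

lemma forces_subset_mono:
  assumes "forces_subset E \<sigma> \<tau> p"
    and E_mono: "\<And>\<rho> q \<pi> q' s. opair \<rho> q \<in> elts \<sigma> \<Longrightarrow> opair \<pi> q' \<in> elts \<tau> \<Longrightarrow> s \<in> elts P \<Longrightarrow>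
      E \<rho> \<pi> s \<Longrightarrow> E' \<rho> \<pi> s"
  shows "forces_subset E' \<sigma> \<tau> p"
  unfolding forces_subset_def forces_entry_def
proof (intro ballI impI)
  fix z \<rho> q r assume z_eq: "z \<in> V" "z \<in> elts \<sigma>" "\<rho> \<in> V" "q \<in> elts P" "z = opair \<rho> q"
    and r_stronger: "r \<in> elts P" "r \<preceq> p \<and> r \<preceq> q"
  have "dense_below (forces_member_at E \<rho> \<tau>) r"
    using assms(1) z_eq r_stronger unfolding forces_subset_def forces_entry_def by blast
  then show "dense_below (forces_member_at E' \<rho> \<tau>) r"
    by (rule dense_below_mono) (use E_mono z_eq in \<open>unfold forces_member_at_def, blast\<close>)
qed

lemma persistent_forces_entry: "persistent (forces_entry E \<tau> z)"
  unfolding persistent_def forces_entry_def using stronger_trans by blast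

lemma stable_forces_entry: "stable (forces_entry E \<tau> z)"
  unfolding stable_def
proof (intro ballI impI)
  fix p assume dense: "dense_below (forces_entry E \<tau> z) p"
  show "forces_entry E \<tau> z p"
    unfolding forces_entry_def
  proof (intro ballI impI)
    fix \<rho> q r assume z_eq: "\<rho> \<in> V" "q \<in> elts P" "z = opair \<rho> q"
      and r_stronger: "r \<in> elts P" "r \<preceq> p \<and> r \<preceq> q"
    have "dense_below (forces_entry E \<tau> z) r"
      using persistentD[OF persistent_dense_below dense] r_stronger(2) by blast
    then have "dense_below (dense_below (forces_member_at E \<rho> \<tau>)) r"
      using z_eq r_stronger(2) stronger_trans stronger_refl[OF stronger_in_P(1)]
        forces_entry_opair[OF z_eq(1,2)]
      unfolding dense_below_iff[of _ r] by (metis stronger_in_P(1))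
    then show "dense_below (forces_member_at E \<rho> \<tau>) r"
      using stableD[OF stable_dense_below r_stronger(1)] by blast
  qed
qed

lemma persistent_forces_subset: "persistent (forces_subset E \<sigma> \<tau>)"
  unfolding forces_subset_def[abs_def] by (intro persistent_all persistent_forces_entry)

lemma stable_forces_subset: "stable (forces_subset E \<sigma> \<tau>)"
  unfolding forces_subset_def[abs_def] by (intro stable_all stable_forces_entry)

text \<open>
  Pairs \<open>opair \<sigma> (opair \<tau> p)\<close> encode the statement that \<open>p\<close> forces \<open>\<sigma>\<close> and \<open>\<tau>\<close> to be equal.
\<close>

definition eq_clause :: "('a \<Rightarrow> bool) \<Rightarrow> 'a \<Rightarrow> bool" where
  "eq_clause X z \<longleftrightarrow> (\<exists>\<sigma>\<in>V. \<exists>\<tau>\<in>V. \<exists>p\<in>elts P. z = opair \<sigma> (opair \<tau> p) \<and>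
     forces_subset (\<lambda>\<rho> \<pi> s. X (opair \<rho> (opair \<pi> s))) \<sigma> \<tau> p \<and>
     forces_subset (\<lambda>\<pi> \<rho> s. X (opair \<rho> (opair \<pi> s))) \<tau> \<sigma> p)"

definition forces_eq :: "'a \<Rightarrow> 'a \<Rightarrow> 'a \<Rightarrow> bool" where
  "forces_eq \<sigma> \<tau> p \<longleftrightarrow> largest_solution eq_clause (opair \<sigma> (opair \<tau> p))"

definition forces_mem :: "'a \<Rightarrow> 'a \<Rightarrow> 'a \<Rightarrow> bool" where
  "forces_mem \<sigma> \<tau> = dense_below (forces_member_at forces_eq \<sigma> \<tau>)"

lemma eq_clause_opair:
  assumes "\<sigma> \<in> V" "\<tau> \<in> V" "p \<in> elts P"
  shows "eq_clause X (opair \<sigma> (opair \<tau> p)) \<longleftrightarrow>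
    forces_subset (\<lambda>\<rho> \<pi> s. X (opair \<rho> (opair \<pi> s))) \<sigma> \<tau> p \<and>
    forces_subset (\<lambda>\<pi> \<rho> s. X (opair \<rho> (opair \<pi> s))) \<tau> \<sigma> p"
  using assms unfolding eq_clause_def by (auto simp: opair_eq_iff)

lemma definable_eq_clause: "definable V (\<lambda>e. eq_clause (\<lambda>y. y \<in> elts (e 0)) (e (Suc 0)))"
  unfolding eq_clause_def forces_subset_def forces_entry_def forces_member_at_def dense_below_def
  by (intro definable_intros P_in)

lemma definable_forces_eq [definable_intros]:
  "definable_term V s \<Longrightarrow> definable_term V t \<Longrightarrow> definable_term V p \<Longrightarrow>
    definable V (\<lambda>e. forces_eq (s e) (t e) (p e))"
  unfolding forces_eq_def
  by (intro definable_largest_solution[OF definable_eq_clause] definable_intros)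

lemma definable_forces_mem [definable_intros]:
  assumes "definable_term V s" "definable_term V t" "definable_term V p"
  shows "definable V (\<lambda>e. forces_mem (s e) (t e) (p e))"
  unfolding forces_mem_def forces_member_at_def dense_below_def
  by (intro definable_intros assms[THEN definable_term_rename] P_in)

lemma forces_eq_iff:
  assumes \<sigma>: "\<sigma> \<in> V" and \<tau>: "\<tau> \<in> V" and p_in: "p \<in> elts P"
  shows "forces_eq \<sigma> \<tau> p \<longleftrightarrow>
    forces_subset forces_eq \<sigma> \<tau> p \<and> forces_subset (\<lambda>\<pi> \<rho>. forces_eq \<rho> \<pi>) \<tau> \<sigma> p"
proof -
  obtain T where T_closure: "T \<in> V" "opair \<sigma> \<tau> \<in> elts T" "transitive_set T"
    using transitive_set_exists[OF opair_in[OF \<sigma> \<tau>]] .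
  have triple_in: "x \<in> V" if "x \<in> elts T" for x
    using transitive[OF T_closure(1) that] .
  let ?triples = "times T (times T P)"
  have triples: "?triples \<in> V" "opair \<rho> (opair \<pi> s) \<in> elts ?triples \<longleftrightarrow>
      \<rho> \<in> elts T \<and> \<pi> \<in> elts T \<and> s \<in> elts P" for \<rho> \<pi> s
    using T_closure(1) by (auto simp: times_in P_in)
  have "eq_clause (\<lambda>y. X y \<and> y \<in> elts ?triples) z"
    if z_clause: "z \<in> elts ?triples" "eq_clause X z" for X z
  proof -
    obtain \<sigma> \<tau> p where z_eq: "z = opair \<sigma> (opair \<tau> p)" "\<sigma> \<in> V" "\<tau> \<in> V" "p \<in> elts P"
      using z_clause(2) unfolding eq_clause_def by blast
    then have "\<sigma> \<in> elts T" "\<tau> \<in> elts T"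
      using z_clause(1) triples(2) by auto
    then have "\<rho> \<in> elts T" if "opair \<rho> q \<in> elts \<sigma> \<or> opair \<rho> q \<in> elts \<tau>" for \<rho> q
      using that transitive_set_opair(1)[OF T_closure(3)] transitive_setD[OF T_closure(3)] by blast
    then show ?thesis
      using z_clause(2) unfolding z_eq(1) eq_clause_opair[OF z_eq(2-4)] triples(2)
      by (auto elim!: forces_subset_mono)
  qed
  moreover have "eq_clause Y z" if "eq_clause X z" "\<And>y. X y \<Longrightarrow> Y y" for X Y z
    using that(1) unfolding eq_clause_def by (blast intro: forces_subset_mono that(2))
  moreover have "opair \<sigma> (opair \<tau> p) \<in> elts ?triples"
    using transitive_set_opair[OF T_closure(3,2)] p_in triples(2) by blast
  ultimately have "forces_eq \<sigma> \<tau> p \<longleftrightarrow> eq_clause (largest_solution eq_clause) (opair \<sigma> (opair \<tau> p))"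
    unfolding forces_eq_def using definable_eq_clause triples(1)
    by (intro largest_solution_unfold) blast+
  then show ?thesis
    unfolding eq_clause_opair[OF assms] forces_eq_def .
qed

lemma persistent_forces_eq:
  assumes "\<sigma> \<in> V" "\<tau> \<in> V"
  shows "persistent (forces_eq \<sigma> \<tau>)"
  unfolding persistent_def
proof (intro allI impI)
  fix p q assume "forces_eq \<sigma> \<tau> p" "q \<preceq> p"
  then show "forces_eq \<sigma> \<tau> q"
    using forces_eq_iff[OF assms] stronger_in_P[OF \<open>q \<preceq> p\<close>] persistentD[OF persistent_forces_subset]
    by blast
qed

lemma stable_forces_eq:
  assumes "\<sigma> \<in> V" "\<tau> \<in> V"
  shows "stable (forces_eq \<sigma> \<tau>)"
  unfolding stable_def
proof (intro ballI impI)
  fix p assume p_in: "p \<in> elts P" and dense: "dense_below (forces_eq \<sigma> \<tau>) p"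
  have "dense_below (forces_subset forces_eq \<sigma> \<tau>) p"
    "dense_below (forces_subset (\<lambda>\<pi> \<rho>. forces_eq \<rho> \<pi>) \<tau> \<sigma>) p"
    using dense forces_eq_iff[OF assms] by (auto elim!: dense_below_mono)
  then show "forces_eq \<sigma> \<tau> p"
    unfolding forces_eq_iff[OF assms p_in] using stableD[OF stable_forces_subset p_in] by blast
qed

lemma persistent_forces_mem: "persistent (forces_mem \<sigma> \<tau>)"
  unfolding forces_mem_def by (rule persistent_dense_below)

lemma stable_forces_mem: "stable (forces_mem \<sigma> \<tau>)"
  unfolding forces_mem_def by (rule stable_dense_below)

lemma persistent_forces_member_at:
  assumes "\<And>\<pi>. \<pi> \<in> V \<Longrightarrow> persistent (E \<rho> \<pi>)"
  shows "persistent (forces_member_at E \<rho> \<tau>)"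
  using assms stronger_trans unfolding persistent_def forces_member_at_def by meson

lemma forces_member_at_truth:
  assumes \<tau>: "\<tau> \<in> V" and persistent: "\<And>\<pi>. \<pi> \<in> V \<Longrightarrow> persistent (E \<rho> \<pi>)"
    and truth: "\<And>\<pi> q. opair \<pi> q \<in> elts \<tau> \<Longrightarrow> val \<rho> = val \<pi> \<longleftrightarrow> (\<exists>p\<in>G. E \<rho> \<pi> p)"
  shows "val \<rho> \<in> elts (val \<tau>) \<longleftrightarrow> (\<exists>p\<in>G. forces_member_at E \<rho> \<tau> p)"
proof
  assume "val \<rho> \<in> elts (val \<tau>)"
  then obtain \<pi> q where \<pi>: "val \<rho> = val \<pi>" "q \<in> G" "opair \<pi> q \<in> elts \<tau>"
    by (rule in_valE)
  have "\<pi> \<in> V"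
    using opair_fst_in[OF \<tau> \<pi>(3)] .
  obtain p where p: "p \<in> G" "E \<rho> \<pi> p"
    using truth[OF \<pi>(3)] \<pi>(1) by blast
  obtain s where s_stronger: "s \<in> G" "s \<preceq> p" "s \<preceq> q"
    using G_directed[OF p(1) \<pi>(2)] .
  then have "E \<rho> \<pi> s"
    using persistentD[OF persistent[OF \<open>\<pi> \<in> V\<close>] p(2)] by blast
  then show "\<exists>p\<in>G. forces_member_at E \<rho> \<tau> p"
    unfolding forces_member_at_def using s_stronger \<pi>(3) G_sub[OF \<pi>(2)] \<open>\<pi> \<in> V\<close> by blast
next
  assume "\<exists>p\<in>G. forces_member_at E \<rho> \<tau> p"
  then obtain p \<pi> q where p: "p \<in> G" and \<pi>: "opair \<pi> q \<in> elts \<tau>" "p \<preceq> q" "E \<rho> \<pi> p"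
    unfolding forces_member_at_def by blast
  then have "val \<rho> = val \<pi>"
    using truth by blast
  then show "val \<rho> \<in> elts (val \<tau>)"
    using in_valI[OF G_upward[OF p \<pi>(2)] \<pi>(1)] by simp
qed

context
  fixes E \<sigma> \<tau>
  assumes \<sigma>_in: "\<sigma> \<in> V" and \<tau>_in: "\<tau> \<in> V"
    and definable_E: "\<And>i j k. definable V (\<lambda>e. E (e i) (e j) (e k))"
    and persistent_E: "\<And>\<rho> \<pi>. \<rho> \<in> V \<Longrightarrow> \<pi> \<in> V \<Longrightarrow> persistent (E \<rho> \<pi>)"
    and E_truth: "\<And>\<rho> q \<pi> q'. opair \<rho> q \<in> elts \<sigma> \<Longrightarrow> opair \<pi> q' \<in> elts \<tau> \<Longrightarrow>
      val \<rho> = val \<pi> \<longleftrightarrow> (\<exists>p\<in>G. E \<rho> \<pi> p)"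
begin

lemma forces_entry_truth:
  assumes z_in: "z \<in> elts \<sigma>"
  shows "(\<exists>p\<in>G. forces_entry E \<tau> z p) \<longleftrightarrow> (\<forall>\<rho>. \<forall>q\<in>G. z = opair \<rho> q \<longrightarrow> val \<rho> \<in> elts (val \<tau>))"
proof (cases "\<exists>\<rho>. \<exists>q\<in>elts P. z = opair \<rho> q")
  case True
  then obtain \<rho> q where z_eq: "z = opair \<rho> q" and q_in: "q \<in> elts P"
    by blast
  have \<rho>_in: "\<rho> \<in> V"
    using opair_fst_in[OF \<sigma>_in] z_in z_eq by blast
  have "definable V (\<lambda>e. E \<rho> (e j) (e k))" for j k
    by (rule definable_plug[OF definable_term_const[OF \<rho>_in], where Q = "\<lambda>x e. E x (e j) (e k)"])
      (rule definable_E)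
  then have "definable V (\<lambda>e. forces_member_at E \<rho> \<tau> (e 0))"
    unfolding forces_member_at_def by (intro definable_intros P_in \<tau>_in)
  then have "(\<exists>p\<in>G. forces_entry E \<tau> z p) \<longleftrightarrow> (q \<in> G \<longrightarrow> (\<exists>p\<in>G. forces_member_at E \<rho> \<tau> p))"
    unfolding z_eq forces_entry_opair[OF \<rho>_in q_in]
    by (intro generic_imp_iff persistent_forces_member_at persistent_E \<rho>_in q_in)
  moreover have "val \<rho> \<in> elts (val \<tau>) \<longleftrightarrow> (\<exists>p\<in>G. forces_member_at E \<rho> \<tau> p)"
    using z_in by (intro forces_member_at_truth \<tau>_in persistent_E \<rho>_in E_truth) (auto simp: z_eq)
  ultimately show ?thesis
    unfolding z_eq by (auto simp: opair_eq_iff)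
next
  case False
  then show ?thesis
    using G_nonempty G_sub unfolding forces_entry_def by metis
qed

lemma forces_subset_truth:
  "elts (val \<sigma>) \<subseteq> elts (val \<tau>) \<longleftrightarrow> (\<exists>p\<in>G. forces_subset E \<sigma> \<tau> p)"
proof -
  have "elts (val \<sigma>) \<subseteq> elts (val \<tau>) \<longleftrightarrow>
      (\<forall>z\<in>elts \<sigma>. \<forall>\<rho>. \<forall>q\<in>G. z = opair \<rho> q \<longrightarrow> val \<rho> \<in> elts (val \<tau>))"
    by (auto elim!: in_valE intro: in_valI)
  also have "\<dots> \<longleftrightarrow> (\<forall>z\<in>V. z \<in> elts \<sigma> \<longrightarrow> (\<exists>p\<in>G. forces_entry E \<tau> z p))"
    using forces_entry_truth transitive[OF \<sigma>_in] by metis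
  also have "\<dots> \<longleftrightarrow> (\<exists>p\<in>G. forces_subset E \<sigma> \<tau> p)"
    unfolding forces_subset_def
  proof (rule generic_all_iff[symmetric])
    show "definable V (\<lambda>e. e 0 \<in> elts \<sigma>)"
      by (intro definable_intros \<sigma>_in)
    show "definable V (\<lambda>e. forces_entry E \<tau> (e 0) (e (Suc 0)))"
      unfolding forces_entry_def forces_member_at_def dense_below_def
      by (intro definable_intros P_in \<tau>_in definable_E)
  qed (rule persistent_forces_entry stable_forces_entry)+
  finally show ?thesis .
qed

end

lemma forces_eq_truth:
  assumes "\<sigma> \<in> V" "\<tau> \<in> V"
  shows "val \<sigma> = val \<tau> \<longleftrightarrow> (\<exists>p\<in>G. forces_eq \<sigma> \<tau> p)"
  using wf_trancl_elts assms
proof (induction \<sigma> arbitrary: \<tau> rule: wf_induct_rule)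
  case (less \<sigma>)
  note \<sigma> = less.prems(1) and \<tau> = less.prems(2)
  have IH: "val \<rho> = val \<pi> \<longleftrightarrow> (\<exists>p\<in>G. forces_eq \<rho> \<pi> p)"
    if "opair \<rho> q \<in> elts \<sigma>" "opair \<pi> q' \<in> elts \<tau>" for \<rho> q \<pi> q'
    using less.IH[of \<rho> \<pi>] opair_fst_below[OF that(1)] opair_fst_in[OF \<sigma> that(1)]
      opair_fst_in[OF \<tau> that(2)] by blast
  have "elts (val \<sigma>) \<subseteq> elts (val \<tau>) \<longleftrightarrow> (\<exists>p\<in>G. forces_subset forces_eq \<sigma> \<tau> p)"
    by (rule forces_subset_truth[OF \<sigma> \<tau>])
      (auto intro!: definable_intros persistent_forces_eq simp: IH)
  moreover have "elts (val \<tau>) \<subseteq> elts (val \<sigma>) \<longleftrightarrow>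
      (\<exists>p\<in>G. forces_subset (\<lambda>\<pi> \<rho>. forces_eq \<rho> \<pi>) \<tau> \<sigma> p)"
    by (rule forces_subset_truth[OF \<tau> \<sigma>])
      (auto intro!: definable_intros persistent_forces_eq simp: IH[symmetric])
  moreover have "val \<sigma> = val \<tau> \<longleftrightarrow> elts (val \<sigma>) \<subseteq> elts (val \<tau>) \<and> elts (val \<tau>) \<subseteq> elts (val \<sigma>)"
    using elts_ext[of "val \<sigma>" "val \<tau>"] by (auto simp: set_eq_subset)
  ultimately have "val \<sigma> = val \<tau> \<longleftrightarrow>
      (\<exists>p\<in>G. forces_subset forces_eq \<sigma> \<tau> p \<and> forces_subset (\<lambda>\<pi> \<rho>. forces_eq \<rho> \<pi>) \<tau> \<sigma> p)"
    using generic_conj_iff[OF persistent_forces_subset persistent_forces_subset] by simp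
  then show ?case
    using forces_eq_iff[OF \<sigma> \<tau>] G_sub by blast
qed

lemma forces_mem_truth:
  assumes \<sigma>: "\<sigma> \<in> V" and \<tau>: "\<tau> \<in> V"
  shows "val \<sigma> \<in> elts (val \<tau>) \<longleftrightarrow> (\<exists>p\<in>G. forces_mem \<sigma> \<tau> p)"
proof -
  have "definable V (\<lambda>e. forces_member_at forces_eq \<sigma> \<tau> (e 0))"
    unfolding forces_member_at_def by (intro definable_intros P_in \<sigma> \<tau>)
  then have "(\<exists>p\<in>G. forces_mem \<sigma> \<tau> p) \<longleftrightarrow> (\<exists>p\<in>G. forces_member_at forces_eq \<sigma> \<tau> p)"
    unfolding forces_mem_def
    by (intro generic_dense_below_iff persistent_forces_member_at persistent_forces_eq \<sigma>)
  moreover have "val \<sigma> \<in> elts (val \<tau>) \<longleftrightarrow> (\<exists>p\<in>G. forces_member_at forces_eq \<sigma> \<tau> p)"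
    using opair_fst_in[OF \<tau>]
    by (intro forces_member_at_truth persistent_forces_eq forces_eq_truth \<sigma> \<tau>)
  ultimately show ?thesis
    by simp
qed

section \<open>The forcing theorem\<close>

primrec forces :: "fm \<Rightarrow> (nat \<Rightarrow> 'a) \<Rightarrow> 'a \<Rightarrow> bool" where
  "forces (Mem i j) e = forces_mem (e i) (e j)"
| "forces (Eq i j) e = forces_eq (e i) (e j)"
| "forces (Neg \<phi>) e = refutes (forces \<phi> e)"
| "forces (Conj \<phi> \<psi>) e = (\<lambda>p. forces \<phi> e p \<and> forces \<psi> e p)"
| "forces (All \<phi>) e = (\<lambda>p. \<forall>x\<in>V. forcing_name P x \<longrightarrow> forces \<phi> (case_nat x e) p)"

lemma definable_forces_env: "definable V (\<lambda>e. forces \<phi> (\<lambda>n. e (Suc n)) (e 0))"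
proof (induction \<phi>)
  case (Neg \<phi>)
  have "definable V (\<lambda>e. forces \<phi> (\<lambda>n. e (Suc (Suc n))) (e 0))"
    using definable_rename[OF Neg, of "case_nat 0 (\<lambda>n. Suc (Suc n))"] by simp
  then show ?case
    unfolding forces.simps by (intro definable_intros)
next
  case (All \<phi>)
  have "(\<lambda>n. e (case_nat (Suc 0) (case_nat 0 (\<lambda>n. Suc (Suc n))) (Suc n)))
      = case_nat (e 0) (\<lambda>n. e (Suc (Suc n)))" for e :: "nat \<Rightarrow> 'a"
    by (auto split: nat.split)
  then have "definable V (\<lambda>e. forces \<phi> (case_nat (e 0) (\<lambda>n. e (Suc (Suc n)))) (e (Suc 0)))"
    using definable_rename[OF All, of "case_nat (Suc 0) (case_nat 0 (\<lambda>n. Suc (Suc n)))"] by simp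
  then show ?case
    unfolding forces.simps by (intro definable_intros)
qed (unfold forces.simps, (intro definable_intros; assumption)+)

lemma definable_forces:
  assumes "range e \<subseteq> V"
  shows "definable V (\<lambda>e'. forces \<phi> e (e' i))"
  by (rule definable_fix_tail[where Q = "\<lambda>x e. forces \<phi> e x", OF definable_forces_env assms])

lemma definable_forces_push:
  assumes "range e \<subseteq> V"
  shows "definable V (\<lambda>e'. forces \<phi> (case_nat (e' i) e) (e' j))"
proof -
  have "range (case_nat (Inr j) (case_nat (Inr i) (\<lambda>n. Inl (e n)))) \<subseteq> V <+> UNIV"
    using assms by (intro range_case_nat) (auto simp: image_subset_iff)
  from definable_instantiate[OF definable_forces_env this] show ?thesis
    by (simp add: instantiate_case_nat)
qed

lemma persistent_forces:
  assumes "range e \<subseteq> V"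
  shows "persistent (forces \<phi> e)"
  using assms
proof (induction \<phi> arbitrary: e)
  case (Eq i j)
  then show ?case
    by (auto intro: persistent_forces_eq)
next
  case (All \<phi>)
  then show ?case
    unfolding forces.simps by (intro persistent_all All.IH range_case_nat)
qed (simp_all add: persistent_forces_mem persistent_refutes persistent_conj)

lemma stable_forces:
  assumes "range e \<subseteq> V"
  shows "stable (forces \<phi> e)"
  using assms
proof (induction \<phi> arbitrary: e)
  case (Eq i j)
  then show ?case
    by (auto intro: stable_forces_eq)
next
  case (All \<phi>)
  then show ?case
    unfolding forces.simps by (intro stable_all All.IH range_case_nat)
qed (simp_all add: stable_forces_mem stable_refutes persistent_forces stable_conj)

abbreviation VG :: "'a set" where
  "VG \<equiv> generic_extension V P G"

lemma in_VGE:
  assumes "x \<in> VG"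
  obtains t where "t \<in> V" "forcing_name P t" "x = val t"
  using assms unfolding generic_extension_def by blast

lemma val_in_VG: "t \<in> V \<Longrightarrow> forcing_name P t \<Longrightarrow> val t \<in> VG"
  unfolding generic_extension_def by blast

theorem forcing_theorem:
  assumes "range e \<subseteq> V"
  shows "sat VG (\<lambda>n. val (e n)) \<phi> \<longleftrightarrow> (\<exists>p\<in>G. forces \<phi> e p)"
  using assms
proof (induction \<phi> arbitrary: e)
  case (Mem i j)
  then show ?case
    using forces_mem_truth[of "e i" "e j"] by auto
next
  case (Eq i j)
  then show ?case
    using forces_eq_truth[of "e i" "e j"] by auto
next
  case (Neg \<phi>)
  then show ?case
    using generic_not_iff[OF definable_forces persistent_forces] by simp
next
  case (Conj \<phi> \<psi>)
  then show ?case
    using generic_conj_iff[OF persistent_forces persistent_forces] by simp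
next
  case (All \<phi>)
  have IH: "sat VG (case_nat (val x) (\<lambda>n. val (e n))) \<phi> \<longleftrightarrow> (\<exists>p\<in>G. forces \<phi> (case_nat x e) p)"
    if "x \<in> V" for x
    using All.IH[OF range_case_nat[OF All.prems that]] by (simp add: nat.case_distrib[of val])
  have "sat VG (\<lambda>n. val (e n)) (All \<phi>) \<longleftrightarrow>
      (\<forall>x\<in>V. forcing_name P x \<longrightarrow> sat VG (case_nat (val x) (\<lambda>n. val (e n))) \<phi>)"
    unfolding generic_extension_def by auto
  also have "\<dots> \<longleftrightarrow> (\<forall>x\<in>V. forcing_name P x \<longrightarrow> (\<exists>p\<in>G. forces \<phi> (case_nat x e) p))"
    using IH by blast
  also have "\<dots> \<longleftrightarrow> (\<exists>p\<in>G. forces (All \<phi>) e p)"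
    unfolding forces.simps
    by (intro generic_all_iff[symmetric] definable_intros definable_forces_push persistent_forces
        stable_forces range_case_nat All.prems)
  finally show ?case .
qed

end

section \<open>The generic extension as a model of Zermelo set theory\<close>

context generic_forcing
begin

lemma VG_transitive:
  assumes "x \<in> VG" "y \<in> elts x"
  shows "y \<in> VG"
proof -
  obtain t where x_name: "t \<in> V" "forcing_name P t" "x = val t"
    using in_VGE[OF assms(1)] .
  obtain s p where y_entry: "y = val s" "opair s p \<in> elts t"
    using assms(2) unfolding x_name(3) by (rule in_valE)
  then show ?thesis
    using val_in_VG[OF opair_fst_in[OF x_name(1) y_entry(2)]
      forcing_nameD(1)[OF x_name(2) y_entry(2)]] by simp
qed

definition name_set :: "'a \<Rightarrow> bool" where
  "name_set D \<longleftrightarrow> D \<in> V \<and> (\<forall>s\<in>elts D. forcing_name P s)"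

lemma name_set_sep:
  assumes "T \<in> V"
  shows "name_set (sep T (forcing_name P))"
  unfolding name_set_def by (auto intro!: sep_in definable_intros assms)

definition subnames :: "'a \<Rightarrow> 'a" where
  "subnames t = sep (Unions (Unions t)) (forcing_name P)"

lemma name_set_subnames: "t \<in> V \<Longrightarrow> name_set (subnames t)"
  unfolding subnames_def by (intro name_set_sep Unions_in)

lemma elts_val_subset_subnames:
  assumes "forcing_name P t"
  shows "elts (val t) \<subseteq> val ` elts (subnames t)"
proof
  fix x assume "x \<in> elts (val t)"
  then obtain s p where x_entry: "x = val s" "opair s p \<in> elts t"
    by (rule in_valE)
  then have "s \<in> elts (subnames t)"
    unfolding subnames_def
    using forcing_nameD(1)[OF assms x_entry(2)] opair_in_Unions(1)[OF x_entry(2)] by simp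
  then show "x \<in> val ` elts (subnames t)"
    using x_entry(1) by blast
qed

definition comprehension_name :: "'a \<Rightarrow> ('a \<Rightarrow> 'a \<Rightarrow> bool) \<Rightarrow> 'a" where
  "comprehension_name D Q = sep (times D P) (\<lambda>z. \<exists>s\<in>elts D. \<exists>p\<in>elts P. z = opair s p \<and> Q s p)"

lemma opair_in_comprehension_name:
  "name_set D \<Longrightarrow>
    opair s p \<in> elts (comprehension_name D Q) \<longleftrightarrow> s \<in> elts D \<and> p \<in> elts P \<and> Q s p"
  unfolding comprehension_name_def name_set_def using P_in by (auto simp: opair_eq_iff)

lemma comprehension_name_in:
  assumes name_set_D: "name_set D" and definable_Q: "definable V (\<lambda>e. Q (e 0) (e (Suc 0)))"
  shows "comprehension_name D Q \<in> V"
proof -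
  have "definable V (\<lambda>e. Q (e (Suc 0)) (e 0))"
    using definable_Q by (rule definable_swap)
  then show ?thesis
    using name_set_D unfolding comprehension_name_def name_set_def
    by (intro sep_in definable_intros times_in P_in) auto
qed

lemma forcing_name_sub_times:
  assumes "name_set D" "elts t \<subseteq> elts (times D P)"
  shows "forcing_name P t"
  by (rule forcing_name.intros)
    (use assms P_in in \<open>unfold name_set_def, simp add: elts_times subset_iff, blast\<close>)

lemma comprehension_name_sub: "elts (comprehension_name D Q) \<subseteq> elts (times D P)"
  unfolding comprehension_name_def by auto

lemma elts_val_comprehension_name:
  "name_set D \<Longrightarrow> elts (val (comprehension_name D Q)) = {val s | s. s \<in> elts D \<and> (\<exists>p\<in>G. Q s p)}"
  by (simp add: elts_name_val opair_in_comprehension_name) (use G_sub in blast)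

lemma name_set_image_in_VG:
  assumes "name_set D"
  obtains z where "z \<in> VG" "elts z = val ` elts D"
proof -
  let ?t = "comprehension_name D (\<lambda>_ _. True)"
  have "?t \<in> V" "forcing_name P ?t"
    using comprehension_name_in[OF assms definable_const]
      forcing_name_sub_times[OF assms comprehension_name_sub] .
  moreover obtain p where "p \<in> G"
    using G_nonempty .
  then have "elts (val ?t) = val ` elts D"
    by (auto simp: elts_val_comprehension_name[OF assms])
  ultimately show thesis
    using that val_in_VG by blast
qed

lemma env_names:
  assumes "range e \<subseteq> VG"
  obtains e' where "range e' \<subseteq> V" "e = (\<lambda>n. val (e' n))"
proof -
  have "\<forall>n. \<exists>t. t \<in> V \<and> e n = val t"
    using assms unfolding generic_extension_def by blast
  then obtain e' where "\<And>n. e' n \<in> V \<and> e n = val (e' n)"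
    by metis
  then show thesis
    using that[of e'] by auto
qed

lemma VG_separation:
  assumes range_e: "range e \<subseteq> VG" and x_in: "x \<in> VG"
  shows "sep x (\<lambda>w. sat VG (case_nat w e) \<phi>) \<in> VG"
proof -
  obtain t where x_name: "t \<in> V" "forcing_name P t" "x = val t"
    using in_VGE[OF x_in] .
  obtain e' where e_names: "range e' \<subseteq> V" "e = (\<lambda>n. val (e' n))"
    using env_names[OF range_e] .
  have range_te': "range (case_nat t e') \<subseteq> V"
    by (rule range_case_nat[OF e_names(1) x_name(1)])
  define \<psi> where "\<psi> = Conj (Mem 0 (Suc 0)) (rename_fm (case_nat 0 (\<lambda>n. Suc (Suc n))) \<phi>)"
  define Q where "Q s = forces \<psi> (case_nat s (case_nat t e'))" for s
  let ?D = "subnames t"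
  note name_set_D = name_set_subnames[OF x_name(1)]
  have truth: "(\<exists>p\<in>G. Q s p) \<longleftrightarrow> val s \<in> elts x \<and> sat VG (case_nat (val s) e) \<phi>"
    if "s \<in> elts ?D" for s
  proof -
    have "s \<in> V"
      using name_set_D that transitive unfolding name_set_def by blast
    then have "(\<exists>p\<in>G. Q s p) \<longleftrightarrow> sat VG (\<lambda>n. val (case_nat s (case_nat t e') n)) \<psi>"
      unfolding Q_def using forcing_theorem[OF range_case_nat[OF range_te']] by blast
    moreover have "(\<lambda>n. val (case_nat s (case_nat t e') (case_nat 0 (\<lambda>n. Suc (Suc n)) n)))
        = case_nat (val s) e"
      unfolding e_names(2) by (auto split: nat.split)
    ultimately show ?thesis
      unfolding \<psi>_def x_name(3) by (simp add: sat_rename_fm)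
  qed
  have "elts (val (comprehension_name ?D Q)) =
      {w \<in> val ` elts ?D. w \<in> elts x \<and> sat VG (case_nat w e) \<phi>}"
    unfolding elts_val_comprehension_name[OF name_set_D] using truth by auto
  also have "\<dots> = elts (sep x (\<lambda>w. sat VG (case_nat w e) \<phi>))"
    using elts_val_subset_subnames[OF x_name(2)] x_name(3) by auto
  finally have "val (comprehension_name ?D Q) = sep x (\<lambda>w. sat VG (case_nat w e) \<phi>)"
    by (rule elts_ext)
  moreover have "definable V (\<lambda>e. Q (e 0) (e (Suc 0)))"
    unfolding Q_def by (rule definable_forces_push[OF range_te'])
  ultimately show ?thesis
    using val_in_VG[OF comprehension_name_in[where Q = Q, OF name_set_D]
        forcing_name_sub_times[OF name_set_D comprehension_name_sub]] by simp
qed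

sublocale VG: transitive_separation VG
proof
  have "forcing_name P (num 0)"
    by (rule forcing_name.intros) simp
  then show "VG \<noteq> {}"
    using val_in_VG[OF empty_in] by blast
qed (fact VG_transitive VG_separation)+

lemma VG_covered_set_exists:
  assumes "name_set D" and definable_Q: "definable VG (\<lambda>e. Q (e 0))"
    and cover: "\<And>w. w \<in> VG \<Longrightarrow> Q w \<Longrightarrow> w \<in> val ` elts D"
  shows "\<exists>z\<in>VG. elts z = {w \<in> VG. Q w}"
proof -
  obtain z where z_image: "z \<in> VG" "elts z = val ` elts D"
    using name_set_image_in_VG[OF assms(1)] .
  have "elts (sep z Q) = {w \<in> VG. Q w}"
    using cover VG_transitive[OF z_image(1)] unfolding z_image(2) elts_sep by blast
  then show ?thesis
    using VG.sep_in[OF z_image(1) definable_Q] by blast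
qed

lemma VG_upair:
  assumes "x \<in> VG" "y \<in> VG"
  shows "upair x y \<in> VG"
proof -
  obtain s where x_name: "s \<in> V" "forcing_name P s" "x = val s"
    using in_VGE[OF assms(1)] .
  obtain t where y_name: "t \<in> V" "forcing_name P t" "y = val t"
    using in_VGE[OF assms(2)] .
  have "name_set (upair s t)"
    unfolding name_set_def using x_name y_name by auto
  then obtain z where z_pair: "z \<in> VG" "elts z = val ` elts (upair s t)"
    by (rule name_set_image_in_VG)
  then have "z = upair x y"
    by (intro elts_ext) (simp add: x_name(3) y_name(3))
  then show ?thesis
    using z_pair(1) by simp
qed

lemma VG_Unions:
  assumes x_in: "x \<in> VG"
  shows "Unions x \<in> VG"
proof -
  obtain t where x_name: "t \<in> V" "forcing_name P t" "x = val t"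
    using in_VGE[OF x_in] .
  obtain T where T_closure: "T \<in> V" "t \<in> elts T" "transitive_set T"
    using transitive_set_exists[OF x_name(1)] .
  have sub_T: "s \<in> elts T" if "opair s p \<in> elts u" "u \<in> elts T" for s p u
    using transitive_set_opair(1)[OF T_closure(3)] transitive_setD[OF T_closure(3) that(2,1)] .
  have "\<exists>z\<in>VG. elts z = {w \<in> VG. \<exists>y\<in>elts x. w \<in> elts y}"
  proof (rule VG_covered_set_exists[OF name_set_sep[OF T_closure(1)]])
    show "definable VG (\<lambda>e. \<exists>y\<in>elts x. e 0 \<in> elts y)"
      by (intro definable_intros x_in)
    fix w assume "\<exists>y\<in>elts x. w \<in> elts y"
    then obtain y where w_in_y: "y \<in> elts x" "w \<in> elts y"
      by blast
    obtain s p where y_entry: "y = val s" "opair s p \<in> elts t"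
      using w_in_y(1) unfolding x_name(3) by (rule in_valE)
    obtain r q where w_entry: "w = val r" "opair r q \<in> elts s"
      using w_in_y(2) unfolding y_entry(1) by (rule in_valE)
    have "r \<in> elts T" "forcing_name P r"
      using sub_T[OF w_entry(2) sub_T[OF y_entry(2) T_closure(2)]]
        forcing_nameD(1)[OF forcing_nameD(1)[OF x_name(2) y_entry(2)] w_entry(2)] .
    then show "w \<in> val ` elts (sep T (forcing_name P))"
      using w_entry(1) by simp
  qed
  then obtain z where z_union: "z \<in> VG" "elts z = {w \<in> VG. \<exists>y\<in>elts x. w \<in> elts y}"
    by blast
  then have "z = Unions x"
    using VG_transitive[OF VG_transitive[OF x_in]] by (intro elts_ext) auto
  then show ?thesis
    using z_union(1) by simp
qed

lemma covered_set_has_name: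
  assumes name_set_D: "name_set D" and y_covered: "y \<in> VG" "elts y \<subseteq> val ` elts D"
  obtains s where "s \<in> V" "elts s \<subseteq> elts (times D P)" "val s = y"
proof -
  obtain r where y_name: "r \<in> V" "forcing_name P r" "y = val r"
    using in_VGE[OF y_covered(1)] .
  have "definable V (\<lambda>e. forces_mem (e 0) r (e (Suc 0)))"
    by (intro definable_intros y_name(1))
  then have "comprehension_name D (\<lambda>a. forces_mem a r) \<in> V"
    using comprehension_name_in[OF name_set_D, where Q = "\<lambda>a. forces_mem a r"] by blast
  moreover have "val a \<in> elts y \<longleftrightarrow> (\<exists>p\<in>G. forces_mem a r p)" if "a \<in> elts D" for a
  proof -
    have "a \<in> V"
      using name_set_D that transitive unfolding name_set_def by blast
    then show ?thesis
      using forces_mem_truth y_name(1,3) by simp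
  qed
  then have "elts (val (comprehension_name D (\<lambda>a. forces_mem a r))) = elts y \<inter> val ` elts D"
    unfolding elts_val_comprehension_name[OF name_set_D] by auto
  then have "elts (val (comprehension_name D (\<lambda>a. forces_mem a r))) = elts y"
    using y_covered(2) by blast
  ultimately show thesis
    using that comprehension_name_sub elts_ext by blast
qed

lemma VG_power:
  assumes x_in: "x \<in> VG"
  shows "\<exists>z\<in>VG. elts z = {y \<in> VG. elts y \<subseteq> elts x}"
proof -
  obtain t where x_name: "t \<in> V" "forcing_name P t" "x = val t"
    using in_VGE[OF x_in] .
  let ?D = "subnames t"
  note name_set_D = name_set_subnames[OF x_name(1)]
  have times_D_P_in: "times ?D P \<in> V"
    using name_set_D P_in unfolding name_set_def by blast
  have "name_set (power (times ?D P))"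
    using forcing_name_sub_times[OF name_set_D] power_in[OF times_D_P_in]
      elts_power[OF times_D_P_in] unfolding name_set_def by blast
  then show ?thesis
  proof (rule VG_covered_set_exists)
    show "definable VG (\<lambda>e. elts (e 0) \<subseteq> elts x)"
      by (intro definable_intros x_in)
    fix y assume y_subset: "y \<in> VG" "elts y \<subseteq> elts x"
    then have "elts y \<subseteq> val ` elts ?D"
      using elts_val_subset_subnames[OF x_name(2)] x_name(3) by blast
    then obtain s where "s \<in> V" "elts s \<subseteq> elts (times ?D P)" "val s = y"
      using covered_set_has_name[OF name_set_D y_subset(1)] by blast
    then show "y \<in> val ` elts (power (times ?D P))"
      unfolding elts_power[OF times_D_P_in] by blast
  qed
qed

section \<open>Check names\<close>

text \<open>Pairs \<open>opair x c\<close> encode the statement that \<open>c\<close> is the canonical name of \<open>x\<close>.\<close>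

definition check_clause :: "('a \<Rightarrow> bool) \<Rightarrow> 'a \<Rightarrow> bool" where
  "check_clause X z \<longleftrightarrow> (\<exists>x\<in>V. \<exists>c\<in>V. z = opair x c \<and>
     (\<forall>y\<in>elts x. \<exists>d\<in>V. X (opair y d) \<and> (\<forall>p\<in>elts P. opair d p \<in> elts c)) \<and>
     (\<forall>w\<in>elts c. \<exists>y\<in>elts x. \<exists>d\<in>V. \<exists>p\<in>elts P. X (opair y d) \<and> w = opair d p))"

definition is_check :: "'a \<Rightarrow> 'a \<Rightarrow> bool" where
  "is_check x c \<longleftrightarrow> largest_solution check_clause (opair x c)"

lemma definable_check_clause: "definable V (\<lambda>e. check_clause (\<lambda>y. y \<in> elts (e 0)) (e (Suc 0)))"
  unfolding check_clause_def by (intro definable_intros P_in)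

lemma definable_is_check [definable_intros]:
  "definable_term V s \<Longrightarrow> definable_term V t \<Longrightarrow> definable V (\<lambda>e. is_check (s e) (t e))"
  unfolding is_check_def
  by (intro definable_largest_solution[OF definable_check_clause] definable_intros)

lemma check_clause_opair:
  assumes "x \<in> V" "c \<in> V"
  shows "check_clause X (opair x c) \<longleftrightarrow>
    (\<forall>y\<in>elts x. \<exists>d\<in>V. X (opair y d) \<and> (\<forall>p\<in>elts P. opair d p \<in> elts c)) \<and>
    (\<forall>w\<in>elts c. \<exists>y\<in>elts x. \<exists>d\<in>V. \<exists>p\<in>elts P. X (opair y d) \<and> w = opair d p)"
  using assms unfolding check_clause_def by (auto simp: opair_eq_iff)

lemma check_clause_mono:
  assumes "check_clause X (opair x c)"
    and X_mono: "\<And>y d p. y \<in> elts x \<Longrightarrow> opair d p \<in> elts c \<Longrightarrow> X (opair y d) \<Longrightarrow> Y (opair y d)"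
  shows "check_clause Y (opair x c)"
proof -
  have x_c_in: "x \<in> V" "c \<in> V"
    using assms(1) unfolding check_clause_def by (auto simp: opair_eq_iff)
  note clause = assms(1)[unfolded check_clause_opair[OF x_c_in]]
  obtain p where p_in: "p \<in> elts P"
    using G_nonempty G_sub by metis
  show ?thesis
    unfolding check_clause_opair[OF x_c_in]
  proof (intro conjI ballI)
    fix y assume y_in: "y \<in> elts x"
    then obtain d where "d \<in> V" "X (opair y d)" "\<forall>p\<in>elts P. opair d p \<in> elts c"
      using clause by blast
    then show "\<exists>d\<in>V. Y (opair y d) \<and> (\<forall>p\<in>elts P. opair d p \<in> elts c)"
      using X_mono y_in p_in by blast
  next
    fix w assume w_in: "w \<in> elts c"
    then obtain y d p where "y \<in> elts x" "d \<in> V" "p \<in> elts P" "X (opair y d)" "w = opair d p"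
      using clause by blast
    then show "\<exists>y\<in>elts x. \<exists>d\<in>V. \<exists>p\<in>elts P. Y (opair y d) \<and> w = opair d p"
      using X_mono w_in by blast
  qed
qed

lemma is_check_iff:
  assumes "x \<in> V" "c \<in> V"
  shows "is_check x c \<longleftrightarrow>
    (\<forall>y\<in>elts x. \<exists>d\<in>V. is_check y d \<and> (\<forall>p\<in>elts P. opair d p \<in> elts c)) \<and>
    (\<forall>w\<in>elts c. \<exists>y\<in>elts x. \<exists>d\<in>V. \<exists>p\<in>elts P. is_check y d \<and> w = opair d p)"
proof -
  obtain T where T_closure: "T \<in> V" "opair x c \<in> elts T" "transitive_set T"
    using transitive_set_exists[OF opair_in[OF assms]] .
  have "largest_solution check_clause (opair x c) \<longleftrightarrow>
      check_clause (largest_solution check_clause) (opair x c)"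
  proof (rule largest_solution_unfold[OF _ definable_check_clause times_in[OF T_closure(1,1)]])
    show "check_clause Y z" if clause: "check_clause X z" and X_imp_Y: "\<And>y. X y \<Longrightarrow> Y y" for X Y z
    proof -
      obtain x c where z: "z = opair x c"
        using clause unfolding check_clause_def by blast
      show ?thesis
        using clause unfolding z by (rule check_clause_mono) (rule X_imp_Y)
    qed
    show "opair x c \<in> elts (times T T)"
      using T_closure(1) transitive_set_opair[OF T_closure(3,2)] by simp
    show "check_clause (\<lambda>y. X y \<and> y \<in> elts (times T T)) z"
      if z: "z \<in> elts (times T T)" and clause: "check_clause X z" for X z
    proof -
      obtain x c where z_eq: "x \<in> elts T" "c \<in> elts T" "z = opair x c"
        using z T_closure(1) by (auto simp: elts_times)
      have "y \<in> elts T" "d \<in> elts T" if "y \<in> elts x" "opair d p \<in> elts c" for y d p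
        using transitive_setD[OF T_closure(3) z_eq(1) that(1)]
          transitive_set_opair(1)[OF T_closure(3) transitive_setD[OF T_closure(3) z_eq(2) that(2)]]
        by blast+
      then show ?thesis
        using clause T_closure(1) unfolding z_eq(3) by (elim check_clause_mono) simp
    qed
  qed
  then show ?thesis
    unfolding check_clause_opair[OF assms] is_check_def .
qed

lemma is_check_in:
  assumes "is_check x c"
  shows "x \<in> V" "c \<in> V"
proof -
  have "opair x c \<in> V"
    using assms transitive unfolding is_check_def largest_solution_def by blast
  then show "x \<in> V" "c \<in> V"
    using opair_inD by blast+
qed

lemma is_check_unique:
  assumes "is_check x c" "is_check x c'"
  shows "c = c'"
  using wf_elts assms
proof (induction x arbitrary: c c' rule: wf_induct_rule)
  case (less x)
  have "elts c \<subseteq> elts c'" if both_check: "is_check x c" "is_check x c'" for c c'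
  proof
    fix w assume "w \<in> elts c"
    then obtain y d p where w_entry: "y \<in> elts x" "p \<in> elts P" "is_check y d" "w = opair d p"
      using both_check(1) is_check_iff[OF is_check_in[OF both_check(1)]] by blast
    obtain d' where d'_check: "is_check y d'" "\<forall>p\<in>elts P. opair d' p \<in> elts c'"
      using both_check(2) is_check_iff[OF is_check_in[OF both_check(2)]] w_entry(1) by blast
    have "d = d'"
      using less.IH[OF _ w_entry(3) d'_check(1)] w_entry(1) by blast
    then show "w \<in> elts c'"
      using w_entry d'_check by blast
  qed
  then show ?case
    using less.prems elts_ext[of c c'] by blast
qed

lemma check_name_exists:
  assumes "x \<in> V"
  shows "\<exists>c\<in>V. is_check x c"
  using wf_elts assms
proof (induction x rule: wf_induct_rule)
  case (less x)
  have unique_check: "\<exists>!d. d \<in> V \<and> is_check y d" if "y \<in> elts x" for y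
    using less.IH[of y] transitive[OF less.prems that] that is_check_unique by blast
  have "definable V (\<lambda>e. is_check (e 0) (e (Suc 0)))"
    by (intro definable_intros)
  from replacement_in[OF less.prems this unique_check] obtain D where D_checks: "D \<in> V"
    "elts D = {d \<in> V. \<exists>y\<in>elts x. is_check y d}"
    by blast
  have "is_check x (times D P)"
    unfolding is_check_iff[OF less.prems times_in[OF D_checks(1) P_in]]
  proof (intro conjI ballI)
    show "\<exists>d\<in>V. is_check y d \<and> (\<forall>p\<in>elts P. opair d p \<in> elts (times D P))"
      if y_in: "y \<in> elts x" for y
      using unique_check[OF y_in] y_in D_checks P_in by auto
    show "\<exists>y\<in>elts x. \<exists>d\<in>V. \<exists>p\<in>elts P. is_check y d \<and> w = opair d p" if "w \<in> elts (times D P)" for w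
      using that D_checks by (auto simp: elts_times P_in)
  qed
  then show ?case
    using D_checks(1) P_in by blast
qed

lemma forcing_name_check:
  assumes "is_check x c"
  shows "forcing_name P c"
  using wf_elts assms
proof (induction x arbitrary: c rule: wf_induct_rule)
  case (less x)
  show ?case
    unfolding forcing_name_iff[of c]
  proof
    fix w assume "w \<in> elts c"
    then obtain y d p where "y \<in> elts x" "p \<in> elts P" "is_check y d" "w = opair d p"
      using less.prems is_check_iff[OF is_check_in[OF less.prems]] by blast
    then show "\<exists>s. \<exists>p\<in>elts P. w = opair s p \<and> forcing_name P s"
      using less.IH by blast
  qed
qed

lemma val_check:
  assumes "is_check x c"
  shows "val c = x"
  using wf_elts assms
proof (induction x arbitrary: c rule: wf_induct_rule)
  case (less x)
  note clause = less.prems[unfolded is_check_iff[OF is_check_in[OF less.prems]]]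
  have IH: "val d = y" if "y \<in> elts x" "is_check y d" for y d
    using less.IH[OF _ that(2)] that(1) by blast
  show ?case
  proof (intro elts_ext equalityI subsetI)
    fix w assume "w \<in> elts (val c)"
    then obtain s p where w_entry: "w = val s" "opair s p \<in> elts c"
      by (rule in_valE)
    then obtain y where "y \<in> elts x" "is_check y s"
      using clause by (fastforce simp: opair_eq_iff)
    then show "w \<in> elts x"
      using IH w_entry(1) by blast
  next
    fix y assume y_in: "y \<in> elts x"
    then obtain d where d_check: "is_check y d" "\<forall>p\<in>elts P. opair d p \<in> elts c"
      using clause by blast
    obtain p where "p \<in> G"
      using G_nonempty .
    then show "y \<in> elts (val c)"
      using in_valI[of p d c] d_check(2) G_sub IH[OF y_in d_check(1)] by auto
  qed
qed

lemma V_subset_VG: "V \<subseteq> VG"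
  using check_name_exists val_check forcing_name_check val_in_VG by (metis subsetI)

sublocale VG: transitive_zermelo_omega VG
proof
  show "\<exists>z\<in>VG. elts z = range num"
    using omega_in V_subset_VG elts_omega by blast
qed (fact VG_upair VG_Unions VG_power)+

end

section \<open>Boolean algebras on a carrier set\<close>

locale boolean_algebra_on =
  fixes B :: "'b set"
    and meet :: "'b \<Rightarrow> 'b \<Rightarrow> 'b"  (infixl "\<sqinter>" 70)
    and join :: "'b \<Rightarrow> 'b \<Rightarrow> 'b"  (infixl "\<squnion>" 65)
    and compl :: "'b \<Rightarrow> 'b"  ("\<sim> _" [80] 80)
    and bot :: 'b  ("\<bottom>")
    and top :: 'b  ("\<top>")
  assumes meet_closed [simp, intro]: "a \<in> B \<Longrightarrow> b \<in> B \<Longrightarrow> a \<sqinter> b \<in> B"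
    and join_closed [simp, intro]: "a \<in> B \<Longrightarrow> b \<in> B \<Longrightarrow> a \<squnion> b \<in> B"
    and compl_closed [simp, intro]: "a \<in> B \<Longrightarrow> \<sim> a \<in> B"
    and bot_closed [simp, intro]: "\<bottom> \<in> B"
    and top_closed [simp, intro]: "\<top> \<in> B"
    and meet_commute: "a \<in> B \<Longrightarrow> b \<in> B \<Longrightarrow> a \<sqinter> b = b \<sqinter> a"
    and join_commute: "a \<in> B \<Longrightarrow> b \<in> B \<Longrightarrow> a \<squnion> b = b \<squnion> a"
    and meet_assoc: "a \<in> B \<Longrightarrow> b \<in> B \<Longrightarrow> c \<in> B \<Longrightarrow> a \<sqinter> b \<sqinter> c = a \<sqinter> (b \<sqinter> c)"
    and meet_join_distrib: "a \<in> B \<Longrightarrow> b \<in> B \<Longrightarrow> c \<in> B \<Longrightarrow> a \<sqinter> (b \<squnion> c) = a \<sqinter> b \<squnion> a \<sqinter> c"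
    and join_meet_distrib: "a \<in> B \<Longrightarrow> b \<in> B \<Longrightarrow> c \<in> B \<Longrightarrow> a \<squnion> b \<sqinter> c = (a \<squnion> b) \<sqinter> (a \<squnion> c)"
    and meet_top [simp]: "a \<in> B \<Longrightarrow> a \<sqinter> \<top> = a"
    and join_bot [simp]: "a \<in> B \<Longrightarrow> a \<squnion> \<bottom> = a"
    and meet_compl [simp]: "a \<in> B \<Longrightarrow> a \<sqinter> \<sim> a = \<bottom>"
    and join_compl [simp]: "a \<in> B \<Longrightarrow> a \<squnion> \<sim> a = \<top>"
begin

definition le :: "'b \<Rightarrow> 'b \<Rightarrow> bool"  (infix "\<sqsubseteq>" 50) where
  "a \<sqsubseteq> b \<longleftrightarrow> a \<sqinter> b = a"

lemma meet_idem [simp]: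
  assumes "a \<in> B"
  shows "a \<sqinter> a = a"
proof -
  have "a \<sqinter> a = a \<sqinter> a \<squnion> a \<sqinter> \<sim> a"
    using assms by simp
  also have "\<dots> = a \<sqinter> (a \<squnion> \<sim> a)"
    using assms by (intro meet_join_distrib[symmetric]) auto
  finally show ?thesis
    using assms by simp
qed

lemma meet_bot [simp]:
  assumes "a \<in> B"
  shows "a \<sqinter> \<bottom> = \<bottom>"
proof -
  have "a \<sqinter> \<bottom> = a \<sqinter> a \<sqinter> \<sim> a"
    using assms by (subst meet_assoc) auto
  then show ?thesis
    using assms by simp
qed

lemma join_absorb:
  assumes "a \<in> B" "b \<in> B"
  shows "a \<sqinter> (a \<squnion> b) = a"
proof -
  have "a \<sqinter> (a \<squnion> b) = (a \<squnion> \<bottom>) \<sqinter> (a \<squnion> b)"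
    using assms by simp
  also have "\<dots> = a \<squnion> \<bottom> \<sqinter> b"
    using assms by (intro join_meet_distrib[symmetric]) auto
  also have "\<bottom> \<sqinter> b = \<bottom>"
    using assms meet_commute[of \<bottom> b] by simp
  finally show ?thesis
    using assms by simp
qed

lemma meet_split: "a \<in> B \<Longrightarrow> b \<in> B \<Longrightarrow> a \<sqinter> b \<squnion> a \<sqinter> \<sim> b = a"
  using meet_join_distrib[of a b "\<sim> b"] by simp

lemma le_refl [simp]: "a \<in> B \<Longrightarrow> a \<sqsubseteq> a"
  unfolding le_def by simp

lemma le_antisym: "a \<in> B \<Longrightarrow> b \<in> B \<Longrightarrow> a \<sqsubseteq> b \<Longrightarrow> b \<sqsubseteq> a \<Longrightarrow> a = b"
  unfolding le_def using meet_commute by metis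

lemma le_trans: "a \<sqsubseteq> b \<Longrightarrow> b \<sqsubseteq> c \<Longrightarrow> a \<in> B \<Longrightarrow> b \<in> B \<Longrightarrow> c \<in> B \<Longrightarrow> a \<sqsubseteq> c"
  unfolding le_def using meet_assoc by metis

lemma le_top [simp]: "a \<in> B \<Longrightarrow> a \<sqsubseteq> \<top>"
  unfolding le_def by simp

lemma le_bot: "a \<sqsubseteq> \<bottom> \<Longrightarrow> a \<in> B \<Longrightarrow> a = \<bottom>"
  unfolding le_def by simp

lemma meet_le1 [simp]: "a \<in> B \<Longrightarrow> b \<in> B \<Longrightarrow> a \<sqinter> b \<sqsubseteq> a"
  unfolding le_def by (metis meet_assoc meet_closed meet_commute meet_idem)

lemma meet_le2 [simp]: "a \<in> B \<Longrightarrow> b \<in> B \<Longrightarrow> a \<sqinter> b \<sqsubseteq> b"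
  unfolding le_def by (simp add: meet_assoc)

lemma meet_greatest: "c \<sqsubseteq> a \<Longrightarrow> c \<sqsubseteq> b \<Longrightarrow> a \<in> B \<Longrightarrow> b \<in> B \<Longrightarrow> c \<in> B \<Longrightarrow> c \<sqsubseteq> a \<sqinter> b"
  unfolding le_def using meet_assoc by metis

lemma meet_mono:
  assumes "a \<sqsubseteq> c" "b \<sqsubseteq> d" and "a \<in> B" "b \<in> B" "c \<in> B" "d \<in> B"
  shows "a \<sqinter> b \<sqsubseteq> c \<sqinter> d"
  using assms le_trans[OF meet_le1 assms(1)] le_trans[OF meet_le2 assms(2)]
  by (intro meet_greatest) auto

lemma join_upper1 [simp]: "a \<in> B \<Longrightarrow> b \<in> B \<Longrightarrow> a \<sqsubseteq> a \<squnion> b"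
  unfolding le_def by (rule join_absorb)

lemma join_upper2 [simp]: "a \<in> B \<Longrightarrow> b \<in> B \<Longrightarrow> b \<sqsubseteq> a \<squnion> b"
  using join_upper1[of b a] join_commute by simp

lemma join_least:
  assumes "a \<sqsubseteq> c" "b \<sqsubseteq> c" and "a \<in> B" "b \<in> B" "c \<in> B"
  shows "a \<squnion> b \<sqsubseteq> c"
proof -
  have "(a \<squnion> b) \<sqinter> c = c \<sqinter> (a \<squnion> b)"
    using assms by (intro meet_commute) auto
  also have "\<dots> = c \<sqinter> a \<squnion> c \<sqinter> b"
    using assms by (intro meet_join_distrib) auto
  also have "\<dots> = a \<squnion> b"
    using assms meet_commute unfolding le_def by metis
  finally show ?thesis
    unfolding le_def .
qed

lemma join_mono:
  assumes "a \<sqsubseteq> c" "b \<sqsubseteq> d" and "a \<in> B" "b \<in> B" "c \<in> B" "d \<in> B"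
  shows "a \<squnion> b \<sqsubseteq> c \<squnion> d"
  using assms le_trans[OF assms(1) join_upper1] le_trans[OF assms(2) join_upper2]
  by (intro join_least) auto

lemma compl_compl [simp]:
  assumes "a \<in> B"
  shows "\<sim> \<sim> a = a"
proof (rule le_antisym)
  have "\<sim> \<sim> a = \<sim> \<sim> a \<sqinter> a \<squnion> \<sim> \<sim> a \<sqinter> \<sim> a"
    using assms meet_split[of "\<sim> \<sim> a" a] by simp
  also have "\<sim> \<sim> a \<sqinter> \<sim> a = \<bottom>"
    using assms meet_commute[of "\<sim> \<sim> a" "\<sim> a"] by simp
  finally show "\<sim> \<sim> a \<sqsubseteq> a"
    unfolding le_def using assms by simp
  have "a = a \<sqinter> \<sim> a \<squnion> a \<sqinter> \<sim> \<sim> a"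
    using assms meet_split[of a "\<sim> a"] by simp
  then show "a \<sqsubseteq> \<sim> \<sim> a"
    unfolding le_def using assms join_commute[of "\<bottom>" "a \<sqinter> \<sim> \<sim> a"] by simp
qed (use assms in auto)

lemma le_iff_meet_compl:
  assumes "a \<in> B" "b \<in> B"
  shows "a \<sqsubseteq> b \<longleftrightarrow> a \<sqinter> \<sim> b = \<bottom>"
proof
  assume "a \<sqsubseteq> b"
  then have "a \<sqinter> \<sim> b = a \<sqinter> b \<sqinter> \<sim> b"
    unfolding le_def by simp
  also have "\<dots> = a \<sqinter> (b \<sqinter> \<sim> b)"
    using assms by (intro meet_assoc) auto
  finally show "a \<sqinter> \<sim> b = \<bottom>"
    using assms by simp
next
  assume "a \<sqinter> \<sim> b = \<bottom>"
  then show "a \<sqsubseteq> b"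
    using meet_split[OF assms] assms unfolding le_def by simp
qed

lemma le_compl_iff: "a \<in> B \<Longrightarrow> b \<in> B \<Longrightarrow> a \<sqsubseteq> \<sim> b \<longleftrightarrow> a \<sqinter> b = \<bottom>"
  using le_iff_meet_compl[of a "\<sim> b"] by simp

lemma disjoint_mono:
  assumes "c \<sqinter> d = \<bottom>" "a \<sqsubseteq> c" "b \<sqsubseteq> d" and "a \<in> B" "b \<in> B" "c \<in> B" "d \<in> B"
  shows "a \<sqinter> b = \<bottom>"
  using assms meet_mono[OF assms(2,3)] by (intro le_bot) auto

lemma compl_top [simp]: "\<sim> \<top> = \<bottom>"
  using meet_compl[of \<top>] meet_commute[of "\<sim> \<top>" \<top>] by simp

lemma compl_bot [simp]: "\<sim> \<bottom> = \<top>"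
  using join_compl[of \<bottom>] join_commute[of "\<sim> \<bottom>" \<bottom>] by simp

lemma compl_antimono: "a \<sqsubseteq> b \<Longrightarrow> a \<in> B \<Longrightarrow> b \<in> B \<Longrightarrow> \<sim> b \<sqsubseteq> \<sim> a"
  using le_compl_iff[of "\<sim> b" a] le_iff_meet_compl[of a b] meet_commute[of a "\<sim> b"] by simp

lemma compl_meet_le:
  assumes "a \<in> B" "b \<in> B"
  shows "\<sim> (a \<sqinter> b) \<sqsubseteq> \<sim> a \<squnion> \<sim> b"
proof -
  let ?c = "\<sim> (a \<sqinter> b)"
  have "?c \<sqinter> a \<sqinter> b = ?c \<sqinter> (a \<sqinter> b)"
    using assms by (intro meet_assoc) auto
  also have "\<dots> = \<bottom>"
    using assms le_compl_iff[of ?c "a \<sqinter> b"] by simp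
  finally have "?c \<sqinter> a \<sqsubseteq> \<sim> b"
    using assms le_compl_iff[of "?c \<sqinter> a" b] by simp
  then have "?c \<sqinter> \<sim> a \<squnion> ?c \<sqinter> a \<sqsubseteq> \<sim> a \<squnion> \<sim> b"
    using assms by (intro join_mono) auto
  then show ?thesis
    using assms meet_split[of ?c a] join_commute[of "?c \<sqinter> \<sim> a"] by simp
qed

lemma not_le_and_le_compl:
  assumes "a \<in> B" "b \<in> B" "a \<noteq> \<bottom>"
  shows "\<not> (a \<sqsubseteq> b \<and> a \<sqsubseteq> \<sim> b)"
  using assms le_compl_iff[of a b] unfolding le_def by auto

subsection \<open>Ultrafilters\<close>

definition ultrafilter :: "'b set \<Rightarrow> bool" where
  "ultrafilter U \<longleftrightarrow> U \<subseteq> B \<and> \<top> \<in> U \<and> \<bottom> \<notin> U \<and> (\<forall>a\<in>U. \<forall>b\<in>U. a \<sqinter> b \<in> U) \<and>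
     (\<forall>a\<in>U. \<forall>b\<in>B. a \<sqsubseteq> b \<longrightarrow> b \<in> U) \<and> (\<forall>a\<in>B. a \<in> U \<or> \<sim> a \<in> U)"

lemma ultrafilterI:
  assumes "U \<subseteq> B" "\<top> \<in> U" "\<bottom> \<notin> U" "\<And>a b. a \<in> U \<Longrightarrow> b \<in> U \<Longrightarrow> a \<sqinter> b \<in> U"
    and "\<And>a b. a \<in> U \<Longrightarrow> b \<in> B \<Longrightarrow> a \<sqsubseteq> b \<Longrightarrow> b \<in> U" "\<And>a. a \<in> B \<Longrightarrow> a \<in> U \<or> \<sim> a \<in> U"
  shows "ultrafilter U"
  using assms unfolding ultrafilter_def by blast

lemma ultrafilter_sub: "ultrafilter U \<Longrightarrow> U \<subseteq> B"
  unfolding ultrafilter_def by blast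

lemma ultrafilter_not_disjoint: "ultrafilter U \<Longrightarrow> a \<in> U \<Longrightarrow> b \<in> U \<Longrightarrow> a \<sqinter> b \<noteq> \<bottom>"
  unfolding ultrafilter_def by metis

lemma ultrafilter_compl_iff:
  assumes "ultrafilter U" "a \<in> B"
  shows "\<sim> a \<in> U \<longleftrightarrow> a \<notin> U"
  using ultrafilter_not_disjoint[OF assms(1), of a "\<sim> a"] assms unfolding ultrafilter_def by auto

lemma ultrafilters_separated:
  assumes ultrafilter_U: "ultrafilter U" and ultrafilter_W: "ultrafilter W" and "U \<noteq> W"
  obtains a where "a \<in> U" "\<sim> a \<in> W"
proof -
  have "\<not> U \<subseteq> W"
  proof
    assume "U \<subseteq> W"
    then have "W \<subseteq> U"
      using ultrafilter_compl_iff[OF ultrafilter_U] ultrafilter_compl_iff[OF ultrafilter_W]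
        ultrafilter_sub[OF ultrafilter_W] by blast
    then show False
      using \<open>U \<subseteq> W\<close> \<open>U \<noteq> W\<close> by blast
  qed
  then show thesis
    using that ultrafilter_compl_iff[OF ultrafilter_W] ultrafilter_sub[OF ultrafilter_U] by blast
qed

subsection \<open>Finite elements and atoms\<close>

definition finite_below :: "'b \<Rightarrow> bool" where
  "finite_below a \<longleftrightarrow> finite {b \<in> B. b \<sqsubseteq> a}"

lemma finite_below_mono:
  assumes "finite_below b" "a \<sqsubseteq> b" "a \<in> B" "b \<in> B"
  shows "finite_below a"
proof -
  have "{x \<in> B. x \<sqsubseteq> a} \<subseteq> {x \<in> B. x \<sqsubseteq> b}"
    using le_trans[OF _ assms(2)] assms(3,4) by blast
  then show ?thesis
    using assms(1) unfolding finite_below_def by (rule finite_subset)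
qed

lemma finite_below_bot: "finite_below \<bottom>"
proof -
  have "{x \<in> B. x \<sqsubseteq> \<bottom>} \<subseteq> {\<bottom>}"
    using le_bot by auto
  then show ?thesis
    unfolding finite_below_def by (rule finite_subset) simp
qed

lemma finite_below_top: "finite_below \<top> \<longleftrightarrow> finite B"
proof -
  have "{x \<in> B. x \<sqsubseteq> \<top>} = B"
    by auto
  then show ?thesis
    unfolding finite_below_def by simp
qed

lemma finite_below_join:
  assumes "finite_below a" "finite_below b" and "a \<in> B" "b \<in> B"
  shows "finite_below (a \<squnion> b)"
proof -
  have "{x \<in> B. x \<sqsubseteq> a \<squnion> b} \<subseteq> (\<lambda>(x, y). x \<squnion> y) ` ({x \<in> B. x \<sqsubseteq> a} \<times> {x \<in> B. x \<sqsubseteq> b})"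
  proof
    fix x assume x_below: "x \<in> {x \<in> B. x \<sqsubseteq> a \<squnion> b}"
    then have "x = x \<sqinter> a \<squnion> x \<sqinter> b"
      using assms(3,4) meet_join_distrib[of x a b] unfolding le_def by simp
    moreover have "(x \<sqinter> a, x \<sqinter> b) \<in> {x \<in> B. x \<sqsubseteq> a} \<times> {x \<in> B. x \<sqsubseteq> b}"
      using x_below assms(3,4) by simp
    ultimately show "x \<in> (\<lambda>(x, y). x \<squnion> y) ` ({x \<in> B. x \<sqsubseteq> a} \<times> {x \<in> B. x \<sqsubseteq> b})"
      by (intro image_eqI[where x = "(x \<sqinter> a, x \<sqinter> b)"]) simp_all
  qed
  then show ?thesis
    using assms(1,2) unfolding finite_below_def by (meson finite_SigmaI finite_imageI finite_subset)
qed

lemma finite_below_split: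
  assumes "finite_below (a \<sqinter> b)" "finite_below (a \<sqinter> \<sim> b)" and "a \<in> B" "b \<in> B"
  shows "finite_below a"
  using finite_below_join[OF assms(1,2)] meet_split assms(3,4) by simp

definition atom :: "'b \<Rightarrow> bool" where
  "atom p \<longleftrightarrow> p \<in> B \<and> p \<noteq> \<bottom> \<and> (\<forall>b\<in>B. b \<sqsubseteq> p \<longrightarrow> b = \<bottom> \<or> b = p)"

lemma atom_closed: "atom p \<Longrightarrow> p \<in> B"
  unfolding atom_def by blast

lemma atom_neq_bot: "atom p \<Longrightarrow> p \<noteq> \<bottom>"
  unfolding atom_def by blast

lemma atom_le_atom: "atom p \<Longrightarrow> atom q \<Longrightarrow> p \<sqsubseteq> q \<Longrightarrow> p = q"
  unfolding atom_def by blast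

lemma finite_below_atom:
  assumes "atom p"
  shows "finite_below p"
proof -
  have "{x \<in> B. x \<sqsubseteq> p} \<subseteq> {\<bottom>, p}"
    using assms unfolding atom_def by auto
  then show ?thesis
    unfolding finite_below_def by (rule finite_subset) simp
qed

lemma atom_decides:
  assumes "atom p" "b \<in> B"
  shows "p \<sqsubseteq> b \<or> p \<sqsubseteq> \<sim> b"
proof (cases "p \<sqinter> b = \<bottom>")
  case True
  then show ?thesis
    using le_compl_iff assms atom_closed by blast
next
  case False
  then have "p \<sqinter> b = p"
    using assms meet_le1[of p b] unfolding atom_def by blast
  then show ?thesis
    unfolding le_def by blast
qed

lemma atom_below_finite:
  assumes "finite_below a" "a \<in> B" "a \<noteq> \<bottom>"
  shows "\<exists>p. atom p \<and> p \<sqsubseteq> a"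
  using assms
proof (induction "card {b \<in> B. b \<sqsubseteq> a}" arbitrary: a rule: less_induct)
  case less
  show ?case
  proof (cases "atom a")
    case True
    then show ?thesis
      using less.prems(2) le_refl by blast
  next
    case False
    then obtain b where b_strictly_below: "b \<in> B" "b \<sqsubseteq> a" "b \<noteq> \<bottom>" "b \<noteq> a"
      using less.prems unfolding atom_def by blast
    have "{x \<in> B. x \<sqsubseteq> b} \<subseteq> {x \<in> B. x \<sqsubseteq> a}"
      using le_trans[OF _ b_strictly_below(2)] b_strictly_below(1) less.prems(2) by blast
    moreover have "a \<in> {x \<in> B. x \<sqsubseteq> a}" "a \<notin> {x \<in> B. x \<sqsubseteq> b}"
      using less.prems(2) b_strictly_below le_antisym by auto
    ultimately have "card {x \<in> B. x \<sqsubseteq> b} < card {x \<in> B. x \<sqsubseteq> a}"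
      using less.prems(1) unfolding finite_below_def by (intro psubset_card_mono) blast+
    moreover have "finite_below b"
      using finite_below_mono less.prems b_strictly_below by blast
    ultimately obtain p where "atom p" "p \<sqsubseteq> b"
      using less.hyps b_strictly_below by blast
    then show ?thesis
      using le_trans[OF _ b_strictly_below(2)] b_strictly_below(1) less.prems(2) atom_closed
      by blast
  qed
qed

definition atom_filter :: "'b \<Rightarrow> 'b set" where
  "atom_filter p = {b \<in> B. p \<sqsubseteq> b}"

lemma ultrafilter_atom_filter:
  assumes atom_p: "atom p"
  shows "ultrafilter (atom_filter p)"
  unfolding atom_filter_def
proof (rule ultrafilterI)
  show "\<bottom> \<notin> {b \<in> B. p \<sqsubseteq> b}"
    using le_bot atom_closed[OF atom_p] atom_neq_bot[OF atom_p] by auto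
  show "c \<in> {b \<in> B. p \<sqsubseteq> b}" if "b \<in> {b \<in> B. p \<sqsubseteq> b}" "c \<in> B" "b \<sqsubseteq> c" for b c
    using that le_trans[of p b c] atom_closed[OF atom_p] by blast
  show "b \<in> {b \<in> B. p \<sqsubseteq> b} \<or> \<sim> b \<in> {b \<in> B. p \<sqsubseteq> b}" if "b \<in> B" for b
    using atom_decides[OF atom_p that] that by blast
qed (use atom_closed[OF atom_p] in \<open>auto intro: meet_greatest\<close>)

lemma atom_in_atom_filter: "atom p \<Longrightarrow> p \<in> atom_filter p"
  unfolding atom_filter_def using atom_closed by simp

lemma atom_filter_inject:
  assumes "atom p" "atom q" "atom_filter p = atom_filter q"
  shows "p = q"
proof -
  have "q \<in> atom_filter p"
    using assms atom_in_atom_filter by simp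
  then show ?thesis
    using atom_le_atom assms unfolding atom_filter_def by blast
qed

subsection \<open>Minimally infinite elements\<close>

text \<open>The atoms of the quotient by the ideal of finite elements.\<close>

definition minimally_infinite :: "'b \<Rightarrow> bool" where
  "minimally_infinite a \<longleftrightarrow> a \<in> B \<and> \<not> finite_below a \<and>
     (\<forall>b\<in>B. finite_below (a \<sqinter> b) \<or> finite_below (a \<sqinter> \<sim> b))"

lemma minimally_infinite_closed: "minimally_infinite a \<Longrightarrow> a \<in> B"
  unfolding minimally_infinite_def by blast

lemma minimally_infinite_mono:
  assumes "minimally_infinite a" "c \<in> B" "c \<sqsubseteq> a" "\<not> finite_below c"
  shows "minimally_infinite c"
proof -
  have "finite_below (c \<sqinter> b)" if "finite_below (a \<sqinter> b)" "b \<in> B" for b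
    using finite_below_mono[OF that(1) meet_mono[OF assms(3) le_refl]] that(2) assms(2)
      minimally_infinite_closed[OF assms(1)] by blast
  then show ?thesis
    using assms unfolding minimally_infinite_def by blast
qed

lemma minimally_infinite_diff_atom:
  assumes "minimally_infinite a" "atom p" "p \<sqsubseteq> a"
  shows "minimally_infinite (a \<sqinter> \<sim> p)"
proof (rule minimally_infinite_mono[OF assms(1)])
  note closed = minimally_infinite_closed[OF assms(1)] atom_closed[OF assms(2)]
  have "a \<sqinter> p = p"
    using assms(3) meet_commute closed unfolding le_def by metis
  then show "\<not> finite_below (a \<sqinter> \<sim> p)"
    using finite_below_split[of a p] finite_below_atom[OF assms(2)] assms(1) closed
    unfolding minimally_infinite_def by auto
qed (use minimally_infinite_closed[OF assms(1)] atom_closed[OF assms(2)] in auto)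

lemma atom_below_minimally_infinite:
  assumes "minimally_infinite a"
  shows "\<exists>p. atom p \<and> p \<sqsubseteq> a"
proof -
  have a_infinite: "a \<in> B" "\<not> finite_below a"
    using assms unfolding minimally_infinite_def by blast+
  then have "a \<noteq> \<bottom>" "\<not> atom a"
    using finite_below_bot finite_below_atom by blast+
  then obtain b where b_strictly_below: "b \<in> B" "b \<sqsubseteq> a" "b \<noteq> \<bottom>" "b \<noteq> a"
    using a_infinite(1) unfolding atom_def by blast
  have "a \<sqinter> \<sim> b \<noteq> \<bottom>"
    using le_iff_meet_compl[OF a_infinite(1) b_strictly_below(1)] b_strictly_below(4)
      le_antisym[OF b_strictly_below(1) a_infinite(1) b_strictly_below(2)] by blast
  moreover have "a \<sqinter> b \<noteq> \<bottom>"
    using b_strictly_below meet_commute[OF a_infinite(1) b_strictly_below(1)] unfolding le_def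
    by simp
  moreover have "finite_below (a \<sqinter> b) \<or> finite_below (a \<sqinter> \<sim> b)"
    using assms b_strictly_below(1) unfolding minimally_infinite_def by blast
  ultimately obtain c where c_finite: "c \<in> B" "c \<sqsubseteq> a" "c \<noteq> \<bottom>" "finite_below c"
    using meet_le1[OF a_infinite(1)] b_strictly_below(1) a_infinite(1)
    by (metis compl_closed meet_closed)
  then obtain p where "atom p" "p \<sqsubseteq> c"
    using atom_below_finite by blast
  then show ?thesis
    using le_trans[OF _ c_finite(2)] c_finite(1) a_infinite(1) atom_closed by blast
qed

lemma finite_below_diff_meet:
  assumes "finite_below (a \<sqinter> \<sim> b)" "finite_below (a \<sqinter> \<sim> c)" and "a \<in> B" "b \<in> B" "c \<in> B"
  shows "finite_below (a \<sqinter> \<sim> (b \<sqinter> c))"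
proof (rule finite_below_mono)
  show "finite_below (a \<sqinter> (\<sim> b \<squnion> \<sim> c))"
    using finite_below_join[OF assms(1,2)] assms(3-5) by (simp add: meet_join_distrib)
  show "a \<sqinter> \<sim> (b \<sqinter> c) \<sqsubseteq> a \<sqinter> (\<sim> b \<squnion> \<sim> c)"
    using assms(3-5) by (simp add: meet_mono compl_meet_le)
qed (use assms(3-5) in auto)

definition cofinite_filter :: "'b \<Rightarrow> 'b set" where
  "cofinite_filter a = {b \<in> B. finite_below (a \<sqinter> \<sim> b)}"

lemma ultrafilter_cofinite_filter:
  assumes minimal_a: "minimally_infinite a"
  shows "ultrafilter (cofinite_filter a)"
proof -
  note a_in = minimally_infinite_closed[OF minimal_a]
  show ?thesis
    unfolding cofinite_filter_def
  proof (rule ultrafilterI)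
    let ?U = "{b \<in> B. finite_below (a \<sqinter> \<sim> b)}"
    show "\<top> \<in> ?U"
      using a_in finite_below_bot by simp
    show "\<bottom> \<notin> ?U"
      using minimal_a a_in unfolding minimally_infinite_def by simp
    show "b \<sqinter> c \<in> ?U" if "b \<in> ?U" "c \<in> ?U" for b c
      using that finite_below_diff_meet a_in by auto
    show "c \<in> ?U" if "b \<in> ?U" "c \<in> B" "b \<sqsubseteq> c" for b c
    proof -
      have "a \<sqinter> \<sim> c \<sqsubseteq> a \<sqinter> \<sim> b"
        using that a_in by (simp add: meet_mono compl_antimono)
      then show ?thesis
        using finite_below_mono[of "a \<sqinter> \<sim> b"] that a_in by simp
    qed
    show "b \<in> ?U \<or> \<sim> b \<in> ?U" if "b \<in> B" for b
      using minimal_a that unfolding minimally_infinite_def by auto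
  qed blast
qed

lemma atom_filter_neq_cofinite_filter:
  assumes "minimally_infinite a" "atom p" "p \<sqsubseteq> a"
  shows "atom_filter p \<noteq> cofinite_filter a"
  using atom_in_atom_filter[OF assms(2)] minimally_infinite_diff_atom[OF assms]
  unfolding cofinite_filter_def minimally_infinite_def by blast

lemma atom_filters_tendsto_cofinite_filter:
  assumes distinct_atoms: "inj p" "\<And>n :: nat. atom (p n)" "\<And>n. p n \<sqsubseteq> a"
    and a_in: "a \<in> B" and b_cofinite: "b \<in> cofinite_filter a"
  shows "\<exists>N. \<forall>n\<ge>N. b \<in> atom_filter (p n)"
proof -
  have b_in: "b \<in> B" "finite_below (a \<sqinter> \<sim> b)"
    using b_cofinite unfolding cofinite_filter_def by auto
  have "p ` {n. \<not> p n \<sqsubseteq> b} \<subseteq> {x \<in> B. x \<sqsubseteq> a \<sqinter> \<sim> b}"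
    using atom_decides[OF distinct_atoms(2) b_in(1)] distinct_atoms(3) a_in b_in(1)
      atom_closed[OF distinct_atoms(2)]
    by (auto intro: meet_greatest)
  then have "finite (p ` {n. \<not> p n \<sqsubseteq> b})"
    using b_in(2) unfolding finite_below_def by (rule finite_subset)
  then have "finite {n. \<not> p n \<sqsubseteq> b}"
    using distinct_atoms(1) by (intro finite_imageD[of p]) (auto intro: inj_on_subset)
  then obtain N where "\<forall>n\<in>{n. \<not> p n \<sqsubseteq> b}. n < N"
    using finite_nat_set_iff_bounded by blast
  then show ?thesis
    unfolding atom_filter_def using b_in(1) by (metis linorder_not_less mem_Collect_eq)
qed

primrec remove_atoms :: "('b \<Rightarrow> 'b) \<Rightarrow> 'b \<Rightarrow> nat \<Rightarrow> 'b" where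
  "remove_atoms pick a 0 = a"
| "remove_atoms pick a (Suc n) = remove_atoms pick a n \<sqinter> \<sim> pick (remove_atoms pick a n)"

context
  fixes pick a
  assumes a: "minimally_infinite a"
    and pick: "\<And>c. c \<in> B \<Longrightarrow> \<exists>p. atom p \<and> p \<sqsubseteq> c \<Longrightarrow> atom (pick c) \<and> pick c \<sqsubseteq> c"
begin

lemma pick_atom:
  assumes "minimally_infinite c"
  shows "atom (pick c)" "pick c \<sqsubseteq> c"
  using pick atom_below_minimally_infinite[OF assms] minimally_infinite_closed[OF assms] by blast+

lemma remove_atoms_minimally_infinite: "minimally_infinite (remove_atoms pick a n)"
  by (induction n) (use a pick_atom minimally_infinite_diff_atom in auto)

lemma remove_atoms_closed: "remove_atoms pick a n \<in> B"
  by (rule minimally_infinite_closed[OF remove_atoms_minimally_infinite])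

lemma removed_atom: "atom (pick (remove_atoms pick a n))"
  by (rule pick_atom(1)[OF remove_atoms_minimally_infinite])

lemma remove_atoms_antimono:
  assumes "m \<le> n"
  shows "remove_atoms pick a n \<sqsubseteq> remove_atoms pick a m"
  using assms
proof (induction rule: dec_induct)
  case base
  show ?case
    using remove_atoms_closed by simp
next
  case (step n)
  have "remove_atoms pick a (Suc n) \<sqsubseteq> remove_atoms pick a n"
    using remove_atoms_closed atom_closed[OF removed_atom] by simp
  then show ?case
    using le_trans step.IH remove_atoms_closed by blast
qed

lemma removed_atom_le: "pick (remove_atoms pick a n) \<sqsubseteq> a"
proof -
  have "remove_atoms pick a n \<sqsubseteq> a"
    using remove_atoms_antimono[of 0 n] by simp
  then show ?thesis
    using le_trans[OF pick_atom(2)[OF remove_atoms_minimally_infinite]] atom_closed[OF removed_atom]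
      remove_atoms_closed minimally_infinite_closed[OF a] by blast
qed

lemma removed_atom_disjoint:
  assumes "m < n"
  shows "pick (remove_atoms pick a n) \<sqsubseteq> \<sim> pick (remove_atoms pick a m)"
proof -
  let ?rem = "remove_atoms pick a"
  note closed = remove_atoms_closed atom_closed[OF removed_atom]
  have "?rem n \<sqsubseteq> ?rem (Suc m)"
    using assms by (intro remove_atoms_antimono) simp
  moreover have "?rem (Suc m) \<sqsubseteq> \<sim> pick (?rem m)"
    using closed by simp
  ultimately have "?rem n \<sqsubseteq> \<sim> pick (?rem m)"
    using le_trans closed by blast
  then show ?thesis
    using le_trans[OF pick_atom(2)[OF remove_atoms_minimally_infinite]] closed by blast
qed

lemma removed_atoms_inj: "inj (\<lambda>n. pick (remove_atoms pick a n))"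
proof (rule linorder_injI)
  fix m n :: nat assume "m < n"
  then show "pick (remove_atoms pick a m) \<noteq> pick (remove_atoms pick a n)"
    using removed_atom_disjoint not_le_and_le_compl[of _ "pick (remove_atoms pick a m)"]
      le_refl atom_closed[OF removed_atom] atom_neq_bot[OF removed_atom] by metis
qed

end

subsection \<open>Ideals\<close>

definition ideal :: "'b set \<Rightarrow> bool" where
  "ideal I \<longleftrightarrow> I \<subseteq> B \<and> \<bottom> \<in> I \<and> (\<forall>a\<in>B. \<forall>b\<in>I. a \<sqsubseteq> b \<longrightarrow> a \<in> I) \<and> (\<forall>a\<in>I. \<forall>b\<in>I. a \<squnion> b \<in> I)"

definition le_mod :: "'b set \<Rightarrow> 'b \<Rightarrow> 'b \<Rightarrow> bool" where
  "le_mod I a b \<longleftrightarrow> (\<exists>i\<in>I. a \<sqsubseteq> i \<squnion> b)"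

lemma ideal_bot: "ideal {\<bottom>}"
  unfolding ideal_def using le_bot by auto

lemma ideal_Union_chain:
  assumes "\<I> \<noteq> {}" "\<And>I. I \<in> \<I> \<Longrightarrow> ideal I" "\<And>I J. I \<in> \<I> \<Longrightarrow> J \<in> \<I> \<Longrightarrow> I \<subseteq> J \<or> J \<subseteq> I"
  shows "ideal (\<Union>\<I>)"
  unfolding ideal_def
proof (intro conjI ballI impI)
  fix a b assume "a \<in> \<Union>\<I>" "b \<in> \<Union>\<I>"
  then obtain I where a_b_in_I: "I \<in> \<I>" "a \<in> I" "b \<in> I"
    using assms(3) by blast
  then have "a \<squnion> b \<in> I"
    using assms(2) unfolding ideal_def by blast
  then show "a \<squnion> b \<in> \<Union>\<I>"
    using a_b_in_I(1) by blast
qed (use assms(1,2) in \<open>unfold ideal_def, blast+\<close>)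

definition ideal_avoiding :: "('b \<Rightarrow> bool) \<Rightarrow> 'b set \<Rightarrow> bool" where
  "ideal_avoiding N I \<longleftrightarrow> ideal I \<and> (\<forall>i\<in>I. \<not> N i)"

lemma ideal_avoiding_bot: "\<not> N \<bottom> \<Longrightarrow> ideal_avoiding N {\<bottom>}"
  unfolding ideal_avoiding_def using ideal_bot by blast

lemma ideal_avoiding_Union_chain:
  assumes "\<I> \<noteq> {}" "\<And>I. I \<in> \<I> \<Longrightarrow> ideal_avoiding N I"
    and "\<And>I J. I \<in> \<I> \<Longrightarrow> J \<in> \<I> \<Longrightarrow> I \<subseteq> J \<or> J \<subseteq> I"
  shows "ideal_avoiding N (\<Union>\<I>)"
  using assms ideal_Union_chain[OF assms(1) _ assms(3)] unfolding ideal_avoiding_def by blast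

context
  fixes I
  assumes ideal: "ideal I"
begin

lemma ideal_closed [simp]: "i \<in> I \<Longrightarrow> i \<in> B"
  using ideal unfolding ideal_def by blast

lemma le_mod_of_le: "a \<sqsubseteq> b \<Longrightarrow> a \<in> B \<Longrightarrow> b \<in> B \<Longrightarrow> le_mod I a b"
  using ideal le_trans[OF _ join_upper2[of \<bottom> b]] unfolding le_mod_def ideal_def by blast

lemma le_mod_trans:
  assumes "le_mod I a b" "le_mod I b c" and "a \<in> B" "b \<in> B" "c \<in> B"
  shows "le_mod I a c"
proof -
  obtain i j where witnesses: "i \<in> I" "a \<sqsubseteq> i \<squnion> b" "j \<in> I" "b \<sqsubseteq> j \<squnion> c"
    using assms(1,2) unfolding le_mod_def by blast
  then have witnesses_closed: "i \<in> B" "j \<in> B" "i \<squnion> j \<in> I"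
    using ideal unfolding ideal_def by blast+
  have "j \<squnion> c \<sqsubseteq> i \<squnion> j \<squnion> c"
    using witnesses_closed assms(5) by (intro join_mono) auto
  then have "b \<sqsubseteq> i \<squnion> j \<squnion> c"
    using le_trans[OF witnesses(4)] witnesses_closed assms(4,5) by blast
  moreover have "i \<sqsubseteq> i \<squnion> j \<squnion> c"
    using le_trans[OF join_upper1[of i j] join_upper1[of _ c]] witnesses_closed assms(5) by blast
  ultimately have "i \<squnion> b \<sqsubseteq> i \<squnion> j \<squnion> c"
    using witnesses_closed assms(4,5) by (intro join_least) auto
  then have "a \<sqsubseteq> i \<squnion> j \<squnion> c"
    using le_trans[OF witnesses(2)] witnesses_closed assms(3-5) by blast
  then show ?thesis
    unfolding le_mod_def using witnesses_closed(3) by blast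
qed

lemma le_mod_bot_iff: "a \<in> B \<Longrightarrow> le_mod I a \<bottom> \<longleftrightarrow> a \<in> I"
  using ideal unfolding le_mod_def ideal_def by (metis join_bot le_refl subsetD)

lemma le_mod_common_witness:
  assumes "le_mod I c a" "le_mod I d b" and "a \<in> B" "b \<in> B" "c \<in> B" "d \<in> B"
  obtains i where "i \<in> I" "c \<sqsubseteq> i \<squnion> a" "d \<sqsubseteq> i \<squnion> b"
proof -
  obtain i j where witnesses: "i \<in> I" "c \<sqsubseteq> i \<squnion> a" "j \<in> I" "d \<sqsubseteq> j \<squnion> b"
    using assms(1,2) unfolding le_mod_def by blast
  then have witnesses_closed: "i \<in> B" "j \<in> B" "i \<squnion> j \<in> I"
    using ideal unfolding ideal_def by blast+
  have "i \<squnion> a \<sqsubseteq> i \<squnion> j \<squnion> a" "j \<squnion> b \<sqsubseteq> i \<squnion> j \<squnion> b"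
    using witnesses_closed assms(3,4) by (auto intro!: join_mono)
  then have "c \<sqsubseteq> i \<squnion> j \<squnion> a" "d \<sqsubseteq> i \<squnion> j \<squnion> b"
    using le_trans[OF witnesses(2)] le_trans[OF witnesses(4)] witnesses_closed assms(3-6) by blast+
  then show thesis
    using that witnesses_closed(3) by blast
qed

lemma le_mod_meet:
  assumes "le_mod I c a" "le_mod I c b" and "a \<in> B" "b \<in> B" "c \<in> B"
  shows "le_mod I c (a \<sqinter> b)"
proof -
  obtain i where witness: "i \<in> I" "c \<sqsubseteq> i \<squnion> a" "c \<sqsubseteq> i \<squnion> b"
    using le_mod_common_witness[OF assms(1,2)] assms(3-5) by blast
  then have "c \<sqsubseteq> i \<squnion> a \<sqinter> b"
    using assms(3-5) by (simp add: join_meet_distrib meet_greatest)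
  then show ?thesis
    unfolding le_mod_def using witness(1) by blast
qed

lemma le_mod_join:
  assumes "le_mod I a c" "le_mod I b c" and "a \<in> B" "b \<in> B" "c \<in> B"
  shows "le_mod I (a \<squnion> b) c"
proof -
  obtain i where "i \<in> I" "a \<sqsubseteq> i \<squnion> c" "b \<sqsubseteq> i \<squnion> c"
    using le_mod_common_witness[OF assms(1,2)] assms(3-5) by blast
  then show ?thesis
    unfolding le_mod_def using assms(3-5) join_least[of a _ b] by (metis ideal_closed join_closed)
qed

lemma le_mod_disjoint:
  assumes "le_mod I a b" "a \<sqinter> b = \<bottom>" and "a \<in> B" "b \<in> B"
  shows "a \<in> I"
proof -
  have "le_mod I a (a \<sqinter> b)"
    using le_mod_meet[OF le_mod_of_le assms(1)] assms(3,4) by simp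
  then show ?thesis
    using assms(2,3) le_mod_bot_iff by simp
qed

lemma le_mod_compl:
  assumes "c \<sqinter> a \<in> I" and "a \<in> B" "c \<in> B"
  shows "le_mod I c (\<sim> a)"
proof -
  have "c \<sqinter> a \<squnion> c \<sqinter> \<sim> a \<sqsubseteq> c \<sqinter> a \<squnion> \<sim> a"
    using assms(2,3) by (intro join_mono) auto
  then show ?thesis
    unfolding le_mod_def using meet_split assms by (metis (no_types))
qed

lemma ideal_adjoin:
  assumes "a \<in> B"
  shows "ideal {b \<in> B. le_mod I b a}"
  unfolding ideal_def
proof (intro conjI ballI impI)
  show "c \<in> {b \<in> B. le_mod I b a}" if "c \<in> B" "b \<in> {b \<in> B. le_mod I b a}" "c \<sqsubseteq> b" for b c
    using that assms le_mod_trans[OF le_mod_of_le] by blast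
qed (use assms in \<open>auto intro: le_mod_join le_mod_of_le simp: le_def meet_commute[of \<bottom>]\<close>)

lemma ideal_sub_adjoin:
  assumes "a \<in> B"
  shows "I \<subseteq> {b \<in> B. le_mod I b a}"
  unfolding le_mod_def using assms join_upper1[OF ideal_closed assms] ideal_closed by blast

end

subsection \<open>Binary splitting\<close>

definition splitting :: "('b \<Rightarrow> 'b) \<Rightarrow> bool" where
  "splitting g \<longleftrightarrow> (\<forall>a\<in>B. \<not> finite_below a \<longrightarrow>
     g a \<in> B \<and> \<not> finite_below (a \<sqinter> g a) \<and> \<not> finite_below (a \<sqinter> \<sim> g a))"

primrec branch :: "('b \<Rightarrow> 'b) \<Rightarrow> (nat \<Rightarrow> bool) \<Rightarrow> nat \<Rightarrow> 'b" where
  "branch g X 0 = \<top>"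
| "branch g X (Suc k) = branch g X k \<sqinter> (if X k then g (branch g X k) else \<sim> g (branch g X k))"

lemma branch_cong: "(\<And>i. i < k \<Longrightarrow> X i = Y i) \<Longrightarrow> branch g X k = branch g Y k"
  by (induction k) simp_all

text \<open>The images of the nodes of the tree form a dense subset of the quotient \<open>B / I\<close>.\<close>

definition tree_dense_mod :: "('b \<Rightarrow> 'b) \<Rightarrow> 'b set \<Rightarrow> bool" where
  "tree_dense_mod g I \<longleftrightarrow> ideal I \<and> (\<forall>X k. branch g X k \<notin> I) \<and>
     (\<forall>a\<in>B. a \<notin> I \<longrightarrow> (\<exists>X k. le_mod I (branch g X k) a))"

definition decides_mod :: "'b set \<Rightarrow> 'b \<Rightarrow> 'b \<Rightarrow> bool" where
  "decides_mod I c a \<longleftrightarrow> le_mod I c a \<or> le_mod I c (\<sim> a)"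

definition branch_filter :: "('b \<Rightarrow> 'b) \<Rightarrow> 'b set \<Rightarrow> (nat \<Rightarrow> bool) \<Rightarrow> 'b set" where
  "branch_filter g I X = {a \<in> B. \<exists>k. le_mod I (branch g X k) a}"

context
  fixes g
  assumes g: "splitting g" and infinite: "infinite B"
begin

lemma branch_closed_infinite: "branch g X k \<in> B \<and> \<not> finite_below (branch g X k)"
  by (induction k) (use g infinite finite_below_top in \<open>auto simp: splitting_def\<close>)

lemma branch_closed [simp]: "branch g X k \<in> B"
  using branch_closed_infinite by blast

lemma split_branch_closed [simp]: "g (branch g X k) \<in> B"
  using g branch_closed_infinite unfolding splitting_def by blast

lemma branch_antimono:
  assumes "k \<le> l"
  shows "branch g X l \<sqsubseteq> branch g X k"
  using assms
proof (induction rule: dec_induct)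
  case (step l)
  have "branch g X (Suc l) \<sqsubseteq> branch g X l"
    by simp
  then show ?case
    using le_trans step.IH branch_closed by blast
qed simp

lemma branch_Suc_disjoint:
  assumes "\<And>i. i < k \<Longrightarrow> X i = Y i" "X k \<noteq> Y k"
  shows "branch g X (Suc k) \<sqinter> branch g Y (Suc k) = \<bottom>"
proof -
  define c where "c = branch g X k"
  have branch_k: "c \<in> B" "g c \<in> B" "branch g Y k = c"
    using branch_cong[of k X Y g] assms(1) unfolding c_def by simp_all
  have "c \<sqinter> g c \<sqinter> (c \<sqinter> \<sim> g c) = \<bottom>"
    by (rule disjoint_mono[of "g c" "\<sim> g c"]) (use branch_k(1,2) in auto)
  then show ?thesis
    using assms(2) branch_k meet_commute[of "c \<sqinter> g c" "c \<sqinter> \<sim> g c"]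
    by (cases "X k") (auto simp: c_def[symmetric])
qed

lemma branch_disjoint:
  assumes "j < k" "j < l" "X j \<noteq> Y j"
  shows "branch g X k \<sqinter> branch g Y l = \<bottom>"
proof -
  define i where "i = (LEAST i. X i \<noteq> Y i)"
  have first_difference: "X i \<noteq> Y i" "\<And>j. j < i \<Longrightarrow> X j = Y j" "i \<le> j"
    unfolding i_def using LeastI[of "\<lambda>i. X i \<noteq> Y i" j] assms(3) not_less_Least
    by (auto intro: Least_le)
  show ?thesis
  proof (rule disjoint_mono)
    show "branch g X (Suc i) \<sqinter> branch g Y (Suc i) = \<bottom>"
      using first_difference(2,1) by (rule branch_Suc_disjoint)
    show "branch g X k \<sqsubseteq> branch g X (Suc i)" "branch g Y l \<sqsubseteq> branch g Y (Suc i)"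
      using first_difference(3) assms(1,2) by (intro branch_antimono; simp)+
  qed (rule branch_closed)+
qed

context
  fixes I
  assumes I: "tree_dense_mod g I"
begin

lemma tree_dense_ideal: "ideal I"
  using I unfolding tree_dense_mod_def by blast

lemma branch_not_in_ideal: "branch g X k \<notin> I"
  using I unfolding tree_dense_mod_def by blast

lemma branch_le_mod_antimono:
  assumes "k \<le> l" "le_mod I (branch g X k) a" "a \<in> B"
  shows "le_mod I (branch g X l) a"
  by (rule le_mod_trans[OF tree_dense_ideal le_mod_of_le[OF tree_dense_ideal branch_antimono]])
    (use assms in auto)

lemma branches_agree:
  assumes deeper_below: "le_mod I (branch g Y l) (branch g X k \<sqinter> a)" and "j < k" "j < l" "a \<in> B"
  shows "Y j = X j"
proof (rule ccontr)
  assume "Y j \<noteq> X j"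
  then have "branch g Y l \<sqinter> branch g X k = \<bottom>"
    by (rule branch_disjoint[OF assms(3,2)])
  then have "branch g Y l \<sqinter> (branch g X k \<sqinter> a) = \<bottom>"
    by (rule disjoint_mono) (use assms(4) in auto)
  then have "branch g Y l \<in> I"
    using le_mod_disjoint[OF tree_dense_ideal deeper_below] assms(4) by simp
  then show False
    using branch_not_in_ideal by blast
qed

lemma branch_decides:
  assumes a_in: "a \<in> B"
  shows "\<exists>Y l. k \<le> l \<and> (\<forall>i<k. Y i = X i) \<and> decides_mod I (branch g Y l) a"
proof (cases "branch g X k \<sqinter> a \<in> I")
  case True
  then have "le_mod I (branch g X k) (\<sim> a)"
    using a_in by (intro le_mod_compl[OF tree_dense_ideal]) auto
  then show ?thesis
    unfolding decides_mod_def by blast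
next
  case False
  moreover have "branch g X k \<sqinter> a \<in> B"
    using a_in by simp
  ultimately obtain Y l where Y_below: "le_mod I (branch g Y l) (branch g X k \<sqinter> a)"
    using I unfolding tree_dense_mod_def by blast
  have Y_below_a: "le_mod I (branch g Y l) a"
    by (rule le_mod_trans[OF tree_dense_ideal Y_below le_mod_of_le[OF tree_dense_ideal]])
      (use a_in in auto)
  show ?thesis
  proof (cases "k \<le> l")
    case True
    then show ?thesis
      using branches_agree[OF Y_below _ _ a_in] Y_below_a unfolding decides_mod_def
      by (metis order_less_le_trans)
  next
    case False
    then have "branch g Y l = branch g X l"
      using branches_agree[OF Y_below _ _ a_in] by (intro branch_cong) auto
    then have "le_mod I (branch g X k) a"
      using branch_le_mod_antimono[of l k X a] Y_below_a False a_in by simp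
    then show ?thesis
      unfolding decides_mod_def by blast
  qed
qed

lemma branch_in_filter: "branch g X k \<in> branch_filter g I X"
  unfolding branch_filter_def using le_mod_of_le[OF tree_dense_ideal] le_refl branch_closed by blast

lemma branch_filter_neq:
  assumes "ultrafilter (branch_filter g I X)" "X j \<noteq> Y j"
  shows "branch_filter g I X \<noteq> branch_filter g I Y"
proof
  assume "branch_filter g I X = branch_filter g I Y"
  then have "branch g X (Suc j) \<in> branch_filter g I X" "branch g Y (Suc j) \<in> branch_filter g I X"
    using branch_in_filter by blast+
  moreover have "branch g X (Suc j) \<sqinter> branch g Y (Suc j) = \<bottom>"
    by (rule branch_disjoint[OF lessI lessI]) (rule assms(2))
  ultimately show False
    using ultrafilter_not_disjoint[OF assms(1)] by blast
qed

lemma branch_filter_locally_constant: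
  assumes "a \<in> branch_filter g I X"
  obtains k where "\<And>Y. \<forall>i<k. Y i = X i \<Longrightarrow> a \<in> branch_filter g I Y"
proof -
  obtain k where node_below_a: "a \<in> B" "le_mod I (branch g X k) a"
    using assms unfolding branch_filter_def by blast
  have "a \<in> branch_filter g I Y" if "\<forall>i<k. Y i = X i" for Y
  proof -
    have "branch g Y k = branch g X k"
      using that by (intro branch_cong) simp
    then show ?thesis
      using node_below_a unfolding branch_filter_def by (metis (mono_tags, lifting) mem_Collect_eq)
  qed
  then show thesis
    by (rule that)
qed

lemma ultrafilter_branch_filter:
  assumes decides: "\<And>a. a \<in> B \<Longrightarrow> \<exists>k. decides_mod I (branch g X k) a"
  shows "ultrafilter (branch_filter g I X)"
proof (rule ultrafilterI)
  show "branch_filter g I X \<subseteq> B"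
    unfolding branch_filter_def by blast
  show "\<top> \<in> branch_filter g I X"
    using branch_in_filter[of X 0] by simp
  show "\<bottom> \<notin> branch_filter g I X"
    unfolding branch_filter_def
    using le_mod_bot_iff[OF tree_dense_ideal branch_closed] branch_not_in_ideal by blast
  show "a \<sqinter> b \<in> branch_filter g I X"
    if a_b_in_filter: "a \<in> branch_filter g I X" "b \<in> branch_filter g I X" for a b
  proof -
    obtain k l where "a \<in> B" "b \<in> B" "le_mod I (branch g X k) a" "le_mod I (branch g X l) b"
      using a_b_in_filter unfolding branch_filter_def by blast
    moreover from this have "le_mod I (branch g X (max k l)) a" "le_mod I (branch g X (max k l)) b"
      using branch_le_mod_antimono[of k "max k l"] branch_le_mod_antimono[of l "max k l"] by auto
    ultimately have "le_mod I (branch g X (max k l)) (a \<sqinter> b)" and "a \<in> B" "b \<in> B"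
      by (auto intro: le_mod_meet[OF tree_dense_ideal])
    then show ?thesis
      unfolding branch_filter_def using \<open>a \<in> B\<close> \<open>b \<in> B\<close> by blast
  qed
  show "b \<in> branch_filter g I X" if "a \<in> branch_filter g I X" "b \<in> B" "a \<sqsubseteq> b" for a b
    using that le_mod_trans[OF tree_dense_ideal _ le_mod_of_le[OF tree_dense_ideal] branch_closed]
    unfolding branch_filter_def by blast
  show "a \<in> branch_filter g I X \<or> \<sim> a \<in> branch_filter g I X" if "a \<in> B" for a
    using decides[OF that] that unfolding branch_filter_def decides_mod_def by blast
qed

end

end

end

section \<open>Cohen reals as binary sequences\<close>

definition bits :: "'a::set_universe \<Rightarrow> nat \<Rightarrow> bool" where
  "bits p i \<longleftrightarrow> opair (num i) (num 1) \<in> elts p"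

definition flip_bit :: "'a::set_universe \<Rightarrow> (nat \<Rightarrow> bool) \<Rightarrow> nat \<Rightarrow> bool" where
  "flip_bit n X i \<longleftrightarrow> (X i \<longleftrightarrow> num i \<noteq> n)"

lemma flip_bit_flip_bit [simp]: "flip_bit n (flip_bit n X) = X"
  unfolding flip_bit_def by auto

definition bit_graph :: "(nat \<Rightarrow> bool) \<Rightarrow> nat \<Rightarrow> 'a::set_universe set" where
  "bit_graph X k = {opair (num i) (num (if X i then 1 else 0)) | i. i < k}"

lemma opair_in_bit_graph:
  "opair (num i) y \<in> bit_graph X k \<longleftrightarrow> i < k \<and> y = num (if X i then 1 else 0)"
  unfolding bit_graph_def by (auto simp: opair_eq_iff)

lemma bit_graphE:
  assumes "z \<in> bit_graph X k"
  obtains i where "i < k" "z = opair (num i) (num (if X i then 1 else 0))"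
  using assms unfolding bit_graph_def by blast

lemma bits_bit_graph: "elts p = bit_graph X k \<Longrightarrow> i < k \<Longrightarrow> bits p i = X i"
  unfolding bits_def by (simp add: opair_in_bit_graph)

lemma bit_graph_in_Fn_omega_2:
  assumes elts_p: "elts p = bit_graph X k"
  shows "p \<in> Fn_omega_2"
proof -
  have "finite (elts p)"
    unfolding elts_p bit_graph_def by simp
  moreover have "is_fun p (num ` {..<k}) {num 0, num 1}"
    unfolding is_fun_def elts_p
  proof (intro conjI ballI)
    show "\<exists>x\<in>num ` {..<k}. \<exists>y\<in>{num 0, num 1}. z = opair x y" if "z \<in> bit_graph X k" for z
      using that by (elim bit_graphE) auto
    show "\<exists>!y. opair x y \<in> bit_graph X k" if "x \<in> num ` {..<k}" for x
      using that by (auto simp: opair_in_bit_graph)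
  qed
  ultimately show ?thesis
    unfolding Fn_omega_2_def by (intro CollectI conjI exI[of _ "num ` {..<k}"]) auto
qed

lemma Fn_omega_2_bit_graph:
  assumes "p \<in> Fn_omega_2"
  obtains k where "\<And>Y l. k \<le> l \<Longrightarrow> \<forall>i<k. Y i = bits p i \<Longrightarrow> elts p \<subseteq> bit_graph Y l"
proof -
  let ?entry = "\<lambda>i. opair (num i) (num (if bits p i then 1 else 0))"
  obtain X where finite_p: "finite (elts p)" and dom_X: "X \<subseteq> range num"
    and fun_p: "is_fun p X {num 0, num 1}"
    using assms unfolding Fn_omega_2_def by blast
  have p_entries: "elts p \<subseteq> range ?entry"
  proof
    fix z assume z_in: "z \<in> elts p"
    then obtain w y where z_eq: "w \<in> X" "y \<in> {num 0, num 1}" "z = opair w y"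
      using fun_p unfolding is_fun_def by blast
    then obtain i where w_eq: "w = num i"
      using dom_X by blast
    have "bits p i \<longleftrightarrow> num 1 = y"
      unfolding bits_def using is_fun_opair_iff[OF fun_p z_eq(1)] z_in z_eq(3) w_eq by metis
    then show "z \<in> range ?entry"
      using z_eq(2,3) w_eq by auto
  qed
  then obtain C where codes_C: "finite C" "elts p = ?entry ` C"
    using finite_subset_image[OF finite_p p_entries] by blast
  obtain k where codes_below_k: "\<forall>i\<in>C. i < k"
    using codes_C(1) finite_nat_set_iff_bounded by blast
  have "elts p \<subseteq> bit_graph Y l" if Y_extends: "k \<le> l" "\<forall>i<k. Y i = bits p i" for Y l
  proof -
    have "?entry i \<in> bit_graph Y l" if "i \<in> C" for i
      using that codes_below_k Y_extends by (auto simp: opair_in_bit_graph)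
    then show ?thesis
      unfolding codes_C(2) by blast
  qed
  then show thesis
    by (rule that)
qed

lemma bits_of_initial_segment:
  assumes fun_x: "is_fun x (range num) {num 0, num 1}"
    and initial_segment: "bit_graph X k \<subseteq> elts x" and "i < k"
  shows "bits x i = X i"
proof -
  have "opair (num i) (num (if X i then 1 else 0)) \<in> elts x"
    using initial_segment \<open>i < k\<close> opair_in_bit_graph by blast
  then have "total_app x (num i) = num (if X i then 1 else 0)"
    unfolding is_fun_opair_iff[OF fun_x rangeI] by (rule sym)
  then show ?thesis
    unfolding bits_def is_fun_opair_iff[OF fun_x rangeI] by simp
qed

context transitive_zermelo_omega
begin

lemma bit_graph_exists: "\<exists>p\<in>M. elts p = bit_graph X k"
proof -
  obtain f where "f \<in> M" "elts f = {opair (num i) (num (if X i then 1 else 0)) | i. i < k}"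
    using finite_graph_in[OF num_in] .
  then show ?thesis
    unfolding bit_graph_def by blast
qed

definition is_bit_graph :: "'a \<Rightarrow> 'a \<Rightarrow> bool" where
  "is_bit_graph p k \<longleftrightarrow>
     (\<forall>z\<in>elts p. \<exists>i\<in>elts k. z = opair i (num 0) \<or> z = opair i (num 1)) \<and>
     (\<forall>i\<in>elts k. \<not> (opair i (num 0) \<in> elts p \<longleftrightarrow> opair i (num 1) \<in> elts p))"

lemma is_bit_graph_num_iff: "is_bit_graph p (num k) \<longleftrightarrow> elts p = bit_graph (bits p) k"
proof
  assume p: "is_bit_graph p (num k)"
  have entry: "opair (num i) (num 0) \<in> elts p \<longleftrightarrow> \<not> bits p i" if "i < k" for i
    using p that unfolding is_bit_graph_def bits_def elts_num by blast
  show "elts p = bit_graph (bits p) k"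
  proof (intro equalityI subsetI)
    fix z assume "z \<in> elts p"
    then obtain i where "i < k" "z = opair (num i) (num 0) \<or> z = opair (num i) (num 1)" "z \<in> elts p"
      using p unfolding is_bit_graph_def elts_num by blast
    then show "z \<in> bit_graph (bits p) k"
      using entry[of i] unfolding bits_def by (auto simp: opair_in_bit_graph bits_def)
  next
    fix z :: 'a assume "z \<in> bit_graph (bits p) k"
    then show "z \<in> elts p"
      using entry by (elim bit_graphE) (auto simp: bits_def)
  qed
next
  assume p: "elts p = bit_graph (bits p) k"
  show "is_bit_graph p (num k)"
    unfolding is_bit_graph_def elts_num p
    by (auto simp: opair_in_bit_graph elim!: bit_graphE)
qed

lemma bit_graphs_with_in:
  assumes "definable M (\<lambda>e. Q (e 0) (e (Suc 0)))"
  obtains D where "D \<in> M"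
    "elts D = {p \<in> M. \<exists>k. elts p = bit_graph (bits p) k \<and> Q p (num k)}"
proof -
  let ?two = "upair (num 0) (num 1)"
  let ?D = "sep (power (times omega ?two)) (\<lambda>p. \<exists>k\<in>elts omega. is_bit_graph p k \<and> Q p k)"
  have times_two_in: "times omega ?two \<in> M"
    by (intro times_in omega_in upair_in num_in)
  have "definable M (\<lambda>e. Q (e (Suc 0)) (e 0))"
    using assms by (rule definable_swap)
  then have "?D \<in> M"
    unfolding is_bit_graph_def
    by (intro sep_in definable_intros power_in times_two_in omega_in num_in)
  moreover have "bit_graph X k \<subseteq> elts (times omega ?two)" for X k
    by (auto elim!: bit_graphE simp: omega_in upair_in num_in)
  then have "elts ?D = {p \<in> M. \<exists>k. elts p = bit_graph (bits p) k \<and> Q p (num k)}"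
    unfolding elts_sep elts_power[OF times_two_in] elts_omega bex_simps bex_UNIV
      is_bit_graph_num_iff
    by blast
  ultimately show thesis
    by (rule that)
qed

lemma Cohen_real_meets:
  assumes Cohen_x: "Cohen_real M x"
    and Q_codes_H: "definable M (\<lambda>e. Q (e 0) (e (Suc 0)))" "\<And>p k. Q p (num k) \<longleftrightarrow> H (bits p) k"
    and initial: "\<And>X Y k. (\<And>i. i < k \<Longrightarrow> X i = Y i) \<Longrightarrow> H X k \<Longrightarrow> H Y k"
    and dense: "\<And>X k. \<exists>Y l. k \<le> l \<and> (\<forall>i<k. Y i = X i) \<and> H Y l"
  shows "\<exists>k. H (bits x) k"
proof -
  obtain D where "D \<in> M"
    and elts_D: "elts D = {p \<in> M. \<exists>k. elts p = bit_graph (bits p) k \<and> H (bits p) k}"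
    using bit_graphs_with_in[OF Q_codes_H(1)] unfolding Q_codes_H(2) .
  moreover have "elts D \<subseteq> Fn_omega_2"
    unfolding elts_D using bit_graph_in_Fn_omega_2 by blast
  moreover have "\<exists>q\<in>elts D. elts p \<subseteq> elts q" if p: "p \<in> Fn_omega_2" for p
  proof -
    obtain k where k_bound: "\<And>Y l. k \<le> l \<Longrightarrow> \<forall>i<k. Y i = bits p i \<Longrightarrow> elts p \<subseteq> bit_graph Y l"
      using Fn_omega_2_bit_graph[OF p] by blast
    obtain Y l where Y_meets: "k \<le> l" "\<forall>i<k. Y i = bits p i" "H Y l"
      using dense[of k "bits p"] by blast
    obtain q where q_graph: "q \<in> M" "elts q = bit_graph Y l"
      using bit_graph_exists by blast
    have "bit_graph (bits q) l = bit_graph Y l"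
      unfolding bit_graph_def using bits_bit_graph[OF q_graph(2)] by auto
    moreover have "H (bits q) l"
      using initial[of l Y "bits q"] bits_bit_graph[OF q_graph(2)] Y_meets(3) by simp
    ultimately show ?thesis
      unfolding elts_D using q_graph k_bound[OF Y_meets(1,2)] by auto
  qed
  ultimately obtain p where p: "p \<in> elts D" "elts p \<subseteq> elts x"
    using Cohen_x unfolding Cohen_real_def by blast
  then obtain k where k_bound: "elts p = bit_graph (bits p) k" "H (bits p) k"
    unfolding elts_D by blast
  have "is_fun x (range num) {num 0, num 1}"
    using Cohen_x unfolding Cohen_real_def by blast
  then have "bits x i = bits p i" if "i < k" for i
    using bits_of_initial_segment that p(2) k_bound(1) by blast
  then show ?thesis
    using initial[of k "bits p" "bits x"] k_bound(2) by blast
qed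

end

section \<open>Boolean algebras in a model\<close>

locale boolean_algebra_set =
  fixes A :: "'a::set_universe ba"
  assumes boolean: "is_boolean_algebra A"
begin

abbreviation B :: "'a set" where
  "B \<equiv> elts (carr A)"

abbreviation bot :: 'a  ("\<bottom>") where
  "\<bottom> \<equiv> bot_elt A"

abbreviation top :: 'a  ("\<top>") where
  "\<top> \<equiv> top_elt A"

definition meet :: "'a \<Rightarrow> 'a \<Rightarrow> 'a"  (infixl "\<sqinter>" 70) where
  "a \<sqinter> b = total_app (meet_fun A) (opair a b)"

definition join :: "'a \<Rightarrow> 'a \<Rightarrow> 'a"  (infixl "\<squnion>" 65) where
  "a \<squnion> b = total_app (join_fun A) (opair a b)"

definition compl :: "'a \<Rightarrow> 'a"  ("\<sim> _" [80] 80) where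
  "\<sim> a = total_app (compl_fun A) a"

lemma operation_funs:
  "is_fun (meet_fun A) {opair a b | a b. a \<in> B \<and> b \<in> B} B"
  "is_fun (join_fun A) {opair a b | a b. a \<in> B \<and> b \<in> B} B"
  "is_fun (compl_fun A) B B"
  using boolean unfolding is_boolean_algebra_def by (simp_all add: Let_def)

lemma ba_meet_eq: "a \<in> B \<Longrightarrow> b \<in> B \<Longrightarrow> ba_meet A a b = a \<sqinter> b"
  unfolding ba_meet_def meet_def by (rule app_eq_total_app[OF operation_funs(1)]) blast

lemma ba_join_eq: "a \<in> B \<Longrightarrow> b \<in> B \<Longrightarrow> ba_join A a b = a \<squnion> b"
  unfolding ba_join_def join_def by (rule app_eq_total_app[OF operation_funs(2)]) blast

lemma ba_compl_eq: "a \<in> B \<Longrightarrow> ba_compl A a = \<sim> a"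
  unfolding ba_compl_def compl_def by (rule app_eq_total_app[OF operation_funs(3)])

sublocale boolean_algebra_on B meet join compl bot top
proof
  show closed: "a \<sqinter> b \<in> B" "a \<squnion> b \<in> B" if "a \<in> B" "b \<in> B" for a b
    unfolding meet_def join_def
    using is_fun_total_app_in[OF operation_funs(1)] is_fun_total_app_in[OF operation_funs(2)] that
    by blast+
  show compl_closed: "\<sim> a \<in> B" if "a \<in> B" for a
    unfolding compl_def using is_fun_total_app_in[OF operation_funs(3) that] .
  note laws = boolean[unfolded is_boolean_algebra_def Let_def]
  show "\<bottom> \<in> B" "\<top> \<in> B"
    using laws by blast+
  fix a assume a: "a \<in> B"
  have "ba_meet A a \<top> = a" "ba_join A a \<bottom> = a"
    "ba_meet A a (ba_compl A a) = \<bottom>" "ba_join A a (ba_compl A a) = \<top>"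
    using laws a by blast+
  then show "a \<sqinter> \<top> = a" "a \<squnion> \<bottom> = a" "a \<sqinter> \<sim> a = \<bottom>" "a \<squnion> \<sim> a = \<top>"
    using a compl_closed[OF a] \<open>\<bottom> \<in> B\<close> \<open>\<top> \<in> B\<close> by (simp_all add: ba_meet_eq ba_join_eq ba_compl_eq)
  fix b assume b: "b \<in> B"
  have "ba_meet A a b = ba_meet A b a" "ba_join A a b = ba_join A b a"
    using laws a b by blast+
  then show "a \<sqinter> b = b \<sqinter> a" "a \<squnion> b = b \<squnion> a"
    using a b by (simp_all add: ba_meet_eq ba_join_eq)
  fix c assume c: "c \<in> B"
  have "ba_meet A (ba_meet A a b) c = ba_meet A a (ba_meet A b c)"
    "ba_meet A a (ba_join A b c) = ba_join A (ba_meet A a b) (ba_meet A a c)"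
    "ba_join A a (ba_meet A b c) = ba_meet A (ba_join A a b) (ba_join A a c)"
    using laws a b c by blast+
  then show "a \<sqinter> b \<sqinter> c = a \<sqinter> (b \<sqinter> c)" "a \<sqinter> (b \<squnion> c) = a \<sqinter> b \<squnion> a \<sqinter> c"
    "a \<squnion> b \<sqinter> c = (a \<squnion> b) \<sqinter> (a \<squnion> c)"
    using a b c closed by (simp_all add: ba_meet_eq ba_join_eq)
qed

notation le  (infix "\<sqsubseteq>" 50)

lemma ba_ultrafilter_iff: "ba_ultrafilter A U \<longleftrightarrow> ultrafilter (elts U)"
proof (cases "elts U \<subseteq> B")
  case True
  then have "\<And>a. a \<in> elts U \<Longrightarrow> a \<in> B"
    by blast
  then show ?thesis
    unfolding ba_ultrafilter_def ultrafilter_def le_def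
    by (simp add: ba_meet_eq ba_compl_eq cong: ball_cong)
qed (simp add: ba_ultrafilter_def ultrafilter_def)

lemma finite_below_iff_sep: "finite_below a \<longleftrightarrow> finite (elts (sep (carr A) (\<lambda>b. b \<sqsubseteq> a)))"
  unfolding finite_below_def by simp

definition chosen :: "'a \<Rightarrow> ('a \<Rightarrow> bool) \<Rightarrow> 'a" where
  "chosen ch Q = total_app ch (sep (carr A) Q)"

definition chosen_atom :: "'a \<Rightarrow> 'a \<Rightarrow> 'a" where
  "chosen_atom ch a = chosen ch (\<lambda>p. atom p \<and> p \<sqsubseteq> a)"

definition chosen_split :: "'a \<Rightarrow> 'a \<Rightarrow> 'a" where
  "chosen_split ch a = chosen ch (\<lambda>b. \<not> finite_below (a \<sqinter> b) \<and> \<not> finite_below (a \<sqinter> \<sim> b))"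

text \<open>
  For \<open>n = omega\<close> no bit is flipped, so the terms of the sequence and its limit are values of one
  definable function.
\<close>

definition coded_branch :: "'a \<Rightarrow> 'a \<Rightarrow> 'a \<Rightarrow> 'a \<Rightarrow> 'a" where
  "coded_branch ch n p k = num_rec \<top> (\<lambda>i y. y \<sqinter> (if opair i (num 1) \<in> elts p \<longleftrightarrow> i \<noteq> n
     then chosen_split ch y else \<sim> chosen_split ch y)) k"

lemma coded_branch_num:
  "coded_branch ch n p (num k) = branch (chosen_split ch) (flip_bit n (bits p)) k"
  by (induction k) (simp_all add: coded_branch_def flip_bit_def bits_def)

lemma num_rec_remove_atoms:
  "num_rec a (\<lambda>_ y. y \<sqinter> \<sim> g y) (num n) = remove_atoms g a n"
  by (induction n) simp_all

end

definition has_nontrivial_convergent_sequence :: "'a::set_universe set \<Rightarrow> 'a ba \<Rightarrow> bool" where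
  "has_nontrivial_convergent_sequence M A \<longleftrightarrow>
     (\<exists>s. stone_sequence M A s \<and> stone_nontrivial M A s \<and> (\<exists>u. stone_tendsto M A s u))"

locale boolean_algebra_in = transitive_zermelo_omega M + boolean_algebra_set A
  for M :: "'a::set_universe set" and A :: "'a ba" +
  assumes ba_in: "ba_in A M"
begin

lemma components_in [intro]:
  "carr A \<in> M" "meet_fun A \<in> M" "join_fun A \<in> M" "compl_fun A \<in> M" "\<bottom> \<in> M" "\<top> \<in> M"
  using ba_in unfolding ba_in_def by auto

lemma carrier_elem_in: "a \<in> B \<Longrightarrow> a \<in> M"
  using transitive components_in(1) by blast

lemma definable_term_meet [definable_intros]:
  "definable_term M s \<Longrightarrow> definable_term M t \<Longrightarrow> definable_term M (\<lambda>e. s e \<sqinter> t e)"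
  unfolding meet_def by (intro definable_intros components_in)

lemma definable_term_join [definable_intros]:
  "definable_term M s \<Longrightarrow> definable_term M t \<Longrightarrow> definable_term M (\<lambda>e. s e \<squnion> t e)"
  unfolding join_def by (intro definable_intros components_in)

lemma definable_term_compl [definable_intros]:
  "definable_term M t \<Longrightarrow> definable_term M (\<lambda>e. \<sim> t e)"
  unfolding compl_def by (intro definable_intros components_in)

lemma definable_le [definable_intros]:
  "definable_term M s \<Longrightarrow> definable_term M t \<Longrightarrow> definable M (\<lambda>e. s e \<sqsubseteq> t e)"
  unfolding le_def by (intro definable_intros)

lemma definable_finite_below [definable_intros]:
  assumes "definable_term M t"
  shows "definable M (\<lambda>e. finite_below (t e))"
  unfolding finite_below_iff_sep
  by (intro definable_intros assms[THEN definable_term_rename] components_in)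

lemma definable_atom [definable_intros]:
  assumes "definable_term M t"
  shows "definable M (\<lambda>e. atom (t e))"
  unfolding atom_def
  by (intro definable_intros assms assms[THEN definable_term_rename] components_in)

lemma definable_ideal [definable_intros]:
  assumes "definable_term M t"
  shows "definable M (\<lambda>e. ideal (elts (t e)))"
  unfolding ideal_def
  by (intro definable_intros assms assms[THEN definable_term_rename] components_in)

lemma definable_le_mod [definable_intros]:
  assumes "definable_term M t" "definable_term M a" "definable_term M b"
  shows "definable M (\<lambda>e. le_mod (elts (t e)) (a e) (b e))"
  unfolding le_mod_def by (intro definable_intros assms assms[THEN definable_term_rename])

lemma definable_ultrafilter [definable_intros]:
  assumes "definable_term M t"
  shows "definable M (\<lambda>e. ultrafilter (elts (t e)))"
  unfolding ultrafilter_def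
  by (intro definable_intros assms assms[THEN definable_term_rename] components_in)

lemma definable_term_chosen_atom [definable_intros]:
  assumes "definable_term M ch" "definable_term M t"
  shows "definable_term M (\<lambda>e. chosen_atom (ch e) (t e))"
  unfolding chosen_atom_def chosen_def
  by (intro definable_intros assms assms[THEN definable_term_rename] components_in)

lemma definable_term_chosen_split [definable_intros]:
  assumes "definable_term M ch" "definable_term M t"
  shows "definable_term M (\<lambda>e. chosen_split (ch e) (t e))"
  unfolding chosen_split_def chosen_def
  by (intro definable_intros assms assms[THEN definable_term_rename] components_in)

lemma definable_term_coded_branch [definable_intros]:
  assumes "definable_term M ch" "definable_term M n" "definable_term M p" "definable_term M k"
  shows "definable_term M (\<lambda>e. coded_branch (ch e) (n e) (p e) (k e))"
  unfolding coded_branch_def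
  by (intro definable_intros assms assms[THEN definable_term_rename] components_in num_in)

definition coded_branch_filter :: "'a \<Rightarrow> 'a \<Rightarrow> 'a \<Rightarrow> 'a \<Rightarrow> 'a" where
  "coded_branch_filter ch I n p =
     sep (carr A) (\<lambda>a. \<exists>k\<in>elts omega. le_mod (elts I) (coded_branch ch n p k) a)"

lemma elts_coded_branch_filter:
  "elts (coded_branch_filter ch I n p) =
    branch_filter (chosen_split ch) (elts I) (flip_bit n (bits p))"
  unfolding coded_branch_filter_def branch_filter_def by (simp add: coded_branch_num)

lemma definable_term_coded_branch_filter [definable_intros]:
  assumes "definable_term M ch" "definable_term M I" "definable_term M n" "definable_term M p"
  shows "definable_term M (\<lambda>e. coded_branch_filter (ch e) (I e) (n e) (p e))"
  unfolding coded_branch_filter_def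
  by (intro definable_intros assms[THEN definable_term_rename] components_in omega_in)

section \<open>Convergence in the Stone space\<close>

lemma stone_pointsD:
  assumes "U \<in> stone_points M A"
  shows "U \<in> M" "ultrafilter (elts U)"
  using assms unfolding stone_points_def ba_ultrafilter_iff by blast+

lemma stone_pointsI: "U \<in> M \<Longrightarrow> ultrafilter (elts U) \<Longrightarrow> U \<in> stone_points M A"
  unfolding stone_points_def ba_ultrafilter_iff by blast

lemma stone_basic_open:
  assumes "a \<in> B"
  shows "\<exists>Z. stone_open M A Z \<and> elts Z = stone_basic M A a"
proof -
  let ?Z = "sep (power (carr A)) (\<lambda>U. ultrafilter (elts U) \<and> a \<in> elts U)"
  have "?Z \<in> M"
    by (intro sep_in definable_intros power_in components_in carrier_elem_in assms)
  moreover have "elts ?Z = stone_basic M A a"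
    unfolding elts_sep stone_basic_def stone_points_def elts_power[OF components_in(1)]
      ba_ultrafilter_iff
    using ultrafilter_sub by blast
  ultimately have "stone_open M A ?Z"
    unfolding stone_open_def stone_basic_def using assms by auto
  then show ?thesis
    using \<open>elts ?Z = stone_basic M A a\<close> by blast
qed

lemma stone_tendstoI:
  assumes "u \<in> stone_points M A" "range s \<subseteq> stone_points M A"
    and eventually_in: "\<And>a. a \<in> elts u \<Longrightarrow> \<exists>N. \<forall>n\<ge>N. a \<in> elts (s n)"
  shows "stone_tendsto M A s u"
  unfolding stone_tendsto_def
proof (intro conjI allI impI)
  fix Z assume "stone_open M A Z \<and> u \<in> elts Z"
  then obtain a where basic_a: "u \<in> stone_basic M A a" "stone_basic M A a \<subseteq> elts Z"
    unfolding stone_open_def by blast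
  then obtain N where "\<forall>n\<ge>N. a \<in> elts (s n)"
    using eventually_in unfolding stone_basic_def by blast
  then show "\<exists>N. \<forall>n\<ge>N. s n \<in> elts Z"
    using basic_a(2) assms(2) unfolding stone_basic_def by blast
qed (rule assms(1))

lemma stone_tendstoD:
  assumes "stone_tendsto M A s u" "a \<in> elts u"
  shows "\<exists>N. \<forall>n\<ge>N. a \<in> elts (s n)"
proof -
  have u_point: "u \<in> stone_points M A"
    using assms(1) unfolding stone_tendsto_def by blast
  then have "a \<in> B"
    using assms(2) ultrafilter_sub stone_pointsD(2) by blast
  then obtain Z where Z_basic: "stone_open M A Z" "elts Z = stone_basic M A a"
    using stone_basic_open by blast
  then have "\<exists>N. \<forall>n\<ge>N. s n \<in> elts Z"
    using assms u_point unfolding stone_tendsto_def stone_basic_def by blast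
  then show ?thesis
    unfolding Z_basic(2) stone_basic_def by blast
qed

lemma stone_tendsto_unique:
  assumes points_s: "range s \<subseteq> stone_points M A" and tends_u: "stone_tendsto M A s u"
    and tends_v: "stone_tendsto M A s v"
  shows "u = v"
proof (rule ccontr)
  assume "u \<noteq> v"
  then have "elts u \<noteq> elts v"
    using elts_ext by blast
  moreover have "u \<in> stone_points M A" "v \<in> stone_points M A"
    using tends_u tends_v unfolding stone_tendsto_def by blast+
  ultimately obtain a where a_separates: "a \<in> elts u" "\<sim> a \<in> elts v"
    using ultrafilters_separated stone_pointsD(2) by metis
  obtain N N' where eventually_in: "\<forall>n\<ge>N. a \<in> elts (s n)" "\<forall>n\<ge>N'. \<sim> a \<in> elts (s n)"
    using stone_tendstoD[OF tends_u a_separates(1)] stone_tendstoD[OF tends_v a_separates(2)]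
    by blast
  have ultrafilter_n: "ultrafilter (elts (s (max N N')))"
    using points_s stone_pointsD(2) by blast
  have "a \<in> elts (s (max N N'))" "\<sim> a \<in> elts (s (max N N'))"
    using eventually_in by simp_all
  then show False
    using ultrafilter_compl_iff[OF ultrafilter_n] ultrafilter_sub[OF ultrafilter_n] by blast
qed

lemma stone_sequenceI:
  assumes term_S: "definable_term M (\<lambda>e. S (e 0))" and "\<And>n. ultrafilter (elts (S (num n)))"
  shows "stone_sequence M A (\<lambda>n. S (num n))"
proof -
  have S_in: "S (num n) \<in> M" for n
    using definable_term_in[OF term_S, of "\<lambda>_. num n"] num_in by auto
  let ?f = "sep (times omega (power (carr A))) (\<lambda>z. \<exists>n\<in>elts omega. z = opair n (S n))"
  have "?f \<in> M"
    by (intro sep_in definable_intros times_in omega_in power_in components_in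
        term_S[THEN definable_term_rename])
  moreover have "opair (num n) (S (num n)) \<in> elts (times omega (power (carr A)))" for n
    using S_in ultrafilter_sub[OF assms(2)] omega_in components_in(1)
    by (subst opair_in_times) (auto simp: elts_power)
  then have "elts ?f = {opair (num n) (S (num n)) | n. True}"
    unfolding elts_sep elts_omega by auto
  ultimately show ?thesis
    unfolding stone_sequence_def using S_in assms(2) stone_pointsI by blast
qed

lemma convergent_sequenceI:
  assumes ultrafilters_S: "definable_term M (\<lambda>e. S (e 0))" "\<And>n. ultrafilter (elts (S (num n)))"
    and ultrafilter_u: "u \<in> M" "ultrafilter (elts u)"
    and inj_S: "inj (\<lambda>n. S (num n))" and S_neq_u: "\<And>n. S (num n) \<noteq> u"
    and eventually_in: "\<And>a. a \<in> elts u \<Longrightarrow> \<exists>N. \<forall>n\<ge>N. a \<in> elts (S (num n))"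
  shows "has_nontrivial_convergent_sequence M A"
proof -
  let ?s = "\<lambda>n. S (num n)"
  have sequence_s: "stone_sequence M A ?s"
    by (rule stone_sequenceI[OF ultrafilters_S])
  then have points: "range ?s \<subseteq> stone_points M A"
    unfolding stone_sequence_def by blast
  have "stone_tendsto M A ?s u"
    using stone_pointsI[OF ultrafilter_u] points eventually_in by (rule stone_tendstoI)
  moreover from this have "stone_nontrivial M A ?s"
    unfolding stone_nontrivial_def using inj_S S_neq_u stone_tendsto_unique[OF points] by blast
  ultimately show ?thesis
    unfolding has_nontrivial_convergent_sequence_def using sequence_s by blast
qed

lemma convergent_sequence_minimally_infinite:
  assumes ch_in: "ch \<in> M" and minimal_a: "minimally_infinite a"
    and picks_atom: "\<And>c. c \<in> B \<Longrightarrow> \<exists>p. atom p \<and> p \<sqsubseteq> c \<Longrightarrow>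
        atom (chosen_atom ch c) \<and> chosen_atom ch c \<sqsubseteq> c"
  shows "has_nontrivial_convergent_sequence M A"
proof -
  note a_in = minimally_infinite_closed[OF minimal_a]
  define p where "p n = chosen_atom ch (remove_atoms (chosen_atom ch) a n)" for n
  have distinct_atoms: "atom (p n)" "p n \<sqsubseteq> a" "inj p" for n
    unfolding p_def
    using removed_atom[OF minimal_a picks_atom] removed_atom_le[OF minimal_a picks_atom]
      removed_atoms_inj[OF minimal_a picks_atom]
    by blast+
  define S where "S n = sep (carr A) (\<lambda>b.
    chosen_atom ch (num_rec a (\<lambda>_ y. y \<sqinter> \<sim> chosen_atom ch y) n) \<sqsubseteq> b)" for n
  define u where "u = sep (carr A) (\<lambda>b. finite_below (a \<sqinter> \<sim> b))"
  have elts_S: "elts (S (num n)) = atom_filter (p n)" for n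
    unfolding S_def p_def atom_filter_def by (simp add: num_rec_remove_atoms)
  have elts_u: "elts u = cofinite_filter a"
    unfolding u_def cofinite_filter_def by simp
  show ?thesis
  proof (rule convergent_sequenceI)
    show "definable_term M (\<lambda>e. S (e 0))"
      unfolding S_def by (intro definable_intros components_in ch_in carrier_elem_in a_in)
    show "ultrafilter (elts (S (num n)))" for n
      unfolding elts_S using distinct_atoms(1) by (rule ultrafilter_atom_filter)
    show "u \<in> M"
      unfolding u_def by (intro sep_in definable_intros components_in carrier_elem_in a_in)
    show "ultrafilter (elts u)"
      unfolding elts_u using minimal_a by (rule ultrafilter_cofinite_filter)
    show "inj (\<lambda>n. S (num n))"
      using atom_filter_inject[OF distinct_atoms(1,1)] distinct_atoms(3) elts_S by (metis injD injI)
    show "S (num n) \<noteq> u" for n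
      using atom_filter_neq_cofinite_filter[OF minimal_a distinct_atoms(1,2)] elts_S elts_u by metis
    show "\<exists>N. \<forall>n\<ge>N. b \<in> elts (S (num n))" if "b \<in> elts u" for b
      using that atom_filters_tendsto_cofinite_filter[OF distinct_atoms(3,1,2) a_in]
      unfolding elts_S elts_u by blast
  qed
qed

lemma convergent_sequence_branches:
  assumes ch_in: "ch \<in> M" and x_in: "x \<in> M" and I_in: "I \<in> M" and infinite_B: "infinite B"
    and splits: "splitting (chosen_split ch)" and dense: "tree_dense_mod (chosen_split ch) (elts I)"
    and decides: "\<And>(n :: 'a) a. n \<in> insert omega (elts omega) \<Longrightarrow> a \<in> B \<Longrightarrow>
      \<exists>k. decides_mod (elts I) (branch (chosen_split ch) (flip_bit n (bits x)) k) a"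
  shows "has_nontrivial_convergent_sequence M A"
proof -
  let ?filter = "branch_filter (chosen_split ch) (elts I)" and ?X = "\<lambda>n :: 'a. flip_bit n (bits x)"
  define S where "S n = coded_branch_filter ch I n x" for n
  have elts_S: "elts (S n) = ?filter (?X n)" for n
    unfolding S_def by (rule elts_coded_branch_filter)
  have term_S: "definable_term M (\<lambda>e. S (e 0))"
    unfolding S_def by (intro definable_intros ch_in x_in I_in)
  have ultra: "ultrafilter (elts (S n))" if "n \<in> insert omega (elts omega)" for n
    unfolding elts_S using ultrafilter_branch_filter[OF splits infinite_B dense decides[OF that]] .
  have S_neq: "S (num n) \<noteq> S m" if "m = omega \<or> m = num k \<and> k \<noteq> n" for n m k
  proof -
    have "?X (num n) n \<noteq> ?X m n"
      using that unfolding flip_bit_def by auto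
    then show ?thesis
      using branch_filter_neq[OF splits infinite_B dense ultra[unfolded elts_S]] elts_S
      by (metis elts_omega insertI2 rangeI)
  qed
  show ?thesis
  proof (rule convergent_sequenceI[OF term_S])
    show "ultrafilter (elts (S (num n)))" "ultrafilter (elts (S omega))" for n
      using ultra by simp_all
    show "S omega \<in> M"
      using definable_term_in[OF term_S, of "\<lambda>_. omega"] omega_in by auto
    show "S (num n) \<noteq> S omega" for n
      using S_neq by blast
    show "inj (\<lambda>n. S (num n))"
      using S_neq by (metis injI)
    show "\<exists>N. \<forall>n\<ge>N. a \<in> elts (S (num n))" if a_in: "a \<in> elts (S omega)" for a
    proof -
      obtain k where decided_by_k: "\<And>Y. \<forall>i<k. Y i = ?X omega i \<Longrightarrow> a \<in> ?filter Y"
        using branch_filter_locally_constant[OF splits infinite_B dense] a_in elts_S by blast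
      have "\<forall>n\<ge>k. \<forall>i<k. ?X (num n) i = ?X omega i"
        unfolding flip_bit_def by auto
      then show ?thesis
        unfolding elts_S using decided_by_k by blast
    qed
  qed
qed

lemma Cohen_real_decides:
  assumes ch_in: "ch \<in> M" and I_in: "I \<in> M" and infinite_B: "infinite B"
    and splits: "splitting (chosen_split ch)" and dense: "tree_dense_mod (chosen_split ch) (elts I)"
    and Cohen_x: "Cohen_real M x" and n_in: "n \<in> M" and a_in: "a \<in> B"
  shows "\<exists>k. decides_mod (elts I) (branch (chosen_split ch) (flip_bit n (bits x)) k) a"
proof (rule Cohen_real_meets[OF Cohen_x])
  let ?g = "chosen_split ch"
  show "definable M (\<lambda>e. decides_mod (elts I) (coded_branch ch n (e 0) (e (Suc 0))) a)"
    unfolding decides_mod_def by (intro definable_intros ch_in I_in n_in carrier_elem_in a_in)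
  show "decides_mod (elts I) (coded_branch ch n p (num k)) a \<longleftrightarrow>
      decides_mod (elts I) (branch ?g (flip_bit n (bits p)) k) a" for p k
    by (simp add: coded_branch_num)
  show "decides_mod (elts I) (branch ?g (flip_bit n Y) k) a"
    if "\<And>i. i < k \<Longrightarrow> X i = Y i" "decides_mod (elts I) (branch ?g (flip_bit n X) k) a" for X Y k
    using that branch_cong[of k "flip_bit n X" "flip_bit n Y" ?g] unfolding flip_bit_def by simp
  show "\<exists>Y l. k \<le> l \<and> (\<forall>i<k. Y i = X i) \<and> decides_mod (elts I) (branch ?g (flip_bit n Y) l) a"
    for X k
  proof -
    obtain Y l where "k \<le> l" "\<forall>i<k. Y i = flip_bit n X i" "decides_mod (elts I) (branch ?g Y l) a"
      using branch_decides[where X = "flip_bit n X", OF splits infinite_B dense a_in] by blast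
    then show ?thesis
      by (intro exI[of _ "flip_bit n Y"] exI[of _ l]) (simp, auto simp: flip_bit_def)
  qed
qed

end

section \<open>Maximal ideals in a model of ZFC\<close>

locale boolean_algebra_zfc = transitive_zfc M + boolean_algebra_in M A
  for M :: "'a::set_universe set" and A :: "'a ba"
begin

lemma choice_on_carrier:
  obtains ch where "ch \<in> M"
    "\<And>Q. definable M (\<lambda>e. Q (e 0)) \<Longrightarrow> \<exists>b\<in>B. Q b \<Longrightarrow> chosen ch Q \<in> B \<and> Q (chosen ch Q)"
proof -
  obtain ch where ch_chooses: "ch \<in> M"
    "\<And>S. S \<in> M \<Longrightarrow> elts S \<subseteq> B \<Longrightarrow> elts S \<noteq> {} \<Longrightarrow> total_app ch S \<in> elts S"
    using choice_function[OF components_in(1)] by metis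
  have "chosen ch Q \<in> B \<and> Q (chosen ch Q)"
    if Q_nonempty: "definable M (\<lambda>e. Q (e 0))" "\<exists>b\<in>B. Q b" for Q
    using ch_chooses(2)[OF sep_in[OF components_in(1) Q_nonempty(1)]] Q_nonempty(2)
    unfolding chosen_def by auto
  then show thesis
    using that ch_chooses(1) by blast
qed

lemma maximal_ideal_avoiding:
  assumes definable_N: "definable M (\<lambda>e. N (e 0))" and "\<not> N \<bottom>"
  obtains I where "I \<in> M" "ideal_avoiding N (elts I)"
    "\<forall>J\<in>M. ideal_avoiding N (elts J) \<and> elts I \<subseteq> elts J \<longrightarrow> J = I"
proof -
  let ?F = "sep (power (carr A)) (\<lambda>I. ideal_avoiding N (elts I))"
  have F_in: "?F \<in> M"
    unfolding ideal_avoiding_def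
    by (intro sep_in definable_intros power_in components_in definable_N)
  have mem_F: "I \<in> elts ?F \<longleftrightarrow> I \<in> M \<and> ideal_avoiding N (elts I)" for I
    unfolding elts_sep elts_power[OF components_in(1)] ideal_avoiding_def ideal_def by blast
  have start: "upair \<bottom> \<bottom> \<in> elts ?F"
    unfolding mem_F using ideal_avoiding_bot[where N = N, OF assms(2)] components_in by auto
  have chain: "Unions C \<in> elts ?F"
    if C_chain: "C \<in> M" "elts C \<subseteq> elts ?F" "elts C \<noteq> {}" "inclusion_chain C" for C
  proof -
    have "ideal_avoiding N (\<Union>(elts ` elts C))"
    proof (rule ideal_avoiding_Union_chain)
      show "ideal_avoiding N I" if "I \<in> elts ` elts C" for I
        using that C_chain(2) mem_F by blast
      show "I \<subseteq> J \<or> J \<subseteq> I" if "I \<in> elts ` elts C" "J \<in> elts ` elts C" for I J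
        using that C_chain(4) unfolding inclusion_chain_def by blast
    qed (use C_chain(3) in blast)
    then show ?thesis
      unfolding mem_F elts_Unions using C_chain(1) by blast
  qed
  obtain I where "I \<in> elts ?F" "\<And>J. J \<in> elts ?F \<Longrightarrow> elts I \<subseteq> elts J \<Longrightarrow> J = I"
    using zorn_in[OF F_in start chain] by blast
  then show thesis
    using that unfolding mem_F by blast
qed

lemma le_mod_maximal_ideal_avoiding:
  assumes I_avoids: "I \<in> M" "ideal_avoiding N (elts I)"
    and maximal: "\<forall>J\<in>M. ideal_avoiding N (elts J) \<and> elts I \<subseteq> elts J \<longrightarrow> J = I"
    and a_not_in: "a \<in> B" "a \<notin> elts I"
  shows "\<exists>c. N c \<and> le_mod (elts I) c a"
proof -
  define J where "J = sep (carr A) (\<lambda>b. le_mod (elts I) b a)"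
  have elts_J: "elts J = {b \<in> B. le_mod (elts I) b a}"
    unfolding J_def by simp
  have "J \<in> M"
    unfolding J_def
    by (intro sep_in definable_intros components_in I_avoids(1) carrier_elem_in[OF a_not_in(1)])
  moreover have ideal: "ideal (elts I)"
    using I_avoids(2) unfolding ideal_avoiding_def by blast
  have "elts I \<subseteq> elts J" "ideal (elts J)"
    unfolding elts_J
    by (rule ideal_sub_adjoin[OF ideal a_not_in(1)], rule ideal_adjoin[OF ideal a_not_in(1)])
  moreover have "a \<in> elts J"
    unfolding elts_J using le_mod_of_le[OF ideal le_refl] a_not_in(1) by simp
  ultimately have "\<not> (\<forall>i\<in>elts J. \<not> N i)"
    using maximal a_not_in(2) unfolding ideal_avoiding_def by blast
  then show ?thesis
    unfolding elts_J by blast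
qed

lemma tree_dense_ideal_exists:
  assumes ch_in: "ch \<in> M" and splits: "splitting (chosen_split ch)" and infinite_B: "infinite B"
  obtains I where "I \<in> M" "tree_dense_mod (chosen_split ch) (elts I)"
proof -
  define node where "node c \<longleftrightarrow> (\<exists>p\<in>M. \<exists>k\<in>elts omega. c = coded_branch ch omega p k)" for c
  have node_iff: "node c \<longleftrightarrow> (\<exists>X k. c = branch (chosen_split ch) X k)" for c
  proof
    assume "\<exists>X k. c = branch (chosen_split ch) X k"
    then obtain X k where c_node: "c = branch (chosen_split ch) X k"
      by blast
    obtain p where p_codes: "p \<in> M" "elts p = bit_graph X k"
      using bit_graph_exists by blast
    have "coded_branch ch omega p (num k) = c"
      unfolding coded_branch_num c_node
      by (rule branch_cong) (simp add: flip_bit_def bits_bit_graph[OF p_codes(2)])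
    then show "node c"
      unfolding node_def using p_codes(1) by auto
  qed (auto simp: node_def coded_branch_num)
  have "definable M (\<lambda>e. node (e 0))"
    unfolding node_def by (intro definable_intros ch_in omega_in)
  moreover have "\<not> node \<bottom>"
    using node_iff branch_closed_infinite[OF splits infinite_B] finite_below_bot by metis
  ultimately obtain I where I_maximal: "I \<in> M" "ideal_avoiding node (elts I)"
    "\<forall>J\<in>M. ideal_avoiding node (elts J) \<and> elts I \<subseteq> elts J \<longrightarrow> J = I"
    by (rule maximal_ideal_avoiding)
  have "\<exists>c. node c \<and> le_mod (elts I) c a" if "a \<in> B" "a \<notin> elts I" for a
    using le_mod_maximal_ideal_avoiding[OF I_maximal that] .
  then have "tree_dense_mod (chosen_split ch) (elts I)"
    using I_maximal(2) unfolding tree_dense_mod_def ideal_avoiding_def node_iff by blast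
  then show thesis
    using that I_maximal(1) by blast
qed

end

locale generic_boolean = generic_forcing V P R G + boolean_algebra_zfc V A
  for V :: "'a::set_universe set" and P R G A
begin

sublocale VG: boolean_algebra_in VG A
proof
  show "ba_in A VG"
    using ba_in V_subset_VG unfolding ba_in_def by blast
qed

lemma VG_convergent_sequence_minimally_infinite:
  assumes "minimally_infinite a"
  shows "has_nontrivial_convergent_sequence VG A"
proof -
  obtain ch where ch_chooses: "ch \<in> V"
    "\<And>Q. definable V (\<lambda>e. Q (e 0)) \<Longrightarrow> \<exists>b\<in>B. Q b \<Longrightarrow> chosen ch Q \<in> B \<and> Q (chosen ch Q)"
    using choice_on_carrier by blast
  have "ch \<in> VG"
    using ch_chooses(1) V_subset_VG by blast
  then show ?thesis
    using assms
  proof (rule VG.convergent_sequence_minimally_infinite)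
    fix c assume atom_below_c: "c \<in> B" "\<exists>p. atom p \<and> p \<sqsubseteq> c"
    have "definable V (\<lambda>e. atom (e 0) \<and> e 0 \<sqsubseteq> c)"
      by (intro definable_intros carrier_elem_in atom_below_c(1))
    then show "atom (chosen_atom ch c) \<and> chosen_atom ch c \<sqsubseteq> c"
      unfolding chosen_atom_def
      using ch_chooses(2)[of "\<lambda>p. atom p \<and> p \<sqsubseteq> c"] atom_below_c(2) atom_closed by blast
  qed
qed

lemma VG_convergent_sequence_splitting:
  assumes infinite_B: "infinite B" and no_minimal: "\<not> (\<exists>a. minimally_infinite a)"
    and x_Cohen: "x \<in> VG" "Cohen_real V x"
  shows "has_nontrivial_convergent_sequence VG A"
proof -
  obtain ch where ch_chooses: "ch \<in> V"
    "\<And>Q. definable V (\<lambda>e. Q (e 0)) \<Longrightarrow> \<exists>b\<in>B. Q b \<Longrightarrow> chosen ch Q \<in> B \<and> Q (chosen ch Q)"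
    using choice_on_carrier by blast
  have splits: "splitting (chosen_split ch)"
    unfolding splitting_def chosen_split_def
  proof (intro ballI impI)
    fix a assume a_infinite: "a \<in> B" "\<not> finite_below a"
    let ?Q = "\<lambda>b. \<not> finite_below (a \<sqinter> b) \<and> \<not> finite_below (a \<sqinter> \<sim> b)"
    have "definable V (\<lambda>e. ?Q (e 0))"
      by (intro definable_intros carrier_elem_in a_infinite(1))
    moreover have "\<exists>b\<in>B. ?Q b"
      using no_minimal a_infinite unfolding minimally_infinite_def by blast
    ultimately show "chosen ch ?Q \<in> B \<and> ?Q (chosen ch ?Q)"
      by (rule ch_chooses(2))
  qed
  obtain I where I_tree_dense: "I \<in> V" "tree_dense_mod (chosen_split ch) (elts I)"
    using tree_dense_ideal_exists[OF ch_chooses(1) splits infinite_B] .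
  have "ch \<in> VG" "I \<in> VG"
    using ch_chooses(1) I_tree_dense(1) V_subset_VG by blast+
  moreover have "\<exists>k. decides_mod (elts I) (branch (chosen_split ch) (flip_bit n (bits x)) k) a"
    if "n \<in> insert omega (elts omega)" "a \<in> B" for n a :: 'a
    using Cohen_real_decides[OF ch_chooses(1) I_tree_dense(1) infinite_B splits I_tree_dense(2)
      x_Cohen(2) _ that(2)] that(1) omega_in num_in by auto
  ultimately show ?thesis
    using VG.convergent_sequence_branches[OF _ x_Cohen(1) _ infinite_B splits I_tree_dense(2)]
    by blast
qed

end

theorem theorem3p2:
  fixes V :: "'a::set_universe set"
    and P R :: 'a
    and A :: "'a ba"
  assumes "transitive_model_ZFC V"
    and "P \<in> V" and "R \<in> V" and "forcing_notion P R"
    and "adds_Cohen_real V P R"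
    and "ba_in A V" and "is_boolean_algebra A" and "infinite (elts (carr A))"
  shows "\<forall>G. generic_filter V P R G \<longrightarrow>
           (\<exists>s. stone_sequence (generic_extension V P G) A s \<and>
                stone_nontrivial (generic_extension V P G) A s \<and>
                (\<exists>u. stone_tendsto (generic_extension V P G) A s u))"
proof (intro allI impI)
  fix G assume G_generic: "generic_filter V P R G"
  interpret transitive_zfc V
    by (rule transitive_zfc_model[OF assms(1)])
  interpret generic_boolean V P R G A
    by unfold_locales (fact assms G_generic)+
  obtain x where x_Cohen: "x \<in> VG" "Cohen_real V x"
    using assms(5) G_generic unfolding adds_Cohen_real_def by blast
  have "has_nontrivial_convergent_sequence VG A"
  proof (cases "\<exists>a. minimally_infinite a")
    case True
    then show ?thesis
      using VG_convergent_sequence_minimally_infinite by blast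
  next
    case False
    then show ?thesis
      by (rule VG_convergent_sequence_splitting[OF assms(8) _ x_Cohen])
  qed
  then show "\<exists>s. stone_sequence VG A s \<and> stone_nontrivial VG A s \<and>
      (\<exists>u. stone_tendsto VG A s u)"
    unfolding has_nontrivial_convergent_sequence_def .
qed

end
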